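(* There is an absolute constant $C$ such that the following holds. Let $p$ be a nonconstant complex polynomial, let $\Omega \subset \mathbb{C}$ be a semi-algebraic open set, and let $\lambda \colon \mathbb{C} \to (0,\infty)$ be an arbitrary smooth everywhere positive function. Then $$\ell(\partial E_1(p) \cap \overline{\Omega}) \leq \Psi(E_2(p) \cap \Omega) + C\,(X_1 + X_2 + X_3 + X_4 + X_5),$$ where $$X_1 = \int_{E_2(p) \cap \Omega} |p'|\, dA, \qquad X_2 = \int_{E_2(p) \cap \Omega,\ |\psi| \leq \lambda} |\psi|\, dA, \qquad X_3 = \int_{E_2(p) \cap \Omega,\ |\psi| \geq \lambda/2} \frac{|\psi'|}{|\psi|}\, dA,$$ $$X_4 = \int_{E_2(p) \cap \Omega} \frac{|\lambda'|}{|\lambda|}\, dA, \qquad X_5 = \ell(\partial \Omega).$$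
   Context: For $R \ge 0$, $E_R(p) = \{z \in \mathbb{C} : |p(z)| < R\}$ and $\partial E_R(p) = \{z \in \mathbb{C} : |p(z)| = R\}$. $\ell$ denotes arclength and $dA$ denotes area measure. $\psi(z) = p''(z)/p'(z)$ is the logarithmic derivative of $p'$. $\Psi$ is the absolutely continuous measure on $\mathbb{C}$ given by $\Psi(E) = \frac{1}{\pi}\int_E |\psi|\, dA$. A set $\Omega$ is semi-algebraic if it is defined by finitely many polynomial inequalities in the real and imaginary parts of $z$. $|\lambda'|$ denotes the magnitude of the gradient of $\lambda$ (any choice between this and the Wirtinger derivative $|\partial\lambda|$ changes it only by a factor of 2). *)

theory Defs
  imports "HOL-Analysis.Analysis" "HOL-Computational_Algebra.Polynomial"
begin

definition sublevel :: "real \<Rightarrow> complex poly \<Rightarrow> complex set" where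
  "sublevel R p = {z. cmod (poly p z) < R}"

definition level :: "real \<Rightarrow> complex poly \<Rightarrow> complex set" where
  "level R p = {z. cmod (poly p z) = R}"

text \<open>
  Arclength of a plane set is its one-dimensional Hausdorff measure, normalised so that a segment
  has its usual length. The boundedness condition is needed because \<^const>\<open>diameter\<close> is a real
  supremum, which is meaningless for unbounded sets.
\<close>

definition arclength_pre :: "real \<Rightarrow> complex set \<Rightarrow> ennreal" where
  "arclength_pre \<delta> S =
     (INF A \<in> {A :: nat \<Rightarrow> complex set. S \<subseteq> (\<Union>i. A i) \<and> (\<forall>i. bounded (A i) \<and> diameter (A i) \<le> \<delta>)}.
        \<Sum>i. ennreal (diameter (A i)))"

definition arclength :: "complex set \<Rightarrow> ennreal" where
  "arclength S = (SUP \<delta> \<in> {0<..}. arclength_pre \<delta> S)"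

text \<open>
  On \<^typ>\<open>complex\<close>, a \<^const>\<open>real_polynomial_function\<close> is exactly a real polynomial in the real and
  imaginary parts. Non-strict inequalities and equations arise through complements.
\<close>

inductive semialgebraic :: "complex set \<Rightarrow> bool" where
  pos: "real_polynomial_function q \<Longrightarrow> semialgebraic {z. q z > 0}"
| compl: "semialgebraic A \<Longrightarrow> semialgebraic (- A)"
| inter: "semialgebraic A \<Longrightarrow> semialgebraic B \<Longrightarrow> semialgebraic (A \<inter> B)"
| union: "semialgebraic A \<Longrightarrow> semialgebraic B \<Longrightarrow> semialgebraic (A \<union> B)"

text \<open>Real differentiability of all orders on the plane.\<close>

primrec times_cont_diff :: "nat \<Rightarrow> (complex \<Rightarrow> real) \<Rightarrow> bool" where
  "times_cont_diff 0 f \<longleftrightarrow> continuous_on UNIV f"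
| "times_cont_diff (Suc k) f \<longleftrightarrow>
     (\<forall>z. f differentiable (at z)) \<and> (\<forall>v. times_cont_diff k (\<lambda>z. frechet_derivative f (at z) v))"

definition smooth :: "(complex \<Rightarrow> real) \<Rightarrow> bool" where
  "smooth f \<longleftrightarrow> (\<forall>k. times_cont_diff k f)"

definition grad :: "(complex \<Rightarrow> real) \<Rightarrow> complex \<Rightarrow> complex" where
  "grad f z = (THE D. GDERIV f z :> D)"

lemma grad_eqI:
  assumes "GDERIV f z :> D"
  shows "grad f z = D"
  unfolding grad_def
proof (rule the_equality)
  fix D' assume "GDERIV f z :> D'"
  then have "(\<lambda>h. inner h D') = (\<lambda>h. inner h D)"
    using assms unfolding gderiv_def by (rule has_derivative_unique)
  then show "D' = D"
    by (metis inner_commute vector_eq_rdot)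
qed (fact assms)

text \<open>
  The value 0 at critical points of \<open>p\<close> (division by zero) is immaterial: for nonconstant \<open>p\<close>
  they form a finite set, and \<^term>\<open>deriv (log_deriv p)\<close> is used only under area integrals.
\<close>

definition log_deriv :: "complex poly \<Rightarrow> complex \<Rightarrow> complex" where
  "log_deriv p z = poly (pderiv (pderiv p)) z / poly (pderiv p) z"

definition Psi :: "complex poly \<Rightarrow> complex measure" where
  "Psi p = density lborel (\<lambda>z. ennreal (cmod (log_deriv p z) / pi))"

lemma log_deriv_measurable [measurable]: "log_deriv p \<in> borel_measurable borel"
proof -
  have [measurable]: "poly q \<in> borel_measurable borel" for q :: "complex poly"
    by (intro borel_measurable_continuous_onI continuous_intros)
  show ?thesis
    unfolding log_deriv_def[abs_def] by measurable
qed

lemma emeasure_Psi: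
  assumes [measurable]: "E \<in> sets borel"
  shows "emeasure (Psi p) E = ennreal (1 / pi) * (\<integral>\<^sup>+z\<in>E. ennreal (cmod (log_deriv p z)) \<partial>lborel)"
proof -
  have "emeasure (Psi p) E = (\<integral>\<^sup>+z\<in>E. ennreal (cmod (log_deriv p z) / pi) \<partial>lborel)"
    unfolding Psi_def by (subst emeasure_density) auto
  also have "\<dots> = (\<integral>\<^sup>+z. ennreal (1 / pi) * (ennreal (cmod (log_deriv p z)) * indicator E z) \<partial>lborel)"
    by (intro nn_integral_cong) (simp add: ennreal_mult[symmetric] mult.assoc[symmetric])
  also have "\<dots> = ennreal (1 / pi) * (\<integral>\<^sup>+z\<in>E. ennreal (cmod (log_deriv p z)) \<partial>lborel)"
    by (rule nn_integral_cmult) auto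
  finally show ?thesis .
qed

definition X1 :: "complex poly \<Rightarrow> complex set \<Rightarrow> ennreal" where
  "X1 p \<Omega> = (\<integral>\<^sup>+z \<in> sublevel 2 p \<inter> \<Omega>. ennreal (cmod (poly (pderiv p) z)) \<partial>lborel)"

definition X2 :: "complex poly \<Rightarrow> complex set \<Rightarrow> (complex \<Rightarrow> real) \<Rightarrow> ennreal" where
  "X2 p \<Omega> l =
     (\<integral>\<^sup>+z \<in> sublevel 2 p \<inter> \<Omega> \<inter> {z. cmod (log_deriv p z) \<le> l z}.
        ennreal (cmod (log_deriv p z)) \<partial>lborel)"

definition X3 :: "complex poly \<Rightarrow> complex set \<Rightarrow> (complex \<Rightarrow> real) \<Rightarrow> ennreal" where
  "X3 p \<Omega> l =
     (\<integral>\<^sup>+z \<in> sublevel 2 p \<inter> \<Omega> \<inter> {z. cmod (log_deriv p z) \<ge> l z / 2}.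
        ennreal (cmod (deriv (log_deriv p) z) / cmod (log_deriv p z)) \<partial>lborel)"

definition X4 :: "complex poly \<Rightarrow> complex set \<Rightarrow> (complex \<Rightarrow> real) \<Rightarrow> ennreal" where
  "X4 p \<Omega> l = (\<integral>\<^sup>+z \<in> sublevel 2 p \<inter> \<Omega>. ennreal (cmod (grad l z) / \<bar>l z\<bar>) \<partial>lborel)"

definition X5 :: "complex set \<Rightarrow> ennreal" where
  "X5 \<Omega> = arclength (frontier \<Omega>)"

end

theory Submission
  imports Defs "HOL-Computational_Algebra.Fundamental_Theorem_Algebra"
begin

text \<open>
  Write \<open>\<psi> = p'' / p'\<close>. The unit field \<open>n = sgn (p / p')\<close> is normal to the level sets of \<open>|p|\<close>, and
  its divergence is \<open>|p'| / |p| - Re (\<psi> n)\<close>. Apply the divergence theorem in \<open>\<Omega>\<close> to \<open>n\<close> multiplied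
  by the sign of \<open>|p| - 1\<close> and by a cutoff concentrated on \<open>1/2 < |p| < 3/2\<close>. The jump of the sign
  contributes twice the length of the level curve, because flux is collected from both of its sides.
  Everything else is at most the integral of \<open>|Re (\<psi> n)|\<close> up to multiples of \<open>X1\<close> and of the
  length of the boundary (\<open>level_flux_le\<close>). So twice the length is essentially at most the integral of
  \<open>|\<psi>| |cos \<theta>|\<close>, where \<open>\<theta>\<close> is the argument of \<open>\<psi> p / p'\<close>.

  The constant \<open>1 / pi\<close> appears because \<open>|cos \<theta>|\<close> may be replaced by its mean \<open>2 / pi\<close>. As long as
  \<open>\<psi>\<close> varies slowly and \<open>|p'|\<close> is small, the angle \<open>\<theta>\<close> rotates at rate \<open>|\<psi>|\<close> along the unit field
  \<open>F = sgn (- \<i> / \<psi>)\<close>. If \<open>G\<close> is the periodic antiderivative of \<open>|cos| - 2 / pi\<close>, then the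
  divergence of \<open>G (\<theta>) F\<close> is \<open>|\<psi>| (|cos \<theta>| - 2 / pi)\<close> up to terms of size \<open>|p'|\<close> and
  \<open>|\<psi>'| / |\<psi>|\<close>, and a second application of the divergence theorem bounds the integral of this
  oscillation (\<open>angle_flux_le\<close>). The field \<open>F\<close> is useful only where \<open>|\<psi>|\<close> is not too small; the
  threshold is \<open>l\<close>, and cutting off there produces \<open>X2\<close>, \<open>X3\<close> and \<open>X4\<close>.

  Two general tools are needed. For open sets whose frontier merely has finite Hausdorff length,
  the divergence theorem holds with an absolute constant in front of the boundary term
  (\<open>stokes_le\<close>); this loss is harmless as \<open>X5\<close> carries a constant anyway. The jump, on the other
  hand, has to be turned into arclength without any loss, which is a lower bound in the coarea formula
  (\<open>level_set_arclength_le\<close>). If \<open>X5\<close> is infinite there is nothing to prove.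
\<close>

section \<open>Arclength\<close>

lemma arclength_pre_mono: "S \<subseteq> T \<Longrightarrow> arclength_pre \<delta> S \<le> arclength_pre \<delta> T"
  unfolding arclength_pre_def by (intro INF_superset_mono) auto

lemma arclength_mono: "S \<subseteq> T \<Longrightarrow> arclength S \<le> arclength T"
  unfolding arclength_def by (intro SUP_mono') (auto intro: arclength_pre_mono)

lemma arclength_pre_le_arclength: "\<delta> > 0 \<Longrightarrow> arclength_pre \<delta> S \<le> arclength S"
  unfolding arclength_def by (rule SUP_upper) simp

lemma arclength_leI: "(\<And>\<delta>. \<delta> > 0 \<Longrightarrow> arclength_pre \<delta> S \<le> B) \<Longrightarrow> arclength S \<le> B"
  unfolding arclength_def by (rule SUP_least) auto

lemma arclength_pre_leI:
  assumes "S \<subseteq> (\<Union>i. A i)" "\<And>i. bounded (A i)" "\<And>i. diameter (A i) \<le> \<delta>"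
  shows "arclength_pre \<delta> S \<le> (\<Sum>i. ennreal (diameter (A i)))"
  unfolding arclength_pre_def using assms by (intro INF_lower) auto

text \<open>
  Countable subadditivity needs \<open>\<delta>\<close>-covers of all the pieces at once: near-optimal covers, with
  errors summing to \<open>e\<close>, are merged into a single sequence by pairing indices.
\<close>

lemma arclength_pre_UN_le:
  assumes "\<delta> > 0"
  shows "arclength_pre \<delta> (\<Union>i::nat. A i) \<le> (\<Sum>i. arclength_pre \<delta> (A i))"
proof (rule ennreal_le_epsilon)
  fix e :: real
  assume fin: "(\<Sum>i. arclength_pre \<delta> (A i)) < top" and e: "e > 0"
  have fin1: "arclength_pre \<delta> (A i) < top" for i
    using fin by (rule ennreal_suminf_lessD)
  have "\<exists>B. A i \<subseteq> (\<Union>j. B j) \<and> (\<forall>j. bounded (B j) \<and> diameter (B j) \<le> \<delta>) \<and>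
      (\<Sum>j. ennreal (diameter (B j))) \<le> arclength_pre \<delta> (A i) + ennreal (e * (1/2) ^ Suc i)" for i
  proof -
    have "arclength_pre \<delta> (A i) < arclength_pre \<delta> (A i) + ennreal (e * (1/2) ^ Suc i)"
      using fin1[of i] e by (simp add: ennreal_zero_less_mult_iff less_top)
    then show ?thesis
      unfolding arclength_pre_def[of _ "A i"] INF_less_iff by (auto intro: less_imp_le)
  qed
  then obtain B where B: "\<And>i. A i \<subseteq> (\<Union>j. B i j)" "\<And>i j. bounded (B i j)"
      "\<And>i j. diameter (B i j) \<le> \<delta>"
      "\<And>i. (\<Sum>j. ennreal (diameter (B i j))) \<le> arclength_pre \<delta> (A i) + ennreal (e * (1/2) ^ Suc i)"
    by metis
  let ?D = "\<lambda>n. case prod_decode n of (i, j) \<Rightarrow> B i j"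
  have "arclength_pre \<delta> (\<Union>i. A i) \<le> (\<Sum>n. ennreal (diameter (?D n)))"
  proof (rule arclength_pre_leI)
    show "(\<Union>i. A i) \<subseteq> (\<Union>n. ?D n)"
    proof
      fix x assume "x \<in> (\<Union>i. A i)"
      then obtain i j where "x \<in> B i j"
        using B(1) by blast
      then have "x \<in> ?D (prod_encode (i, j))"
        by simp
      then show "x \<in> (\<Union>n. ?D n)" by (rule UN_I[OF UNIV_I])
    qed
  qed (auto split: prod.split simp: B)
  also have "\<dots> = (\<Sum>n. (\<lambda>(i, j). ennreal (diameter (B i j))) (prod_decode n))"
    by (intro suminf_cong) (auto split: prod.split)
  also have "\<dots> = (\<Sum>i. \<Sum>j. ennreal (diameter (B i j)))"
    by (rule suminf_ennreal_2dimen) simp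
  also have "\<dots> \<le> (\<Sum>i. arclength_pre \<delta> (A i) + ennreal (e * (1/2) ^ Suc i))"
    by (intro suminf_le B(4)) auto
  also have "\<dots> = (\<Sum>i. arclength_pre \<delta> (A i)) + (\<Sum>i. ennreal (e * (1/2) ^ Suc i))"
    by (intro suminf_add[symmetric]) auto
  also have "(\<Sum>i. ennreal (e * (1/2) ^ Suc i)) = ennreal e"
  proof (rule suminf_ennreal_eq)
    show "(\<lambda>i. e * (1/2) ^ Suc i) sums e"
      using sums_mult[OF power_half_series, of e] by simp
  qed (use e in simp)
  finally show "arclength_pre \<delta> (\<Union>i. A i) \<le> (\<Sum>i. arclength_pre \<delta> (A i)) + ennreal e" .
qed

lemma arclength_UN_nat_le: "arclength (\<Union>i::nat. A i) \<le> (\<Sum>i. arclength (A i))"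
proof (rule arclength_leI)
  fix \<delta> :: real assume \<delta>: "\<delta> > 0"
  have "arclength_pre \<delta> (\<Union>i. A i) \<le> (\<Sum>i. arclength_pre \<delta> (A i))"
    by (rule arclength_pre_UN_le[OF \<delta>])
  also have "\<dots> \<le> (\<Sum>i. arclength (A i))"
    by (intro suminf_le arclength_pre_le_arclength \<delta>) auto
  finally show "arclength_pre \<delta> (\<Union>i. A i) \<le> (\<Sum>i. arclength (A i))" .
qed

lemma arclength_empty [simp]: "arclength {} = 0"
proof -
  have "arclength {} \<le> 0"
  proof (rule arclength_leI)
    fix \<delta> :: real assume "\<delta> > 0"
    then have "arclength_pre \<delta> {} \<le> (\<Sum>i::nat. ennreal (diameter ({}::complex set)))"
      by (intro arclength_pre_leI) auto
    then show "arclength_pre \<delta> {} \<le> 0" by simp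
  qed
  then show ?thesis by simp
qed

text \<open>
  The sum over an arbitrary countable index set is written as an integral over counting measure, so
  that convergence theorems for integrals apply to it.
\<close>

lemma arclength_UN_countable_le:
  assumes I: "countable I"
  shows "arclength (\<Union>i\<in>I. A i) \<le> (\<integral>\<^sup>+i. arclength (A i) \<partial>count_space I)"
proof -
  let ?J = "to_nat_on I ` I"
  let ?B = "\<lambda>n. if n \<in> ?J then A (from_nat_into I n) else {}"
  have "(\<Union>i\<in>I. A i) \<subseteq> (\<Union>n. ?B n)"
  proof
    fix x assume "x \<in> (\<Union>i\<in>I. A i)"
    then obtain i where i: "i \<in> I" "x \<in> A i" by blast
    then have "x \<in> ?B (to_nat_on I i)"
      using I by simp
    then show "x \<in> (\<Union>n. ?B n)" by blast
  qed
  then have "arclength (\<Union>i\<in>I. A i) \<le> arclength (\<Union>n. ?B n)"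
    by (rule arclength_mono)
  also have "\<dots> \<le> (\<Sum>n. arclength (?B n))"
    by (rule arclength_UN_nat_le)
  also have "\<dots> = (\<integral>\<^sup>+n. arclength (?B n) \<partial>count_space UNIV)"
    by (simp add: nn_integral_count_space_nat)
  also have "\<dots> = (\<integral>\<^sup>+n. arclength (A (from_nat_into I n)) * indicator ?J n \<partial>count_space UNIV)"
    by (intro nn_integral_cong) auto
  also have "\<dots> = (\<integral>\<^sup>+n. arclength (A (from_nat_into I n)) \<partial>count_space ?J)"
    by (simp add: nn_integral_count_space_indicator)
  also have "\<dots> = (\<integral>\<^sup>+i. arclength (A (from_nat_into I (to_nat_on I i))) \<partial>count_space I)"
    using I by (intro nn_integral_bij_count_space[symmetric])
      (auto simp: bij_betw_def inj_on_to_nat_on)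
  also have "\<dots> = (\<integral>\<^sup>+i. arclength (A i) \<partial>count_space I)"
    using I by (intro nn_integral_cong) auto
  finally show ?thesis .
qed

lemma arclength_Un_le: "arclength (A \<union> B) \<le> arclength A + arclength B"
proof -
  have "arclength (A \<union> B) = arclength (\<Union>b\<in>{False, True}. if b then A else B)"
    by (intro arg_cong[where f = arclength]) auto
  also have "\<dots> \<le> (\<integral>\<^sup>+b. arclength (if b then A else B) \<partial>count_space {False, True})"
    by (rule arclength_UN_countable_le) simp
  also have "\<dots> = arclength A + arclength B"
    by (subst nn_integral_count_space_finite) (auto simp: add.commute)
  finally show ?thesis .
qed

lemma arclength_countable:
  assumes "countable S"
  shows "arclength S = 0"
proof -
  have 1: "arclength {x} = 0" for x
  proof -
    have "arclength {x} \<le> 0"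
    proof (rule arclength_leI)
      fix \<delta> :: real assume "\<delta> > 0"
      then have "arclength_pre \<delta> {x} \<le> (\<Sum>i::nat. ennreal (diameter {x}))"
        by (intro arclength_pre_leI) auto
      then show "arclength_pre \<delta> {x} \<le> 0" by simp
    qed
    then show ?thesis by simp
  qed
  have "arclength (\<Union>x\<in>S. {x}) \<le> 0"
    using arclength_UN_countable_le[OF assms, of "\<lambda>x. {x}"] by (simp add: 1)
  then show ?thesis by simp
qed

text \<open>
  A set on which one real coordinate \<open>\<pi>\<close> controls the distance is a Lipschitz graph over the image of
  \<open>\<pi>\<close>. Cutting an interval into equal short pieces yields admissible covers at every scale.
\<close>

lemma arclength_le_of_coordinate_interval:
  fixes \<pi> :: "complex \<Rightarrow> real"
  assumes L: "L \<ge> 0" and lip: "\<And>z w. z \<in> A \<Longrightarrow> w \<in> A \<Longrightarrow> dist z w \<le> L * \<bar>\<pi> z - \<pi> w\<bar>"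
    and sub: "\<pi> ` A \<subseteq> {a..b}" and ab: "a \<le> b"
  shows "arclength A \<le> ennreal (L * (b - a))"
proof (rule arclength_leI)
  fix \<delta> :: real assume \<delta>: "\<delta> > 0"
  obtain N :: nat where N: "N > 0" "L * (b - a) \<le> \<delta> * real N"
  proof -
    obtain N :: nat where "L * (b - a) / \<delta> < real N"
      using reals_Archimedean2 by blast
    then show ?thesis
      using \<delta> by (intro that[of "Suc N"]) (auto simp: field_simps)
  qed
  define s where "s = (b - a) / N"
  have s: "s \<ge> 0" "N * s = b - a"
    using ab N by (auto simp: s_def)
  define B where "B i = (if i < N then A \<inter> \<pi> -` {a + i * s .. a + Suc i * s} else {})" for i
  have bd: "dist z w \<le> L * s" if "z \<in> B i" "w \<in> B i" for z w i
  proof -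
    have "z \<in> A" "w \<in> A" "\<bar>\<pi> z - \<pi> w\<bar> \<le> s"
      using that by (auto simp: B_def algebra_simps split: if_splits)
    then show ?thesis
      using lip[of z w] L by (meson mult_left_mono order_trans)
  qed
  have bnd: "bounded (B i)" for i
    unfolding bounded_two_points using bd by blast
  have Ls: "L * s \<ge> 0" using L s by simp
  have diam: "diameter (B i) \<le> L * s" for i
    by (rule diameter_le) (use Ls bd in \<open>auto simp: dist_norm\<close>)
  have Ls\<delta>: "L * s \<le> \<delta>"
    using N by (simp add: s_def field_simps)
  have "arclength_pre \<delta> A \<le> (\<Sum>i. ennreal (diameter (B i)))"
  proof (rule arclength_pre_leI)
    show "A \<subseteq> (\<Union>i. B i)"
    proof
      fix z assume z: "z \<in> A"
      then have ab': "a \<le> \<pi> z" "\<pi> z \<le> b" using sub by auto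
      show "z \<in> (\<Union>i. B i)"
      proof (cases "\<pi> z = b")
        case True
        have "z \<in> B (N - 1)"
          using N(1) z True s by (auto simp: B_def of_nat_diff algebra_simps)
        then show ?thesis by blast
      next
        case False
        then have lt: "\<pi> z < b" using ab' by simp
        then have "b - a > 0" using ab' by simp
        then have s0: "s > 0" using N by (simp add: s_def)
        define i where "i = nat \<lfloor>(\<pi> z - a) / s\<rfloor>"
        have i1: "real i = of_int \<lfloor>(\<pi> z - a) / s\<rfloor>"
          unfolding i_def using ab' s0 by (subst of_nat_nat) (auto simp: field_simps)
        have i2: "real i \<le> (\<pi> z - a) / s" "(\<pi> z - a) / s < real i + 1"
          unfolding i1 by linarith+
        have "real i * s \<le> \<pi> z - a" "\<pi> z - a < (real i + 1) * s"
          using i2 s0 by (auto simp: field_simps)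
        moreover have "real i * s < real N * s"
          using calculation(1) lt s(2) by linarith
        then have "i < N" using s0 by simp
        ultimately have "z \<in> B i"
          using z by (auto simp: B_def algebra_simps)
        then show ?thesis by blast
      qed
    qed
  qed (use bnd diam Ls\<delta> in \<open>auto intro: order_trans\<close>)
  also have "\<dots> = (\<Sum>i<N. ennreal (diameter (B i)))"
    by (rule suminf_finite) (auto simp: B_def)
  also have "\<dots> \<le> (\<Sum>i<N. ennreal (L * s))"
    by (intro sum_mono ennreal_leI diam)
  also have "\<dots> = ennreal (L * (b - a))"
  proof -
    have "real N * (L * s) = L * (b - a)"
      using s(2) by (metis mult.left_commute)
    then show ?thesis
      using ennreal_mult[of "real N" "L * s"] Ls by (simp only: ennreal_of_nat_eq_real_of_nat sum_constant card_lessThan of_nat_0_le_iff)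
  qed
  finally show "arclength_pre \<delta> A \<le> ennreal (L * (b - a))" .
qed

text \<open>
  Replacing the interval by a measurable set \<open>T\<close>: cover \<open>T\<close> by countably many non-overlapping
  intervals of total length at most \<open>|T| + d\<close> and apply the previous bound above each of them.
\<close>

lemma arclength_le_of_coordinate:
  fixes \<pi> :: "complex \<Rightarrow> real"
  assumes L: "L \<ge> 0" and lip: "\<And>z w. z \<in> A \<Longrightarrow> w \<in> A \<Longrightarrow> dist z w \<le> L * \<bar>\<pi> z - \<pi> w\<bar>"
    and sub: "\<pi> ` A \<subseteq> T" and T: "T \<in> sets lborel" "T \<subseteq> {a..b}"
  shows "arclength A \<le> ennreal L * emeasure lborel T"
proof -
  have "emeasure lborel {a..b} < \<infinity>"
    by (simp add: emeasure_lborel_Icc_eq)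
  then have "emeasure lborel T < \<infinity>"
    using emeasure_mono[OF T(2), of lborel] by (simp add: le_less_trans)
  then have Tl: "T \<in> lmeasurable"
    using T(1) by (intro fmeasurableI) simp_all
  show ?thesis
  proof (rule ennreal_le_epsilon)
    fix e :: real assume e: "e > 0"
    define d where "d = e / (L + 1)"
    have d: "d > 0" "L * d \<le> e" using e L by (auto simp: d_def field_simps)
    have sub': "T \<subseteq> cbox a b"
      using T(2) by simp
    obtain \<D> where \<D>: "countable \<D>"
        "\<And>K. K \<in> \<D> \<Longrightarrow> K \<subseteq> cbox a b \<and> K \<noteq> {} \<and> (\<exists>c d. K = cbox c d)"
        "pairwise (\<lambda>A B. interior A \<inter> interior B = {}) \<D>"
        "\<And>u v. cbox u v \<in> \<D> \<Longrightarrow> \<exists>n. \<forall>i \<in> Basis. v \<bullet> i - u \<bullet> i = (b \<bullet> i - a \<bullet> i)/2^n"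
        "\<And>K. \<lbrakk>K \<in> \<D>; box a b \<noteq> {}\<rbrakk> \<Longrightarrow> interior K \<noteq> {}"
        "T \<subseteq> \<Union>\<D>" "\<Union>\<D> \<in> lmeasurable" "measure lebesgue (\<Union>\<D>) \<le> measure lebesgue T + d"
      using measurable_outer_intervals_bounded[OF Tl sub' d(1)] by metis
    have len: "arclength (A \<inter> \<pi> -` K) \<le> ennreal L * emeasure lborel (interior K)" if K: "K \<in> \<D>" for K
    proof -
      obtain c d where "K = cbox c d" "K \<noteq> {}"
        using \<D>(2)[OF K] by blast
      then have cd: "K = {c..d}" "c \<le> d"
        by auto
      have "arclength (A \<inter> \<pi> -` K) \<le> ennreal (L * (d - c))"
        using cd by (intro arclength_le_of_coordinate_interval[of L _ \<pi>] L lip) auto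
      also have "\<dots> = ennreal L * emeasure lborel (interior K)"
        using cd L by (simp add: interior_atLeastAtMost_real ennreal_mult)
      finally show ?thesis .
    qed
    have "arclength A \<le> arclength (\<Union>K\<in>\<D>. A \<inter> \<pi> -` K)"
    proof (rule arclength_mono, rule subsetI)
      fix z assume z: "z \<in> A"
      then have "\<pi> z \<in> \<Union>\<D>" using sub \<D>(6) by (meson image_subset_iff subsetD)
      then show "z \<in> (\<Union>K\<in>\<D>. A \<inter> \<pi> -` K)" using z by auto
    qed
    also have "\<dots> \<le> (\<integral>\<^sup>+K. arclength (A \<inter> \<pi> -` K) \<partial>count_space \<D>)"
      by (rule arclength_UN_countable_le[OF \<D>(1)])
    also have "\<dots> \<le> (\<integral>\<^sup>+K. ennreal L * emeasure lborel (interior K) \<partial>count_space \<D>)"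
      by (intro nn_integral_mono) (auto simp: len)
    also have "\<dots> = ennreal L * (\<integral>\<^sup>+K. emeasure lborel (interior K) \<partial>count_space \<D>)"
      by (rule nn_integral_cmult) simp
    also have "(\<integral>\<^sup>+K. emeasure lborel (interior K) \<partial>count_space \<D>) = emeasure lborel (\<Union>K\<in>\<D>. interior K)"
    proof (rule emeasure_UN_countable[symmetric])
      show "disjoint_family_on interior \<D>"
        using \<D>(3) unfolding disjoint_family_on_def pairwise_def by metis
    qed (use \<D>(1) in simp_all)
    also have "\<dots> \<le> emeasure lebesgue (\<Union>\<D>)"
    proof -
      have "(\<Union>K\<in>\<D>. interior K) \<in> sets borel"
        using \<D>(1) by (intro sets.countable_UN') auto
      then have "emeasure lborel (\<Union>K\<in>\<D>. interior K) = emeasure lebesgue (\<Union>K\<in>\<D>. interior K)"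
        by simp
      also have "\<dots> \<le> emeasure lebesgue (\<Union>\<D>)"
        using interior_subset by (intro emeasure_mono fmeasurableD \<D>(7)) blast
      finally show ?thesis .
    qed
    also have "\<dots> \<le> emeasure lborel T + ennreal d"
    proof -
      have "emeasure lebesgue (\<Union>\<D>) = ennreal (measure lebesgue (\<Union>\<D>))"
        by (rule emeasure_eq_measure2[OF \<D>(7)])
      also have "\<dots> \<le> ennreal (measure lebesgue T + d)"
        by (rule ennreal_leI[OF \<D>(8)])
      also have "\<dots> = emeasure lebesgue T + ennreal d"
        unfolding emeasure_eq_measure2[OF Tl] using d(1) by (simp add: ennreal_plus)
      finally show ?thesis using T by simp
    qed
    finally have "arclength A \<le> ennreal L * (emeasure lborel T + ennreal d)"
      by (simp add: mult_left_mono)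
    also have "\<dots> = ennreal L * emeasure lborel T + ennreal (L * d)"
      using L d by (simp add: distrib_left ennreal_mult)
    also have "\<dots> \<le> ennreal L * emeasure lborel T + ennreal e"
      by (intro add_left_mono ennreal_leI d(2))
    finally show "arclength A \<le> ennreal L * emeasure lborel T + ennreal e" .
  qed
qed

section \<open>Integration by parts in the plane\<close>

lemma borel_measurable_Complex [measurable]:
  "(\<lambda>(x, y). Complex x y) \<in> borel_measurable (lborel \<Otimes>\<^sub>M lborel)"
proof -
  have "(\<lambda>z. Complex (fst z) (snd z)) \<in> borel_measurable borel"
    by (intro borel_measurable_continuous_onI continuous_intros)
  then show ?thesis
    by (simp add: lborel_prod split_beta')
qed

lemma lborel_complex_eq_distr:
  "lborel = distr (lborel \<Otimes>\<^sub>M lborel) borel (\<lambda>(x, y). Complex x y)"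
proof (rule lborel_eqI)
  fix l u :: complex
  assume le: "\<And>b. b \<in> Basis \<Longrightarrow> l \<bullet> b \<le> u \<bullet> b"
  then have le': "Re l \<le> Re u" "Im l \<le> Im u"
    using le[of 1] le[of \<i>] by (auto simp: Basis_complex_def)
  have "(\<lambda>(x, y). Complex x y) -` box l u \<inter> space (lborel \<Otimes>\<^sub>M lborel)
      = {Re l<..<Re u} \<times> {Im l<..<Im u}"
    by (auto simp: in_box_complex_iff space_pair_measure)
  then show "emeasure (distr (lborel \<Otimes>\<^sub>M lborel) borel (\<lambda>(x, y). Complex x y)) (box l u)
      = (\<Prod>b\<in>Basis. (u - l) \<bullet> b)"
    using le' by (simp add: emeasure_distr lborel.emeasure_pair_measure_Times Basis_complex_def
        ennreal_mult)
qed simp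

text \<open>
  Fubini's theorem, and later the slicing of level sets, is needed in both coordinate directions.
  A line in direction \<open>u\<close> is parametrised as \<open>x *\<^sub>R u + y *\<^sub>R v\<close>, which treats the two cases at once.
\<close>

definition axis_pair :: "complex \<Rightarrow> complex \<Rightarrow> bool" where
  "axis_pair u v \<longleftrightarrow> u = 1 \<and> v = \<i> \<or> u = \<i> \<and> v = 1"

lemma axis_pair_expand: "axis_pair u v \<Longrightarrow> z = (z \<bullet> u) *\<^sub>R u + (z \<bullet> v) *\<^sub>R v"
  unfolding axis_pair_def
proof (elim disjE conjE)
  assume "u = 1" "v = \<i>"
  then show ?thesis by (simp add: complex_eq_iff[of z])
next
  assume "u = \<i>" "v = 1"
  then show ?thesis by (simp add: complex_eq_iff[of z])
qed

lemma nn_integral_axis_pair: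
  assumes uv: "axis_pair u v" and [measurable]: "f \<in> borel_measurable borel"
  shows "(\<integral>\<^sup>+z. f z \<partial>lborel) = (\<integral>\<^sup>+y. \<integral>\<^sup>+x. f (x *\<^sub>R u + y *\<^sub>R v) \<partial>lborel \<partial>lborel)"
proof -
  have eq: "(\<integral>\<^sup>+z. f z \<partial>lborel) = (\<integral>\<^sup>+w. f (case w of (x, y) \<Rightarrow> Complex x y) \<partial>(lborel \<Otimes>\<^sub>M lborel))"
    by (subst lborel_complex_eq_distr, subst nn_integral_distr) simp_all
  show ?thesis
    using uv unfolding axis_pair_def
  proof (elim disjE conjE)
    assume "u = 1" "v = \<i>"
    moreover have "(\<integral>\<^sup>+z. f z \<partial>lborel) = (\<integral>\<^sup>+y. \<integral>\<^sup>+x. f (Complex x y) \<partial>lborel \<partial>lborel)"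
      unfolding eq by (subst lborel_pair.nn_integral_snd[symmetric]) (simp_all add: split_beta')
    ultimately show ?thesis by (simp add: Complex_eq mult.commute scaleR_conv_of_real)
  next
    assume "u = \<i>" "v = 1"
    moreover have "(\<integral>\<^sup>+z. f z \<partial>lborel) = (\<integral>\<^sup>+x. \<integral>\<^sup>+y. f (Complex x y) \<partial>lborel \<partial>lborel)"
      unfolding eq by (subst lborel.nn_integral_fst[symmetric]) (simp_all add: split_beta')
    ultimately show ?thesis by (simp add: Complex_eq mult.commute add.commute scaleR_conv_of_real)
  qed
qed

lemma integral_axis_pair:
  fixes f :: "complex \<Rightarrow> real"
  assumes uv: "axis_pair u v" and f: "integrable lborel f"
  shows "(\<integral>z. f z \<partial>lborel) = (\<integral>y. \<integral>x. f (x *\<^sub>R u + y *\<^sub>R v) \<partial>lborel \<partial>lborel)"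
proof -
  have [measurable]: "f \<in> borel_measurable borel" using f by auto
  have int: "integrable (lborel \<Otimes>\<^sub>M lborel) (\<lambda>(x, y). f (Complex x y))"
  proof -
    have "integrable (distr (lborel \<Otimes>\<^sub>M lborel) borel (\<lambda>(x, y). Complex x y)) f"
      using f by (simp flip: lborel_complex_eq_distr)
    then show ?thesis
      by (subst (asm) integrable_distr_eq) (auto simp: split_beta')
  qed
  have eq: "(\<integral>z. f z \<partial>lborel) = (\<integral>(x, y). f (Complex x y) \<partial>(lborel \<Otimes>\<^sub>M lborel))"
    by (subst lborel_complex_eq_distr, subst integral_distr) (simp_all add: split_beta')
  show ?thesis
    using uv unfolding axis_pair_def
  proof (elim disjE conjE)
    assume "u = 1" "v = \<i>"
    moreover have "(\<integral>z. f z \<partial>lborel) = (\<integral>y. \<integral>x. f (Complex x y) \<partial>lborel \<partial>lborel)"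
      unfolding eq by (rule lborel_pair.integral_snd[symmetric, OF int])
    ultimately show ?thesis by (simp add: Complex_eq mult.commute scaleR_conv_of_real)
  next
    assume "u = \<i>" "v = 1"
    moreover have "(\<integral>z. f z \<partial>lborel) = (\<integral>x. \<integral>y. f (Complex x y) \<partial>lborel \<partial>lborel)"
      unfolding eq using lborel_pair.integral_fst[OF int] by simp
    ultimately show ?thesis by (simp add: Complex_eq mult.commute add.commute scaleR_conv_of_real)
  qed
qed

text \<open>
  The derivative is carried along as explicit data, because the divergence of the vector fields below
  has to be computed and not only to exist.
\<close>

definition C1on ::
    "complex set \<Rightarrow> (complex \<Rightarrow> 'a::real_normed_vector) \<Rightarrow> (complex \<Rightarrow> complex \<Rightarrow> 'a) \<Rightarrow> bool" where
  "C1on U f D \<longleftrightarrow>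
     (\<forall>z\<in>U. (f has_derivative D z) (at z)) \<and> (\<forall>v. continuous_on U (\<lambda>z. D z v))"

lemma C1onI:
  assumes "\<And>z. z \<in> U \<Longrightarrow> (f has_derivative D z) (at z)" "\<And>v. continuous_on U (\<lambda>z. D z v)"
  shows "C1on U f D"
  using assms by (auto simp: C1on_def)

lemma C1onD: "C1on U f D \<Longrightarrow> z \<in> U \<Longrightarrow> (f has_derivative D z) (at z)"
  by (auto simp: C1on_def)

lemma C1on_continuous_derivative:
  "C1on U f D \<Longrightarrow> continuous_on U (\<lambda>z. D z v)"
  by (auto simp: C1on_def)

lemma C1on_continuous: "C1on U f D \<Longrightarrow> continuous_on U f"
  unfolding C1on_def
  by (meson continuous_at_imp_continuous_on has_derivative_continuous)

lemma C1on_subset: "C1on U f D \<Longrightarrow> V \<subseteq> U \<Longrightarrow> C1on V f D"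
  unfolding C1on_def by (meson continuous_on_subset subsetD)

lemma C1on_expand:
  fixes D :: "complex \<Rightarrow> complex \<Rightarrow> 'a::real_normed_vector"
  assumes "C1on U f D" "z \<in> U"
  shows "D z h = Re h *\<^sub>R D z 1 + Im h *\<^sub>R D z \<i>"
proof -
  interpret bounded_linear "D z"
    using C1onD[OF assms] by (rule has_derivative_bounded_linear)
  have "h = Re h *\<^sub>R 1 + Im h *\<^sub>R \<i>"
    by (simp add: complex_eq_iff)
  then have "D z h = D z (Re h *\<^sub>R 1 + Im h *\<^sub>R \<i>)" by simp
  then show ?thesis by (simp only: add scaleR)
qed

lemma C1on_scaleR:
  assumes a: "C1on U a A" and F: "C1on U F B"
  shows "C1on U (\<lambda>z. a z *\<^sub>R F z) (\<lambda>z h. a z *\<^sub>R B z h + A z h *\<^sub>R F z)"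
proof (rule C1onI)
  fix z assume "z \<in> U"
  then show "((\<lambda>z. a z *\<^sub>R F z) has_derivative (\<lambda>h. a z *\<^sub>R B z h + A z h *\<^sub>R F z)) (at z)"
    by (intro has_derivative_scaleR C1onD[OF a] C1onD[OF F])
next
  fix v
  show "continuous_on U (\<lambda>z. a z *\<^sub>R B z v + A z v *\<^sub>R F z)"
    by (intro continuous_intros C1on_continuous[OF a] C1on_continuous[OF F]
        C1on_continuous_derivative[OF a] C1on_continuous_derivative[OF F])
qed

lemma C1on_mult:
  fixes a F :: "complex \<Rightarrow> real"
  shows "C1on U a A \<Longrightarrow> C1on U F B \<Longrightarrow>
    C1on U (\<lambda>z. a z * F z) (\<lambda>z h. a z * B z h + A z h * F z)"
  using C1on_scaleR[of U a A F B] by simp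

lemma C1on_compose_real:
  fixes a :: "complex \<Rightarrow> real"
  assumes a: "C1on U a A" and r: "\<And>t. (r has_real_derivative r' t) (at t)"
    and r': "continuous_on UNIV r'"
  shows "C1on U (\<lambda>z. r (a z)) (\<lambda>z h. r' (a z) * A z h)"
proof (rule C1onI)
  fix z assume "z \<in> U"
  then have "(a has_derivative A z) (at z)" by (rule C1onD[OF a])
  from has_derivative_compose[OF this r[of "a z", unfolded has_field_derivative_def]]
  show "((\<lambda>z. r (a z)) has_derivative (\<lambda>h. r' (a z) * A z h)) (at z)" .
next
  fix v
  have "continuous_on U (\<lambda>z. r' (a z))"
    by (rule continuous_on_compose2[OF r' C1on_continuous[OF a]]) simp
  then show "continuous_on U (\<lambda>z. r' (a z) * A z v)"
    by (intro continuous_intros C1on_continuous_derivative[OF a])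
qed

lemma C1on_const: "C1on U (\<lambda>z. c) (\<lambda>z h. 0)"
  by (rule C1onI) auto

text \<open>
  At a point outside \<open>U\<close> the extended function vanishes near that point, so its derivative there is
  zero, and by uniqueness of derivatives \<open>E\<close> is zero at the nearby points of \<open>U\<close> too; this is what
  makes the extended derivative continuous.
\<close>

lemma C1on_glue_zero:
  fixes F :: "complex \<Rightarrow> 'a::real_normed_vector"
  assumes U: "open U" and F: "C1on U F E"
    and zero: "\<And>z. z \<notin> U \<Longrightarrow> \<exists>N. open N \<and> z \<in> N \<and> (\<forall>w\<in>N \<inter> U. F w = 0)"
  shows "C1on UNIV (\<lambda>z. if z \<in> U then F z else 0) (\<lambda>z. if z \<in> U then E z else (\<lambda>h. 0))"
    (is "C1on UNIV ?F ?E")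
proof -
  have deriv: "(?F has_derivative ?E z) (at z)" for z
  proof (cases "z \<in> U")
    case True
    then show ?thesis
      using has_derivative_transform_within_open[OF C1onD[OF F True] U True, of ?F] by simp
  next
    case False
    then obtain N where N: "open N" "z \<in> N" "\<forall>w\<in>N \<inter> U. F w = 0" using zero by blast
    have "((\<lambda>w. 0::'a) has_derivative (\<lambda>h. 0)) (at z)" by simp
    then have "(?F has_derivative (\<lambda>h. 0)) (at z)"
      by (rule has_derivative_transform_within_open[OF _ N(1,2)]) (use N(3) in auto)
    then show ?thesis using False by simp
  qed
  have cont: "isCont (\<lambda>z. ?E z v) z" for z v
  proof (cases "z \<in> U")
    case True
    then have "isCont (\<lambda>z. E z v) z"
      using F U by (auto simp: C1on_def continuous_on_eq_continuous_at)
    moreover have "\<forall>\<^sub>F w in nhds z. E w v = ?E w v"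
      using U True by (auto simp: eventually_nhds)
    ultimately show ?thesis
      by (subst (asm) isCont_cong) auto
  next
    case False
    then obtain N where N: "open N" "z \<in> N" "\<forall>w\<in>N \<inter> U. F w = 0" using zero by blast
    have "?E w = (\<lambda>h. 0)" if w: "w \<in> N" for w
    proof -
      have "((\<lambda>w. 0::'a) has_derivative (\<lambda>h. 0)) (at w)" by simp
      then have "(?F has_derivative (\<lambda>h. 0)) (at w)"
        by (rule has_derivative_transform_within_open[OF _ N(1) w]) (use N(3) in auto)
      then show ?thesis
        by (rule has_derivative_unique[OF deriv])
    qed
    then have "\<forall>\<^sub>F w in nhds z. 0 = ?E w v"
      unfolding eventually_nhds using N by (intro exI[of _ N]) (auto dest!: fun_cong)
    moreover have "isCont (\<lambda>w. 0 :: 'a) z" by simp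
    ultimately show ?thesis
      by (subst (asm) isCont_cong) auto
  qed
  show ?thesis
    by (rule C1onI) (use deriv cont in \<open>auto intro: continuous_at_imp_continuous_on\<close>)
qed

text \<open>
  This is the divergence theorem without boundary: integrate first along lines in direction \<open>u\<close>, where
  the fundamental theorem of calculus gives zero.
\<close>

lemma integral_partial_derivative_eq_0:
  fixes w :: "complex \<Rightarrow> real"
  assumes w: "C1on UNIV w D" and supp: "\<And>z. norm z \<ge> R \<Longrightarrow> w z = 0" and uv: "axis_pair u v"
  shows "integrable lborel (\<lambda>z. D z u)" and "(\<integral>z. D z u \<partial>lborel) = 0"
proof -
  define S where "S = \<bar>R\<bar> + 1"
  have S: "S \<ge> 0" "S > R" by (auto simp: S_def)
  have D0: "D z h = 0" if z: "norm z > R" for z h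
  proof -
    have o: "open {z::complex. norm z > R}"
      by (intro open_Collect_less continuous_intros)
    have "((\<lambda>z. 0) has_derivative (\<lambda>h. 0)) (at z)" by simp
    then have "(w has_derivative (\<lambda>h. 0)) (at z)"
      by (rule has_derivative_transform_within_open[OF _ o]) (use z supp in auto)
    then show ?thesis
      using has_derivative_unique[OF C1onD[OF w]] by (metis UNIV_I)
  qed
  show int: "integrable lborel (\<lambda>z. D z u)"
  proof -
    have "integrable lborel (\<lambda>z. indicator (cball 0 R) z *\<^sub>R D z u)"
      by (intro borel_integrable_compact) (use w in \<open>auto simp: C1on_def intro: continuous_on_subset\<close>)
    moreover have "(\<lambda>z. indicator (cball 0 R) z *\<^sub>R D z u) = (\<lambda>z. D z u)"
      using D0 by (auto simp: fun_eq_iff indicator_def)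
    ultimately show ?thesis by simp
  qed
  have contD: "isCont (\<lambda>z. D z u) z" for z
    using w by (auto simp: C1on_def continuous_on_eq_continuous_at)
  have big: "norm (x *\<^sub>R u + y *\<^sub>R v) > R" if "\<bar>x\<bar> \<ge> S" for x y
  proof -
    have "\<bar>x\<bar> \<le> norm (x *\<^sub>R u + y *\<^sub>R v)"
      using uv abs_Re_le_cmod[of "x *\<^sub>R u + y *\<^sub>R v"] abs_Im_le_cmod[of "x *\<^sub>R u + y *\<^sub>R v"]
      by (auto simp: axis_pair_def)
    then show ?thesis using that S by linarith
  qed
  have "(\<integral>x. D (x *\<^sub>R u + y *\<^sub>R v) u \<partial>lborel) = 0" for y
  proof -
    have "(\<integral>x. D (x *\<^sub>R u + y *\<^sub>R v) u \<partial>lborel)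
        = (\<integral>x. D (x *\<^sub>R u + y *\<^sub>R v) u * indicator {-S..S} x \<partial>lborel)"
      by (intro Bochner_Integration.integral_cong) (auto simp: indicator_def intro!: D0 big)
    also have "\<dots> = w (S *\<^sub>R u + y *\<^sub>R v) - w ((-S) *\<^sub>R u + y *\<^sub>R v)"
    proof (rule integral_FTC_Icc_real)
      fix x
      have "((\<lambda>x. x *\<^sub>R u + y *\<^sub>R v) has_derivative (\<lambda>h. h *\<^sub>R u)) (at x)"
        by (auto intro!: derivative_eq_intros)
      from has_derivative_compose[OF this C1onD[OF w UNIV_I]]
      have "((\<lambda>x. w (x *\<^sub>R u + y *\<^sub>R v)) has_derivative (\<lambda>h. D (x *\<^sub>R u + y *\<^sub>R v) (h *\<^sub>R u))) (at x)" .
      moreover have "D z (h *\<^sub>R u) = D z u * h" for z h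
        using linear_scale[OF has_derivative_linear[OF C1onD[OF w UNIV_I]], of z h u]
        by (simp add: mult.commute)
      ultimately show "((\<lambda>x. w (x *\<^sub>R u + y *\<^sub>R v)) has_real_derivative D (x *\<^sub>R u + y *\<^sub>R v) u) (at x)"
        by (simp add: has_field_derivative_def)
      show "isCont (\<lambda>x. D (x *\<^sub>R u + y *\<^sub>R v) u) x"
        by (rule isCont_o2[OF _ contD]) (intro continuous_intros)
    qed (use S in simp)
    also have "\<dots> = 0"
      using supp[OF less_imp_le[OF big[of S]]] supp[OF less_imp_le[OF big[of "-S"]]] S by simp
    finally show ?thesis .
  qed
  then show "(\<integral>z. D z u \<partial>lborel) = 0"
    by (subst integral_axis_pair[OF uv int]) simp
qed

section \<open>Smooth cutoffs and covers by balls\<close>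

text \<open>
  The quadratic spline whose derivative is the tent of height 2 on the unit interval; it rises from 0
  to 1. Only one continuous derivative is ever needed.
\<close>

definition smoothstep :: "real \<Rightarrow> real" where
  "smoothstep t = 2 * (max 0 t)^2 - 4 * (max 0 (t - 1/2))^2 + 2 * (max 0 (t - 1))^2"

definition smoothstep' :: "real \<Rightarrow> real" where
  "smoothstep' t = 4 * max 0 t - 8 * max 0 (t - 1/2) + 4 * max 0 (t - 1)"

lemma pos_part_squared_deriv: "((\<lambda>t::real. (max 0 t)^2) has_real_derivative 2 * max 0 t) (at t)"
proof (cases t "0::real" rule: linorder_cases)
  case less
  have "((\<lambda>t::real. 0) has_real_derivative 2 * max 0 t) (at t)" using less by simp
  then show ?thesis
    by (rule has_field_derivative_transform_within_open[of _ _ _ "{..<0}"]) (use less in auto)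
next
  case greater
  have "((\<lambda>t::real. t^2) has_real_derivative 2 * max 0 t) (at t)"
    using greater by (auto intro!: derivative_eq_intros)
  then show ?thesis
    by (rule has_field_derivative_transform_within_open[of _ _ _ "{0<..}"]) (use greater in auto)
next
  case equal
  have "((\<lambda>h::real. (max 0 h)^2 / h) \<longlongrightarrow> 0) (at 0)"
  proof (rule Lim_null_comparison)
    show "\<forall>\<^sub>F h in at 0. norm ((max 0 h)^2 / h) \<le> \<bar>h::real\<bar>"
      by (intro always_eventually) (auto simp: max_def power2_eq_square)
    show "((\<lambda>h::real. \<bar>h\<bar>) \<longlongrightarrow> 0) (at 0)"
      by (intro tendsto_eq_intros) auto
  qed
  then show ?thesis
    using equal by (simp add: DERIV_def)
qed

lemma smoothstep_deriv: "(smoothstep has_real_derivative smoothstep' t) (at t)"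
proof -
  have shift: "((\<lambda>t. (max 0 (t - c))^2) has_real_derivative 2 * max 0 (t - c)) (at t)" for c :: real
    using DERIV_shift[of "\<lambda>t. (max 0 t)^2" _ t "-c"] pos_part_squared_deriv[of "t - c"] by simp
  show ?thesis
    unfolding smoothstep_def[abs_def] smoothstep'_def
    by (rule derivative_eq_intros pos_part_squared_deriv shift refl)+ simp
qed

lemma smoothstep'_continuous: "continuous_on UNIV smoothstep'"
  unfolding smoothstep'_def[abs_def] by (intro continuous_intros)

lemma smoothstep_eq_0: "t \<le> 0 \<Longrightarrow> smoothstep t = 0"
  by (simp add: smoothstep_def max_def)

lemma smoothstep_eq_1: "t \<ge> 1 \<Longrightarrow> smoothstep t = 1"
  by (simp add: smoothstep_def max_def power2_eq_square algebra_simps)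

lemma smoothstep'_bounds: "0 \<le> smoothstep' t" "smoothstep' t \<le> 2"
  by (auto simp: smoothstep'_def max_def)

lemma smoothstep'_eq_0: "t \<le> 0 \<or> t \<ge> 1 \<Longrightarrow> smoothstep' t = 0"
  by (auto simp: smoothstep'_def max_def)

lemma smoothstep_mono: "s \<le> t \<Longrightarrow> smoothstep s \<le> smoothstep t"
proof (erule DERIV_nonneg_imp_nondecreasing)
  fix x show "\<exists>y. (smoothstep has_real_derivative y) (at x) \<and> 0 \<le> y"
    by (rule exI[of _ "smoothstep' x"]) (simp add: smoothstep_deriv smoothstep'_bounds)
qed

lemma smoothstep_bounds: "0 \<le> smoothstep t" "smoothstep t \<le> 1"
  using smoothstep_mono[of "min t 0" t] smoothstep_mono[of t "max t 1"]
  by (auto simp: smoothstep_eq_0 smoothstep_eq_1)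

text \<open>
  A cutoff that vanishes on the ball of radius \<open>r\<close> and equals 1 off the concentric ball of radius
  \<open>2 r\<close>. Its gradient is of order \<open>1/r\<close> on a set of area of order \<open>r\<^sup>2\<close>, so the integral of the
  gradient is of order \<open>r\<close>. Summed over a cover of a curve this is comparable with its length, which
  is how arclength enters the divergence theorem.
\<close>

definition hole :: "complex \<Rightarrow> real \<Rightarrow> complex \<Rightarrow> real" where
  "hole c r z = smoothstep ((norm (z - c))\<^sup>2 / r\<^sup>2 - 1)"

definition hole' :: "complex \<Rightarrow> real \<Rightarrow> complex \<Rightarrow> complex \<Rightarrow> real" where
  "hole' c r z h = smoothstep' ((norm (z - c))\<^sup>2 / r\<^sup>2 - 1) * (2 * ((z - c) \<bullet> h) / r\<^sup>2)"

lemma C1on_hole: "C1on UNIV (hole c r) (hole' c r)"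
proof -
  have "C1on UNIV (\<lambda>z. (norm (z - c))\<^sup>2 / r\<^sup>2 - 1) (\<lambda>z h. 2 * ((z - c) \<bullet> h) / r\<^sup>2)"
  proof (rule C1onI)
    fix z
    show "((\<lambda>z. (norm (z - c))\<^sup>2 / r\<^sup>2 - 1) has_derivative (\<lambda>h. 2 * ((z - c) \<bullet> h) / r\<^sup>2)) (at z)"
      unfolding power2_norm_eq_inner
      by (auto intro!: derivative_eq_intros simp: inner_commute divide_inverse algebra_simps)
  qed (auto intro!: continuous_intros simp: divide_inverse)
  from C1on_compose_real[OF this smoothstep_deriv smoothstep'_continuous]
  show ?thesis
    unfolding hole_def[abs_def] hole'_def[abs_def] .
qed

lemma hole_bounds: "0 \<le> hole c r z" "hole c r z \<le> 1"
  by (simp_all add: hole_def smoothstep_bounds)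

lemma hole_eq_0: "z \<in> ball c r \<Longrightarrow> hole c r z = 0"
proof -
  assume "z \<in> ball c r"
  then have "norm (z - c) < r" by (simp add: dist_norm norm_minus_commute)
  then have "(norm (z - c))\<^sup>2 \<le> r\<^sup>2" "r > 0"
    using norm_ge_zero[of "z - c"] by (auto intro: power_mono simp del: norm_ge_zero)
  then show ?thesis
    unfolding hole_def by (intro smoothstep_eq_0) simp
qed

lemma hole_eq_1: "r > 0 \<Longrightarrow> z \<notin> ball c (2 * r) \<Longrightarrow> hole c r z = 1"
proof -
  assume r: "r > 0" and "z \<notin> ball c (2 * r)"
  then have "2 * r \<le> norm (z - c)" by (simp add: dist_norm norm_minus_commute)
  then have "(2 * r)\<^sup>2 \<le> (norm (z - c))\<^sup>2"
    using r by (intro power_mono) auto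
  then have "2 * r\<^sup>2 \<le> (norm (z - c))\<^sup>2"
    by (simp add: power_mult_distrib) (smt (verit) zero_le_power2)
  then show ?thesis
    unfolding hole_def using r by (intro smoothstep_eq_1) (simp add: field_simps)
qed

lemma hole'_bound:
  assumes r: "r > 0"
  shows "\<bar>hole' c r z h\<bar> \<le> 6 / r * indicator (ball c (2 * r)) z * norm h"
proof (cases "(norm (z - c))\<^sup>2 < 2 * r\<^sup>2")
  case False
  then have "smoothstep' ((norm (z - c))\<^sup>2 / r\<^sup>2 - 1) = 0"
    using r by (intro smoothstep'_eq_0 disjI2) (simp add: field_simps)
  then show ?thesis using r by (simp add: hole'_def)
next
  case True
  also have "2 * r\<^sup>2 \<le> (3/2 * r)\<^sup>2" by (simp add: power_mult_distrib power2_eq_square)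
  finally have lt: "norm (z - c) < 3/2 * r"
    using r by (meson less_eq_real_def mult_nonneg_nonneg power_less_imp_less_base zero_le_divide_iff zero_le_numeral)
  have "\<bar>(z - c) \<bullet> h\<bar> \<le> norm (z - c) * norm h"
    by (rule Cauchy_Schwarz_ineq2)
  also have "\<dots> \<le> 3/2 * r * norm h"
    using lt by (intro mult_right_mono) auto
  finally have "2 * \<bar>(z - c) \<bullet> h\<bar> / r\<^sup>2 \<le> 2 * (3/2 * r * norm h) / r\<^sup>2"
    by (intro divide_right_mono) auto
  also have "\<dots> = 3 / r * norm h" using r by (simp add: power2_eq_square)
  finally have a: "2 * \<bar>(z - c) \<bullet> h\<bar> / r\<^sup>2 \<le> 3 / r * norm h" .
  have "\<bar>hole' c r z h\<bar> = smoothstep' ((norm (z - c))\<^sup>2 / r\<^sup>2 - 1) * (2 * \<bar>(z - c) \<bullet> h\<bar> / r\<^sup>2)"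
    unfolding hole'_def by (simp add: abs_mult smoothstep'_bounds)
  also have "\<dots> \<le> 2 * (3 / r * norm h)"
    using a smoothstep'_bounds by (intro mult_mono) auto
  also have "\<dots> = 6 / r * indicator (ball c (2 * r)) z * norm h"
    using lt r by (simp add: dist_norm norm_minus_commute indicator_def)
  finally show ?thesis .
qed

lemma C1on_prod_hole:
  assumes "finite J" "\<And>i. i \<in> J \<Longrightarrow> r i > 0"
  shows "\<exists>D. C1on UNIV (\<lambda>z. \<Prod>i\<in>J. hole (c i) (r i) z) D \<and>
    (\<forall>z h. \<bar>D z h\<bar> \<le> (\<Sum>i\<in>J. 6 / r i * indicator (ball (c i) (2 * r i)) z) * norm h)"
  using assms
proof (induction J rule: finite_induct)
  case empty
  show ?case by (rule exI[of _ "\<lambda>z h. 0"]) (auto intro: C1on_const)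
next
  case (insert i J)
  let ?P = "\<lambda>J z. \<Prod>i\<in>J. hole (c i) (r i) z"
  let ?S = "\<lambda>J z. \<Sum>i\<in>J. 6 / r i * indicator (ball (c i) (2 * r i)) z"
  obtain D where D: "C1on UNIV (?P J) D" "\<And>z h. \<bar>D z h\<bar> \<le> ?S J z * norm h"
    using insert by auto
  have P: "\<bar>?P J z\<bar> \<le> 1" for z
    by (simp add: abs_prod prod_le_1 hole_bounds)
  have "\<bar>hole (c i) (r i) z * D z h + hole' (c i) (r i) z h * ?P J z\<bar> \<le> ?S (insert i J) z * norm h" for z h
  proof -
    have "\<bar>hole (c i) (r i) z * D z h\<bar> \<le> 1 * \<bar>D z h\<bar>"
      unfolding abs_mult by (intro mult_right_mono) (auto simp: hole_bounds)
    moreover have "\<bar>hole' (c i) (r i) z h * ?P J z\<bar> \<le> \<bar>hole' (c i) (r i) z h\<bar> * 1"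
      unfolding abs_mult by (intro mult_left_mono P) auto
    moreover have "?S (insert i J) z * norm h
        = 6 / r i * indicator (ball (c i) (2 * r i)) z * norm h + ?S J z * norm h"
      using insert.hyps by (simp add: distrib_right)
    ultimately show ?thesis
      using D(2)[of z h] hole'_bound[of "r i" "c i" z h] insert.prems by fastforce
  qed
  moreover have "C1on UNIV (?P (insert i J)) (\<lambda>z h. hole (c i) (r i) z * D z h + hole' (c i) (r i) z h * ?P J z)"
    using C1on_mult[OF C1on_hole D(1), of "c i" "r i"] insert.hyps by simp
  ultimately show ?case by blast
qed

text \<open>
  The sets of a near-optimal cover may have diameter zero, so their radii are enlarged by a summable
  amount before passing to balls. Centres are chosen in \<open>K\<close>, so that balls of small radius stay away
  from any fixed point off \<open>K\<close>.
\<close>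

lemma arclength_finite_ball_cover:
  assumes K: "compact K" and len: "arclength K \<le> ennreal l" and l: "l \<ge> 0" and \<delta>: "\<delta> > 0"
  obtains J :: "nat set" and c :: "nat \<Rightarrow> complex" and r :: "nat \<Rightarrow> real"
  where "finite J" "\<And>i. i \<in> J \<Longrightarrow> c i \<in> K" "\<And>i. i \<in> J \<Longrightarrow> 0 < r i" "\<And>i. i \<in> J \<Longrightarrow> r i \<le> \<delta>"
    "K \<subseteq> (\<Union>i\<in>J. ball (c i) (r i))" "(\<Sum>i\<in>J. r i) \<le> l + \<delta>"
proof -
  have "arclength_pre (\<delta>/2) K \<le> ennreal l"
    using arclength_pre_le_arclength[of "\<delta>/2" K] \<delta> len by (simp add: order_trans)
  also have "\<dots> < ennreal (l + \<delta>/2)"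
    using l \<delta> by (intro ennreal_lessI) auto
  finally obtain A where A: "K \<subseteq> (\<Union>i::nat. A i)" "\<And>i. bounded (A i)" "\<And>i. diameter (A i) \<le> \<delta>/2"
      "(\<Sum>i. ennreal (diameter (A i))) < ennreal (l + \<delta>/2)"
    unfolding arclength_pre_def INF_less_iff by auto
  define c where "c i = (SOME z. z \<in> A i \<inter> K)" for i
  define r where "r i = diameter (A i) + \<delta>/2 * (1/2) ^ Suc i" for i
  define J0 where "J0 = {i. A i \<inter> K \<noteq> {}}"
  have c: "c i \<in> A i" "c i \<in> K" if "i \<in> J0" for i
    using that some_in_eq[of "A i \<inter> K"] by (auto simp: J0_def c_def)
  have dia: "diameter (A i) \<ge> 0" for i
    by (rule diameter_ge_0[OF A(2)])
  have r0: "r i > 0" for i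
    using dia[of i] \<delta> by (simp add: r_def add_nonneg_pos)
  have r\<delta>: "r i \<le> \<delta>" for i
  proof -
    have "\<delta>/2 * (1/2) ^ Suc i \<le> \<delta>/2 * 1"
      using \<delta> by (intro mult_left_mono power_le_one) auto
    then show ?thesis using A(3)[of i] by (simp add: r_def)
  qed
  have "K \<subseteq> (\<Union>i\<in>J0. ball (c i) (r i))"
  proof
    fix z assume z: "z \<in> K"
    then obtain i where i: "z \<in> A i" using A(1) by blast
    then have i0: "i \<in> J0" using z by (auto simp: J0_def)
    have "dist (c i) z \<le> diameter (A i)"
      using A(2) c(1)[OF i0] i by (rule diameter_bounded_bound)
    also have "\<dots> < r i" using \<delta> by (simp add: r_def)
    finally show "z \<in> (\<Union>i\<in>J0. ball (c i) (r i))" using i0 by auto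
  qed
  then obtain J where J: "J \<subseteq> J0" "finite J" "K \<subseteq> (\<Union>i\<in>J. ball (c i) (r i))"
    using compactE_image[OF K, of J0 "\<lambda>i. ball (c i) (r i)"] by blast
  have "ennreal (\<Sum>i\<in>J. diameter (A i)) = (\<Sum>i\<in>J. ennreal (diameter (A i)))"
    using dia by simp
  also have "\<dots> \<le> (\<Sum>i. ennreal (diameter (A i)))"
    by (intro sum_le_suminf) (use J in auto)
  also have "\<dots> \<le> ennreal (l + \<delta>/2)" using A(4) by simp
  finally have "(\<Sum>i\<in>J. diameter (A i)) \<le> l + \<delta>/2"
    using l \<delta> by (subst (asm) ennreal_le_iff) auto
  moreover have "(\<Sum>i\<in>J. \<delta>/2 * (1/2) ^ Suc i) \<le> \<delta>/2"
  proof -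
    have s: "(\<lambda>i. \<delta>/2 * (1/2) ^ Suc i) sums (\<delta>/2 * 1)"
      by (rule sums_mult[OF power_half_series])
    then have "(\<Sum>i\<in>J. \<delta>/2 * (1/2) ^ Suc i) \<le> (\<Sum>i. \<delta>/2 * (1/2) ^ Suc i)"
      by (intro sum_le_suminf) (use J \<delta> in \<open>auto simp: sums_iff\<close>)
    then show ?thesis using s by (simp add: sums_iff)
  qed
  ultimately have "(\<Sum>i\<in>J. r i) \<le> l + \<delta>"
    by (simp add: r_def sum.distrib)
  then show ?thesis
    using that[of J c r] J c r0 r\<delta> by blast
qed

definition divergence :: "(complex \<Rightarrow> complex \<Rightarrow> complex) \<Rightarrow> complex \<Rightarrow> real" where
  "divergence D z = Re (D z 1) + Im (D z \<i>)"

lemma C1on_Re: "C1on U f D \<Longrightarrow> C1on U (\<lambda>z. Re (f z)) (\<lambda>z h. Re (D z h))"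
  unfolding C1on_def by (auto intro: continuous_intros has_derivative_Re)

lemma C1on_Im: "C1on U f D \<Longrightarrow> C1on U (\<lambda>z. Im (f z)) (\<lambda>z h. Im (D z h))"
  unfolding C1on_def by (auto intro: continuous_intros has_derivative_Im)

text \<open>
  The vanishing of the integral of a divergence, in a form that can be cancelled in inequalities
  between nonnegative integrals.
\<close>

lemma nn_integral_divergence_pos_eq_neg:
  fixes W :: "complex \<Rightarrow> complex"
  assumes W: "C1on UNIV W D" and supp: "\<And>z. norm z \<ge> R \<Longrightarrow> W z = 0"
  shows "divergence D \<in> borel_measurable borel"
    and "(\<integral>\<^sup>+z. ennreal (divergence D z) \<partial>lborel) = (\<integral>\<^sup>+z. ennreal (- divergence D z) \<partial>lborel)"
    and "(\<integral>\<^sup>+z. ennreal (divergence D z) \<partial>lborel) < \<infinity>"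
proof -
  have int: "integrable lborel (divergence D)" and z: "(\<integral>z. divergence D z \<partial>lborel) = 0"
    unfolding divergence_def[abs_def]
    using integral_partial_derivative_eq_0[OF C1on_Re[OF W], of R 1 \<i>]
      integral_partial_derivative_eq_0[OF C1on_Im[OF W], of R \<i> 1] supp
    by (simp_all add: axis_pair_def)
  show "divergence D \<in> borel_measurable borel" using int by auto
  have fin: "(\<integral>\<^sup>+z. ennreal (divergence D z) \<partial>lborel) \<noteq> \<infinity>" "(\<integral>\<^sup>+z. ennreal (- divergence D z) \<partial>lborel) \<noteq> \<infinity>"
    using integrableD[OF int] by auto
  then show "(\<integral>\<^sup>+z. ennreal (divergence D z) \<partial>lborel) < \<infinity>" by (simp add: less_top)
  from z have "enn2real (\<integral>\<^sup>+z. ennreal (divergence D z) \<partial>lborel) = enn2real (\<integral>\<^sup>+z. ennreal (- divergence D z) \<partial>lborel)"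
    unfolding real_lebesgue_integral_def[OF int] by simp
  then show "(\<integral>\<^sup>+z. ennreal (divergence D z) \<partial>lborel) = (\<integral>\<^sup>+z. ennreal (- divergence D z) \<partial>lborel)"
    using fin by (metis ennreal_enn2real infinity_ennreal_def less_top)
qed

section \<open>The divergence theorem with Hausdorff length\<close>

lemma measurable_continuous_on_open:
  fixes g :: "complex \<Rightarrow> real"
  shows "open U \<Longrightarrow> continuous_on U g \<Longrightarrow> (\<lambda>z. indicator U z * g z) \<in> borel_measurable borel"
  using borel_measurable_continuous_on_indicator[of U g] by simp

lemma measurable_ennreal_indicator:
  fixes g :: "'a::topological_space \<Rightarrow> real"
  assumes "(\<lambda>z. indicator U z * g z) \<in> borel_measurable borel"
  shows "(\<lambda>z. ennreal (g z) * indicator U z) \<in> borel_measurable borel"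
proof -
  have "(\<lambda>z. ennreal (indicator U z * g z)) \<in> borel_measurable borel"
    using assms by measurable
  also have "(\<lambda>z. ennreal (indicator U z * g z)) = (\<lambda>z. ennreal (g z) * indicator U z)"
    by (auto simp: indicator_def)
  finally show ?thesis .
qed

lemma divergence_scaleR:
  assumes a: "C1on U a A" and z: "z \<in> U"
  shows "divergence (\<lambda>z h. a z *\<^sub>R B z h + A z h *\<^sub>R F z) z = a z * divergence B z + A z (F z)"
  using C1on_expand[OF a z, of "F z"]
  by (simp add: divergence_def distrib_left mult.commute)

text \<open>
  Multiplying \<open>V\<close> by cutoffs that vanish on balls covering the frontier makes it extend by zero to a
  compactly supported field on the plane, whose divergence integrates to zero. The price is the
  gradient of the cutoffs, which integrates to at most a multiple of the sum of the radii.
\<close>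

lemma stokes_cutoff:
  fixes V :: "complex \<Rightarrow> complex" and f g :: "complex \<Rightarrow> real"
  assumes U: "open U" and V: "C1on U V D"
    and M: "\<And>z. z \<in> U \<Longrightarrow> norm (V z) \<le> M" "M \<ge> 0"
    and supp: "\<And>z. z \<in> U \<Longrightarrow> norm z \<ge> R \<Longrightarrow> V z = 0"
    and meas: "(\<lambda>z. indicator U z * f z) \<in> borel_measurable borel"
      "(\<lambda>z. indicator U z * g z) \<in> borel_measurable borel"
    and nonneg: "\<And>z. z \<in> U \<Longrightarrow> 0 \<le> f z" "\<And>z. z \<in> U \<Longrightarrow> 0 \<le> g z"
    and le: "\<And>z. z \<in> U \<Longrightarrow> f z \<le> divergence D z + g z"
    and J: "finite J" "\<And>i. i \<in> J \<Longrightarrow> r i > 0"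
      "frontier U \<inter> cball 0 R \<subseteq> (\<Union>i\<in>J. ball (c i) (r i))"
  shows "(\<integral>\<^sup>+z\<in>U. ennreal ((\<Prod>i\<in>J. hole (c i) (r i) z) * f z) \<partial>lborel)
    \<le> (\<integral>\<^sup>+z\<in>U. ennreal (g z) \<partial>lborel) + ennreal (96 * M * (\<Sum>i\<in>J. r i))"
proof -
  define \<phi> where "\<phi> z = (\<Prod>i\<in>J. hole (c i) (r i) z)" for z
  define S where "S z = (\<Sum>i\<in>J. 6 / r i * indicator (ball (c i) (2 * r i)) z)" for z
  obtain P where P: "C1on UNIV \<phi> P" "\<And>z h. \<bar>P z h\<bar> \<le> S z * norm h"
    unfolding \<phi>_def S_def using C1on_prod_hole[OF J(1), of r c] J(2) by auto
  have \<phi>: "0 \<le> \<phi> z" "\<phi> z \<le> 1" for z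
    unfolding \<phi>_def by (auto intro: prod_nonneg prod_le_1 simp: hole_bounds)
  have \<phi>0: "\<phi> z = 0" if "i \<in> J" "z \<in> ball (c i) (r i)" for i z
    unfolding \<phi>_def using hole_eq_0[OF that(2)] that(1) J(1) by (auto simp: prod_zero_iff)
  have PU: "C1on U \<phi> P" using P(1) by (rule C1on_subset) simp
  define E where "E z h = \<phi> z *\<^sub>R D z h + P z h *\<^sub>R V z" for z h
  have FE: "C1on U (\<lambda>z. \<phi> z *\<^sub>R V z) E"
    unfolding E_def by (rule C1on_scaleR[OF PU V])
  define W where "W z = (if z \<in> U then \<phi> z *\<^sub>R V z else 0)" for z
  define DW where "DW z = (if z \<in> U then E z else (\<lambda>h. 0))" for z
  have W: "C1on UNIV W DW"
    unfolding W_def DW_def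
  proof (rule C1on_glue_zero[OF U FE])
    fix z assume z: "z \<notin> U"
    consider "z \<notin> closure U" | "z \<in> frontier U" "norm z \<le> R" | "norm z > R"
      using z by (force simp: frontier_def interior_open[OF U])
    then show "\<exists>N. open N \<and> z \<in> N \<and> (\<forall>w\<in>N \<inter> U. \<phi> w *\<^sub>R V w = 0)"
    proof cases
      case 1
      then show ?thesis
        using closure_subset[of U] by (intro exI[of _ "- closure U"]) auto
    next
      case 2
      then obtain i where "i \<in> J" "z \<in> ball (c i) (r i)" using J(3) by auto
      then show ?thesis
        using \<phi>0 by (intro exI[of _ "ball (c i) (r i)"]) auto
    next
      case 3
      have "open {z::complex. norm z > R}" by (intro open_Collect_less continuous_intros)
      then show ?thesis
        using 3 supp by (intro exI[of _ "{z. norm z > R}"]) auto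
    qed
  qed
  have Wsupp: "W z = 0" if "norm z \<ge> R" for z
    using supp that by (auto simp: W_def)
  note div = nn_integral_divergence_pos_eq_neg[OF W, of R, OF Wsupp]
  have S0: "S z \<ge> 0" for z
    unfolding S_def using J(2) by (intro sum_nonneg) (auto simp: less_imp_le)
  have pw: "ennreal (\<phi> z * f z) * indicator U z + ennreal (- divergence DW z)
      \<le> (ennreal (g z) * indicator U z + ennreal (M * S z)) + ennreal (divergence DW z)" for z
  proof (cases "z \<in> U")
    case True
    have dv: "divergence DW z = \<phi> z * divergence D z + P z (V z)"
      using divergence_scaleR[OF PU True, of D V] True by (simp add: DW_def E_def divergence_def)
    have "\<bar>P z (V z)\<bar> \<le> S z * M"
      using P(2)[of z "V z"] mult_left_mono[OF M(1)[OF True] S0[of z]] by linarith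
    moreover have "\<phi> z * f z \<le> \<phi> z * divergence D z + \<phi> z * g z"
      using mult_left_mono[OF le[OF True] \<phi>(1)[of z]] by (simp add: distrib_left)
    moreover have "\<phi> z * g z \<le> g z"
      using nonneg(2)[OF True] \<phi>(2)[of z] by (simp add: mult_left_le_one_le \<phi>)
    ultimately have main: "\<phi> z * f z + - divergence DW z \<le> g z + M * S z"
      using dv by (simp add: mult.commute)
    have nn: "0 \<le> \<phi> z * f z" "0 \<le> g z" "0 \<le> M * S z"
      using nonneg[OF True] \<phi>(1)[of z] S0[of z] M(2) by auto
    show ?thesis
    proof (cases "divergence DW z \<ge> 0")
      case True
      then have "ennreal (- divergence DW z) = 0" by (simp add: ennreal_neg)
      then show ?thesis
        using main nn True \<open>z \<in> U\<close> by (simp flip: ennreal_plus)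
    next
      case False
      then have "ennreal (divergence DW z) = 0" by (simp add: ennreal_neg)
      then show ?thesis
        using main nn False \<open>z \<in> U\<close> by (simp flip: ennreal_plus)
    qed
  next
    case False
    then show ?thesis by (simp add: DW_def divergence_def)
  qed
  have [measurable]: "S \<in> borel_measurable borel"
    unfolding S_def
    by (intro borel_measurable_sum borel_measurable_times borel_measurable_const
        borel_measurable_indicator) auto
  have [measurable]: "\<phi> \<in> borel_measurable borel"
    by (intro borel_measurable_continuous_onI C1on_continuous[OF P(1)])
  have [measurable]: "U \<in> sets borel" using U by simp
  have [measurable]: "(\<lambda>z. ennreal (\<phi> z * f z) * indicator U z) \<in> borel_measurable borel"
  proof (rule measurable_ennreal_indicator)
    have "(\<lambda>z. \<phi> z * (indicator U z * f z)) \<in> borel_measurable borel"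
      using meas(1) by measurable
    then show "(\<lambda>z. indicator U z * (\<phi> z * f z)) \<in> borel_measurable borel"
      by (simp add: mult.left_commute)
  qed
  have [measurable]: "(\<lambda>z. ennreal (g z) * indicator U z) \<in> borel_measurable borel"
    by (rule measurable_ennreal_indicator[OF meas(2)])
  note [measurable] = div(1)
  have intS: "(\<integral>\<^sup>+z. ennreal (M * S z) \<partial>lborel) \<le> ennreal (96 * M * (\<Sum>i\<in>J. r i))"
  proof -
    have ball: "emeasure lborel (ball (c i) (2 * r i)) \<le> ennreal (16 * (r i)\<^sup>2)" if "i \<in> J" for i
    proof -
      have "emeasure lborel (ball (c i) (2 * r i)) = ennreal (measure lborel (ball (c i) (2 * r i)))"
        using emeasure_lborel_ball_finite by (intro emeasure_eq_ennreal_measure) (simp add: less_top)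
      also have "measure lborel (ball (c i) (2 * r i)) = pi * (2 * r i)\<^sup>2"
        using J(2)[OF that] content_ball[of "2 * r i" "c i"]
        by (simp add: unit_ball_vol_2)
      also have "\<dots> \<le> 4 * (2 * r i)\<^sup>2"
        using pi_less_4 by (intro mult_right_mono) auto
      finally show ?thesis by (simp add: power_mult_distrib ennreal_leI)
    qed
    have "(\<integral>\<^sup>+z. ennreal (M * S z) \<partial>lborel)
      = (\<integral>\<^sup>+z. (\<Sum>i\<in>J. ennreal (6 * M / r i) * indicator (ball (c i) (2 * r i)) z) \<partial>lborel)"
    proof (intro nn_integral_cong)
      fix z
      have "M * S z = (\<Sum>i\<in>J. 6 * M / r i * indicator (ball (c i) (2 * r i)) z)"
        unfolding S_def sum_distrib_left by (intro sum.cong) auto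
      then have "ennreal (M * S z) = (\<Sum>i\<in>J. ennreal (6 * M / r i * indicator (ball (c i) (2 * r i)) z))"
        using J(2) M(2) by (simp add: less_imp_le)
      also have "\<dots> = (\<Sum>i\<in>J. ennreal (6 * M / r i) * indicator (ball (c i) (2 * r i)) z)"
        by (intro sum.cong) (auto simp: indicator_def)
      finally show "ennreal (M * S z) = \<dots>" .
    qed
    also have "\<dots> = (\<Sum>i\<in>J. ennreal (6 * M / r i) * emeasure lborel (ball (c i) (2 * r i)))"
    proof (subst nn_integral_sum)
      fix i assume "i \<in> J"
      have [measurable]: "ball (c i) (2 * r i) \<in> sets borel" by simp
      show "(\<lambda>z. ennreal (6 * M / r i) * indicator (ball (c i) (2 * r i)) z) \<in> borel_measurable lborel"
        by measurable
    qed (simp add: nn_integral_cmult_indicator)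
    also have "\<dots> \<le> (\<Sum>i\<in>J. ennreal (6 * M / r i) * ennreal (16 * (r i)\<^sup>2))"
      by (intro sum_mono mult_left_mono ball) auto
    also have "\<dots> = (\<Sum>i\<in>J. ennreal (96 * M * r i))"
    proof (intro sum.cong refl)
      fix i assume "i \<in> J"
      then have "r i > 0" by (rule J(2))
      then show "ennreal (6 * M / r i) * ennreal (16 * (r i)\<^sup>2) = ennreal (96 * M * r i)"
        using M(2) by (subst ennreal_mult[symmetric]) (auto simp: power2_eq_square field_simps)
    qed
    also have "\<dots> = ennreal (96 * M * (\<Sum>i\<in>J. r i))"
      using J(2) M(2) by (simp add: sum_distrib_left less_imp_le)
    finally show ?thesis .
  qed
  have "(\<integral>\<^sup>+z\<in>U. ennreal (\<phi> z * f z) \<partial>lborel) + (\<integral>\<^sup>+z. ennreal (- divergence DW z) \<partial>lborel)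
      = (\<integral>\<^sup>+z. ennreal (\<phi> z * f z) * indicator U z + ennreal (- divergence DW z) \<partial>lborel)"
    by (subst nn_integral_add) auto
  also have "\<dots> \<le> (\<integral>\<^sup>+z. (ennreal (g z) * indicator U z + ennreal (M * S z)) + ennreal (divergence DW z) \<partial>lborel)"
    by (intro nn_integral_mono pw)
  also have "\<dots> = ((\<integral>\<^sup>+z\<in>U. ennreal (g z) \<partial>lborel) + (\<integral>\<^sup>+z. ennreal (M * S z) \<partial>lborel))
      + (\<integral>\<^sup>+z. ennreal (divergence DW z) \<partial>lborel)"
    by (subst nn_integral_add, measurable, subst nn_integral_add) auto
  finally have "(\<integral>\<^sup>+z. ennreal (divergence DW z) \<partial>lborel) + (\<integral>\<^sup>+z\<in>U. ennreal (\<phi> z * f z) \<partial>lborel)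
      \<le> (\<integral>\<^sup>+z. ennreal (divergence DW z) \<partial>lborel)
        + ((\<integral>\<^sup>+z\<in>U. ennreal (g z) \<partial>lborel) + (\<integral>\<^sup>+z. ennreal (M * S z) \<partial>lborel))"
    by (simp only: add.commute div(2))
  then have "(\<integral>\<^sup>+z\<in>U. ennreal (\<phi> z * f z) \<partial>lborel)
      \<le> (\<integral>\<^sup>+z\<in>U. ennreal (g z) \<partial>lborel) + (\<integral>\<^sup>+z. ennreal (M * S z) \<partial>lborel)"
    using div(3) unfolding ennreal_add_left_cancel_le infinity_ennreal_def less_top[symmetric] by blast
  also have "\<dots> \<le> (\<integral>\<^sup>+z\<in>U. ennreal (g z) \<partial>lborel) + ennreal (96 * M * (\<Sum>i\<in>J. r i))"
    by (intro add_left_mono intS)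
  finally show ?thesis unfolding \<phi>_def .
qed

text \<open>
  A one-sided divergence theorem on an arbitrary open set, with the Hausdorff length of the frontier
  as boundary term: choose covers by smaller and smaller balls in the previous bound. The cutoffs
  converge to 1 at each point of \<open>U\<close>, and Fatou's lemma gives the limit. Stated as a comparison of
  nonnegative integrals, it asks for no integrability of the divergence, which may be large near
  the frontier.
\<close>

lemma stokes_le:
  fixes V :: "complex \<Rightarrow> complex" and f g :: "complex \<Rightarrow> real"
  assumes U: "open U" and V: "C1on U V D"
    and M: "\<And>z. z \<in> U \<Longrightarrow> norm (V z) \<le> M" "M \<ge> 0"
    and supp: "\<And>z. z \<in> U \<Longrightarrow> norm z \<ge> R \<Longrightarrow> V z = 0"
    and meas: "(\<lambda>z. indicator U z * f z) \<in> borel_measurable borel"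
      "(\<lambda>z. indicator U z * g z) \<in> borel_measurable borel"
    and nonneg: "\<And>z. z \<in> U \<Longrightarrow> 0 \<le> f z" "\<And>z. z \<in> U \<Longrightarrow> 0 \<le> g z"
    and le: "\<And>z. z \<in> U \<Longrightarrow> f z \<le> divergence D z + g z"
    and len: "arclength (frontier U) \<le> ennreal l" and l: "l \<ge> 0"
  shows "(\<integral>\<^sup>+z\<in>U. ennreal (f z) \<partial>lborel)
    \<le> (\<integral>\<^sup>+z\<in>U. ennreal (g z) \<partial>lborel) + ennreal (96 * M * l)"
proof -
  define K where "K = frontier U \<inter> cball 0 R"
  have K: "compact K" unfolding K_def by (simp add: closed_Int_compact)
  have lenK: "arclength K \<le> ennreal l"
    using arclength_mono[of K "frontier U"] len by (auto simp: K_def)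
  define cov where "cov n X \<longleftrightarrow> (case X of (J :: nat set, c, r) \<Rightarrow>
      finite J \<and> (\<forall>i\<in>J. c i \<in> K) \<and> (\<forall>i\<in>J. 0 < r i) \<and> (\<forall>i\<in>J. r i \<le> 1 / real (Suc n)) \<and>
      K \<subseteq> (\<Union>i\<in>J. ball (c i) (r i)) \<and> (\<Sum>i\<in>J. r i) \<le> l + 1 / real (Suc n))" for n X
  have "\<exists>X. cov n X" for n
  proof -
    have "1 / real (Suc n) > 0" by simp
    then show ?thesis
    proof (rule arclength_finite_ball_cover[OF K lenK l])
      fix J c r
      assume "finite (J :: nat set)" "\<And>i. i \<in> J \<Longrightarrow> c i \<in> K" "\<And>i. i \<in> J \<Longrightarrow> 0 < r i"
        "\<And>i. i \<in> J \<Longrightarrow> r i \<le> 1 / real (Suc n)" "K \<subseteq> (\<Union>i\<in>J. ball (c i) (r i))"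
        "(\<Sum>i\<in>J. r i) \<le> l + 1 / real (Suc n)"
      then show ?thesis
        unfolding cov_def by (intro exI[of _ "(J, c, r)"]) simp
    qed
  qed
  then obtain X where X: "\<And>n. cov n (X n)" by metis
  define J c r where "J n = fst (X n)" and "c n = fst (snd (X n))" and "r n = snd (snd (X n))" for n
  have J: "finite (J n)" "i \<in> J n \<Longrightarrow> c n i \<in> K" "i \<in> J n \<Longrightarrow> 0 < r n i"
      "i \<in> J n \<Longrightarrow> r n i \<le> 1 / real (Suc n)"
      "K \<subseteq> (\<Union>i\<in>J n. ball (c n i) (r n i))" "(\<Sum>i\<in>J n. r n i) \<le> l + 1 / real (Suc n)" for n i
    using X[of n] unfolding cov_def J_def c_def r_def by (auto simp: split_beta simp del: of_nat_Suc)
  \<comment> \<open>Every point of \<open>U\<close> has positive distance to the frontier, and is eventually outside the doubled balls.\<close>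
  define \<phi> where "\<phi> n z = (\<Prod>i\<in>J n. hole (c n i) (r n i) z)" for n z
  have step: "(\<integral>\<^sup>+z\<in>U. ennreal (\<phi> n z * f z) \<partial>lborel)
    \<le> (\<integral>\<^sup>+z\<in>U. ennreal (g z) \<partial>lborel) + ennreal (96 * M * l) + ennreal (96 * M / real (Suc n))" for n
  proof -
    have "(\<integral>\<^sup>+z\<in>U. ennreal (\<phi> n z * f z) \<partial>lborel)
      \<le> (\<integral>\<^sup>+z\<in>U. ennreal (g z) \<partial>lborel) + ennreal (96 * M * (\<Sum>i\<in>J n. r n i))"
      unfolding \<phi>_def
      by (rule stokes_cutoff[OF U V M supp meas nonneg le J(1) J(3) J(5)[unfolded K_def]])
    also have "ennreal (96 * M * (\<Sum>i\<in>J n. r n i)) \<le> ennreal (96 * M * (l + 1 / real (Suc n)))"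
      using M(2) by (intro ennreal_leI mult_left_mono J(6)) auto
    also have "\<dots> = ennreal (96 * M * l) + ennreal (96 * M / real (Suc n))"
      using M(2) l by (subst ennreal_plus[symmetric]) (auto simp: distrib_left)
    finally show ?thesis by (simp add: add.assoc add_left_mono)
  qed
  have ev: "\<forall>\<^sub>F n in sequentially. \<phi> n z = 1" if z: "z \<in> U" for z
  proof -
    obtain d where d: "d > 0" "ball z d \<subseteq> U"
      using U z by (auto simp: open_contains_ball)
    obtain N where N: "2 / d < real N" using reals_Archimedean2 by blast
    have "\<phi> n z = 1" if "n \<ge> N" for n
      unfolding \<phi>_def
    proof (intro prod.neutral ballI)
      fix i assume i: "i \<in> J n"
      have "c n i \<notin> U" using J(2)[OF i] by (simp add: K_def frontier_def interior_open[OF U])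
      then have "c n i \<notin> ball z d" using d(2) by blast
      then have "d \<le> dist (c n i) z" by (simp add: dist_commute)
      moreover have "2 * r n i \<le> d"
      proof -
        have "2 / d < real (Suc n)" using N that by linarith
        then have "2 * (1 / real (Suc n)) \<le> d" using d(1) by (simp add: field_simps)
        then show ?thesis using J(4)[OF i] by linarith
      qed
      ultimately have "z \<notin> ball (c n i) (2 * r n i)" by simp
      then show "hole (c n i) (r n i) z = 1" by (rule hole_eq_1[OF J(3)[OF i]])
    qed
    then show ?thesis by (auto simp: eventually_sequentially)
  qed
  have m: "(\<lambda>z. ennreal (\<phi> n z * f z) * indicator U z) \<in> borel_measurable borel" for n
  proof (rule measurable_ennreal_indicator)
    have "\<phi> n \<in> borel_measurable borel"
      unfolding \<phi>_def using C1on_continuous[OF C1on_hole]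
      by (intro borel_measurable_prod borel_measurable_continuous_onI) auto
    then have "(\<lambda>z. \<phi> n z * (indicator U z * f z)) \<in> borel_measurable borel"
      using meas(1) by measurable
    then show "(\<lambda>z. indicator U z * (\<phi> n z * f z)) \<in> borel_measurable borel"
      by (simp add: mult.left_commute)
  qed
  have "(\<integral>\<^sup>+z\<in>U. ennreal (f z) \<partial>lborel)
      = (\<integral>\<^sup>+z. liminf (\<lambda>n. ennreal (\<phi> n z * f z) * indicator U z) \<partial>lborel)"
  proof (rule nn_integral_cong)
    fix z
    have "(\<lambda>n. ennreal (\<phi> n z * f z) * indicator U z) \<longlonglongrightarrow> ennreal (f z) * indicator U z"
    proof (cases "z \<in> U")
      case True
      show ?thesis
        by (rule tendsto_eventually) (use ev[OF True] in eventually_elim, simp)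
    qed simp
    then show "ennreal (f z) * indicator U z = liminf (\<lambda>n. ennreal (\<phi> n z * f z) * indicator U z)"
      by (simp add: lim_imp_Liminf)
  qed
  also have "\<dots> \<le> liminf (\<lambda>n. \<integral>\<^sup>+z\<in>U. ennreal (\<phi> n z * f z) \<partial>lborel)"
    by (rule nn_integral_liminf) (use m in simp)
  also have "\<dots> \<le> liminf (\<lambda>n. (\<integral>\<^sup>+z\<in>U. ennreal (g z) \<partial>lborel) + ennreal (96 * M * l) + ennreal (96 * M / real (Suc n)))"
    by (intro Liminf_mono always_eventually allI step)
  also have "\<dots> = (\<integral>\<^sup>+z\<in>U. ennreal (g z) \<partial>lborel) + ennreal (96 * M * l)"
  proof (rule lim_imp_Liminf)
    have "(\<lambda>n. ennreal (96 * M / real (Suc n))) \<longlonglongrightarrow> ennreal 0"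
      using tendsto_mult[OF tendsto_const[of "96 * M"] LIMSEQ_inverse_real_of_nat]
      by (intro tendsto_ennrealI) (simp add: divide_inverse)
    from tendsto_add[OF tendsto_const this]
    show "(\<lambda>n. (\<integral>\<^sup>+z\<in>U. ennreal (g z) \<partial>lborel) + ennreal (96 * M * l) + ennreal (96 * M / real (Suc n)))
      \<longlonglongrightarrow> (\<integral>\<^sup>+z\<in>U. ennreal (g z) \<partial>lborel) + ennreal (96 * M * l)"
      by simp
  qed simp
  finally show ?thesis .
qed

section \<open>Length of level sets as a limit of area integrals\<close>

definition gradient :: "(complex \<Rightarrow> complex \<Rightarrow> real) \<Rightarrow> complex \<Rightarrow> complex" where
  "gradient D z = Complex (D z 1) (D z \<i>)"

lemma C1on_gradient:
  assumes "C1on U f D" "z \<in> U"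
  shows "D z h = gradient D z \<bullet> h"
  using C1on_expand[OF assms, of h] by (simp add: gradient_def inner_complex_def mult.commute)

lemma continuous_on_gradient: "C1on U f D \<Longrightarrow> continuous_on U (gradient D)"
  unfolding gradient_def[abs_def] Complex_eq
  by (intro continuous_intros C1on_continuous_derivative)

text \<open>
  In the limit \<open>h n\<close> jumps from \<open>-1\<close> to \<open>1\<close> at \<open>c\<close>, so \<open>k n\<close> tends to twice the point mass at \<open>c\<close>
  and the integral of \<open>k n (f z)\<close> times the norm of the gradient tends to twice the length of
  \<open>f = c\<close>, by the coarea formula. Only the lower bound is needed, and it is proved directly below.
\<close>

definition jump_at :: "real \<Rightarrow> (nat \<Rightarrow> real \<Rightarrow> real) \<Rightarrow> (nat \<Rightarrow> real \<Rightarrow> real) \<Rightarrow> bool" where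
  "jump_at c h k \<longleftrightarrow>
     (\<forall>n t. (h n has_real_derivative k n t) (at t)) \<and> (\<forall>n. continuous_on UNIV (k n)) \<and>
     (\<forall>n t. k n t \<ge> 0) \<and>
     (\<forall>t<c. \<forall>\<^sub>F n in sequentially. h n t = -1) \<and> (\<forall>t>c. \<forall>\<^sub>F n in sequentially. h n t = 1)"

text \<open>
  On a line that crosses the level set, the integral is the total variation of \<open>h n\<close> along \<open>F\<close>, namely
  the full jump from \<open>-1\<close> to \<open>1\<close>.
\<close>

lemma jump_slice:
  fixes F :: "real \<Rightarrow> real"
  assumes hk: "jump_at c h k"
    and F: "\<And>x. x \<in> {a..b} \<Longrightarrow> (F has_real_derivative F' x) (at x)"
    and F': "continuous_on {a..b} F'"
    and sgn: "(\<forall>x\<in>{a..b}. F' x > 0) \<or> (\<forall>x\<in>{a..b}. F' x < 0)"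
    and m: "a < m" "m < b" "F m = c"
  shows "\<forall>\<^sub>F n in sequentially. (\<integral>\<^sup>+x\<in>{a..b}. ennreal (k n (F x) * \<bar>F' x\<bar>) \<partial>lborel) = 2"
proof -
  have h: "(h n has_real_derivative k n t) (at t)" "continuous_on UNIV (k n)" "k n t \<ge> 0" for n t
    using hk by (auto simp: jump_at_def)
  have lo: "\<forall>\<^sub>F n in sequentially. h n t = -1" if "t < c" for t
    using hk that by (auto simp: jump_at_def)
  have hi: "\<forall>\<^sub>F n in sequentially. h n t = 1" if "t > c" for t
    using hk that by (auto simp: jump_at_def)
  have ab: "a \<le> b" using m by simp
  have cF: "continuous_on {a..b} F"
    using F by (meson DERIV_isCont continuous_at_imp_continuous_on)
  have ckF: "continuous_on {a..b} (\<lambda>x. k n (F x) * \<bar>F' x\<bar>)" for n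
    by (intro continuous_intros continuous_on_compose2[OF h(2) cF] F') simp
  have int: "(\<integral>\<^sup>+x\<in>{a..b}. ennreal (k n (F x) * \<bar>F' x\<bar>) \<partial>lborel) = ennreal (s * h n (F b) - s * h n (F a))"
    if s: "\<And>x. x \<in> {a..b} \<Longrightarrow> s * F' x = \<bar>F' x\<bar>" for n and s :: real
  proof -
    define q where "q x = indicator {a..b} x *\<^sub>R (k n (F x) * \<bar>F' x\<bar>)" for x
    have "(\<integral>\<^sup>+x. ennreal (q x) * indicator {a..b} x \<partial>lborel) = ennreal (s * h n (F b) - s * h n (F a))"
    proof (rule nn_integral_FTC_Icc)
      show "q \<in> borel_measurable borel"
        unfolding q_def[abs_def] by (rule borel_measurable_continuous_on_indicator[OF _ ckF]) simp
      fix x assume x: "x \<in> {a..b}"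
      have "((\<lambda>x. s * h n (F x)) has_real_derivative s * (k n (F x) * F' x)) (at x)"
        using DERIV_cmult[OF DERIV_chain2[OF h(1) F[OF x]]] .
      moreover have "s * (k n (F x) * F' x) = q x"
        using x s[OF x] by (simp add: q_def)
      ultimately show "((\<lambda>x. s * h n (F x)) has_real_derivative q x) (at x)" by simp
      show "0 \<le> q x" using h(3) by (simp add: q_def)
    qed (rule ab)
    moreover have "(\<integral>\<^sup>+x. ennreal (q x) * indicator {a..b} x \<partial>lborel)
        = (\<integral>\<^sup>+x\<in>{a..b}. ennreal (k n (F x) * \<bar>F' x\<bar>) \<partial>lborel)"
      by (intro nn_integral_cong) (simp add: q_def indicator_def)
    ultimately show ?thesis by simp
  qed
  show ?thesis
    using sgn
  proof
    assume pos: "\<forall>x\<in>{a..b}. F' x > 0"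
    have mono: "F s < F t" if "a \<le> s" "s < t" "t \<le> b" for s t
      using that(2)
    proof (rule DERIV_pos_imp_increasing)
      fix x assume "s \<le> x" "x \<le> t"
      then have "x \<in> {a..b}" using that by auto
      then show "\<exists>y. (F has_real_derivative y) (at x) \<and> 0 < y"
        using F pos by (intro exI[of _ "F' x"]) blast
    qed
    have "F a < c" "c < F b" using mono[of a m] mono[of m b] m by auto
    from lo[OF this(1)] hi[OF this(2)] show ?thesis
    proof eventually_elim
      case (elim n)
      show ?case using int[of 1 n] pos elim by (simp add: less_imp_le)
    qed
  next
    assume neg: "\<forall>x\<in>{a..b}. F' x < 0"
    have mono: "F t < F s" if "a \<le> s" "s < t" "t \<le> b" for s t
      using that(2)
    proof (rule DERIV_neg_imp_decreasing)
      fix x assume "s \<le> x" "x \<le> t"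
      then have "x \<in> {a..b}" using that by auto
      then show "\<exists>y. (F has_real_derivative y) (at x) \<and> y < 0"
        using F neg by (intro exI[of _ "F' x"]) blast
    qed
    have "F b < c" "c < F a" using mono[of a m] mono[of m b] m by auto
    from lo[OF this(1)] hi[OF this(2)] show ?thesis
    proof eventually_elim
      case (elim n)
      show ?case using int[of "-1" n] neg elim by (simp add: less_imp_le)
    qed
  qed
qed

lemma axis_pair_inner: "axis_pair u v \<Longrightarrow> a \<bullet> b = (a \<bullet> u) * (b \<bullet> u) + (a \<bullet> v) * (b \<bullet> v)"
  by (auto simp: axis_pair_def inner_complex_def)

lemma axis_pair_norm: "axis_pair u v \<Longrightarrow> norm a = sqrt ((a \<bullet> u)\<^sup>2 + (a \<bullet> v)\<^sup>2)"
  by (auto simp: axis_pair_def cmod_def add.commute)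

text \<open>
  A displacement \<open>d\<close> almost orthogonal to \<open>a\<close> is measured by its \<open>v\<close>-coordinate, up to the ratio of
  \<open>norm a\<close> to its \<open>u\<close>-component. Applied to chords of a level set, with \<open>a\<close> the gradient.
\<close>

lemma almost_orthogonal_bound:
  assumes uv: "axis_pair u v" and ad: "\<bar>a \<bullet> d\<bar> \<le> \<tau> * norm a * norm d" and \<tau>: "\<tau> \<ge> 0"
  shows "norm d * (\<bar>a \<bullet> u\<bar> - \<tau> * norm a) \<le> norm a * \<bar>d \<bullet> v\<bar>"
proof -
  define e where "e = \<tau> * norm a * norm d"
  have e: "e \<ge> 0" using \<tau> by (simp add: e_def)
  have "\<bar>a \<bullet> u\<bar> * \<bar>d \<bullet> u\<bar> = \<bar>a \<bullet> d - (a \<bullet> v) * (d \<bullet> v)\<bar>"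
    using axis_pair_inner[OF uv, of a d] by (simp add: abs_mult)
  also have "\<dots> \<le> \<bar>a \<bullet> v\<bar> * \<bar>d \<bullet> v\<bar> + e"
    using ad unfolding e_def abs_mult[symmetric] by linarith
  finally have le: "\<bar>a \<bullet> u\<bar> * \<bar>d \<bullet> u\<bar> \<le> \<bar>a \<bullet> v\<bar> * \<bar>d \<bullet> v\<bar> + e" .
  have "\<bar>a \<bullet> u\<bar> * norm d = sqrt ((\<bar>a \<bullet> u\<bar> * \<bar>d \<bullet> u\<bar>)\<^sup>2 + (\<bar>a \<bullet> u\<bar> * \<bar>d \<bullet> v\<bar>)\<^sup>2)"
    unfolding axis_pair_norm[OF uv, of d]
    by (simp add: power_mult_distrib distrib_left[symmetric] real_sqrt_mult)
  also have "\<dots> \<le> sqrt ((\<bar>a \<bullet> v\<bar> * \<bar>d \<bullet> v\<bar> + e)\<^sup>2 + (\<bar>a \<bullet> u\<bar> * \<bar>d \<bullet> v\<bar>)\<^sup>2)"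
    using le by (intro real_sqrt_le_mono add_right_mono power_mono) auto
  also have "\<dots> \<le> sqrt ((\<bar>a \<bullet> v\<bar> * \<bar>d \<bullet> v\<bar>)\<^sup>2 + (\<bar>a \<bullet> u\<bar> * \<bar>d \<bullet> v\<bar>)\<^sup>2) + sqrt (e\<^sup>2 + 0\<^sup>2)"
    using real_sqrt_sum_squares_triangle_ineq[of "\<bar>a \<bullet> v\<bar> * \<bar>d \<bullet> v\<bar>" e "\<bar>a \<bullet> u\<bar> * \<bar>d \<bullet> v\<bar>" 0] by simp
  also have "sqrt ((\<bar>a \<bullet> v\<bar> * \<bar>d \<bullet> v\<bar>)\<^sup>2 + (\<bar>a \<bullet> u\<bar> * \<bar>d \<bullet> v\<bar>)\<^sup>2) = norm a * \<bar>d \<bullet> v\<bar>"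
    unfolding axis_pair_norm[OF uv, of a]
    by (simp add: power_mult_distrib distrib_right[symmetric] real_sqrt_mult add.commute)
  also have "sqrt (e\<^sup>2 + 0\<^sup>2) = e" using e by simp
  finally show ?thesis by (simp add: e_def algebra_simps)
qed

text \<open>
  Where the gradient is constant up to a relative error \<open>\<tau>\<close>, the level set is a graph over the axis
  \<open>v\<close> for one of the two axis directions \<open>u\<close>, namely that in which the gradient has the larger
  component. If \<open>\<kappa>\<close> is the cosine of the angle between the gradient and \<open>u\<close>, then the length of the
  graph is \<open>1/\<kappa>\<close> times that of its projection \<open>T\<close>, and each line in direction \<open>u\<close> over \<open>T\<close>
  contributes a jump of size 2, to be weighted with \<open>1/\<kappa>\<close> as only the component of the gradient along
  \<open>u\<close> is seen by the line. The two factors cancel up to errors in \<open>\<tau>\<close>. The open set \<open>Q\<close> need not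
  be convex, since an open line segment through each crossing suffices.
\<close>

lemma level_set_local:
  fixes f :: "complex \<Rightarrow> real"
  assumes f: "C1on U f D" and R: "convex R" "bounded R" "R \<subseteq> U" and O: "open Q" "Q \<subseteq> R" and z0: "z0 \<in> R"
    and \<tau>: "0 < \<tau>" "\<tau> < 1/4"
    and ne: "gradient D z0 \<noteq> 0"
    and near: "\<And>z. z \<in> R \<Longrightarrow> norm (gradient D z - gradient D z0) \<le> \<tau> * norm (gradient D z0)"
    and hk: "jump_at c h k"
  shows "ennreal (2 * (1 - 2 * \<tau>) * (1 - \<tau>) / (1 + 2 * \<tau>)) * arclength (Q \<inter> {z. f z = c})
    \<le> liminf (\<lambda>n. \<integral>\<^sup>+z\<in>Q. ennreal (k n (f z) * norm (gradient D z)) \<partial>lborel)"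
proof -
  define a where "a = gradient D z0"
  have na: "norm a > 0" using ne by (simp add: a_def)
  have k0: "k n t \<ge> 0" "continuous_on UNIV (k n)" for n t using hk by (auto simp: jump_at_def)
  obtain u v where uv: "axis_pair u v" and au: "norm a \<le> 2 * \<bar>a \<bullet> u\<bar>"
  proof -
    have "norm a \<le> \<bar>Re a\<bar> + \<bar>Im a\<bar>" by (rule cmod_le)
    then show ?thesis
      using that[of 1 \<i>] that[of \<i> 1] by (auto simp: axis_pair_def) linarith
  qed
  have nuv: "norm u = 1" "norm v = 1" using uv by (auto simp: axis_pair_def)
  define \<kappa> where "\<kappa> = \<bar>a \<bullet> u\<bar> / norm a"
  have \<kappa>: "\<kappa> \<ge> 1/2" using au na by (simp add: \<kappa>_def field_simps)
  have \<kappa>a: "\<bar>a \<bullet> u\<bar> = \<kappa> * norm a" using na by (simp add: \<kappa>_def)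
  define L where "L = 1 / (\<kappa> - \<tau>)"
  have L: "L > 0" using \<kappa> \<tau> by (simp add: L_def)
  define \<rho> where "\<rho> = (1 - \<tau>) / (\<kappa> + \<tau>)"
  have \<rho>: "\<rho> > 0" using \<kappa> \<tau> by (simp add: \<rho>_def)
  have Dg: "D z w = gradient D z \<bullet> w" if "z \<in> R" for z w
    using C1on_gradient[OF f] R(3) that by blast
  have dir: "\<bar>gradient D z \<bullet> u - a \<bullet> u\<bar> \<le> \<tau> * norm a" if "z \<in> R" for z
    using Cauchy_Schwarz_ineq2[of "gradient D z - a" u] near[OF that] nuv
    by (simp add: inner_diff_left a_def)
  have au0: "\<tau> * norm a < \<bar>a \<bullet> u\<bar>"
    using \<kappa> \<tau> na unfolding \<kappa>a by (intro mult_strict_right_mono) auto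
  \<comment> \<open>\<open>\<rho>\<close> compares the full gradient with its component along \<open>u\<close>; it is close to \<open>1/\<kappa>\<close>.\<close>
  have slope: "\<rho> * \<bar>D z u\<bar> \<le> norm (gradient D z)" if z: "z \<in> R" for z
  proof -
    have "\<bar>D z u\<bar> \<le> (\<kappa> + \<tau>) * norm a"
      using dir[OF z] \<kappa>a unfolding Dg[OF z] by (simp add: distrib_right)
    then have "\<rho> * \<bar>D z u\<bar> \<le> \<rho> * ((\<kappa> + \<tau>) * norm a)"
      using \<rho> by (intro mult_left_mono) auto
    also have "\<dots> = (1 - \<tau>) * norm a" using \<kappa> \<tau> by (simp add: \<rho>_def)
    also have "\<dots> \<le> norm (gradient D z)"
      using near[OF z] norm_triangle_ineq2[of a "gradient D z"]
      by (simp add: a_def norm_minus_commute algebra_simps)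
    finally show ?thesis .
  qed
  \<comment> \<open>By the mean value inequality a chord of the level set is almost orthogonal to the gradient.\<close>
  have lip: "dist z w \<le> L * \<bar>z \<bullet> v - w \<bullet> v\<bar>" if zw: "z \<in> Q \<inter> {z. f z = c}" "w \<in> Q \<inter> {z. f z = c}" for z w
  proof -
    have zR: "z \<in> R" "w \<in> R" using zw O(2) by auto
    have "norm (f z - f w - D z0 (z - w)) \<le> norm (z - w) * (\<tau> * norm a)"
    proof (rule differentiable_bound_linearization[of w z R])
      show "w + t *\<^sub>R (z - w) \<in> R" if "t \<in> {0..1}" for t
      proof -
        have "w + t *\<^sub>R (z - w) = (1 - t) *\<^sub>R w + t *\<^sub>R z" by (simp add: algebra_simps)
        then show ?thesis using R(1) zR that by (auto simp: convex_alt)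
      qed
      show "(f has_derivative D x) (at x within R)" if "x \<in> R" for x
        using C1onD[OF f] R(3) that by (meson has_derivative_at_withinI subsetD)
      show "onorm (D x - D z0) \<le> \<tau> * norm a" if x: "x \<in> R" for x
      proof (rule onorm_bound)
        fix w
        have "norm ((D x - D z0) w) = \<bar>(gradient D x - a) \<bullet> w\<bar>"
          using Dg[OF x] Dg[OF z0] by (simp add: a_def inner_diff_left)
        also have "\<dots> \<le> norm (gradient D x - a) * norm w" by (rule Cauchy_Schwarz_ineq2)
        also have "\<dots> \<le> \<tau> * norm a * norm w"
          using near[OF x] by (intro mult_right_mono) (auto simp: a_def)
        finally show "norm ((D x - D z0) w) \<le> \<tau> * norm a * norm w" .
      qed (use \<tau> in simp)
    qed (rule z0)
    then have "\<bar>a \<bullet> (z - w)\<bar> \<le> \<tau> * norm a * norm (z - w)"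
      using zw Dg[OF z0] by (simp add: a_def mult_ac)
    from almost_orthogonal_bound[OF uv this less_imp_le[OF \<tau>(1)]]
    have "norm (z - w) * ((\<kappa> - \<tau>) * norm a) \<le> norm a * \<bar>(z - w) \<bullet> v\<bar>"
      unfolding \<kappa>a by (simp add: left_diff_distrib)
    then have "norm (z - w) * (\<kappa> - \<tau>) \<le> \<bar>(z - w) \<bullet> v\<bar>"
      using na by (simp add: mult.left_commute[of _ _ "norm a"] mult.commute[of _ "norm a"] mult.assoc)
    then show ?thesis
      using \<kappa> \<tau> by (simp add: L_def dist_norm inner_diff_left field_simps)
  qed
  define q where "q n z = ennreal (k n (f z) * norm (gradient D z)) * indicator Q z" for n z
  have QU: "Q \<subseteq> U" using O R by blast
  have q [measurable]: "q n \<in> borel_measurable borel" for n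
    unfolding q_def[abs_def]
    by (intro measurable_ennreal_indicator measurable_continuous_on_open O(1) continuous_intros
        continuous_on_compose2[OF k0(2)] continuous_on_subset[OF C1on_continuous[OF f] QU]
        continuous_on_subset[OF continuous_on_gradient[OF f] QU]) simp
  define I where "I n y = (\<integral>\<^sup>+x. q n (x *\<^sub>R u + y *\<^sub>R v) \<partial>lborel)" for n y
  have "(\<lambda>(y, x). q n (x *\<^sub>R u + y *\<^sub>R v)) \<in> borel_measurable (borel \<Otimes>\<^sub>M lborel)" for n
    by measurable
  then have I [measurable]: "I n \<in> borel_measurable borel" for n
    unfolding I_def[abs_def] by (intro lborel.borel_measurable_nn_integral) simp
  obtain B where B: "\<And>z. z \<in> R \<Longrightarrow> norm z \<le> B" using R(2) by (auto simp: bounded_iff)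
  \<comment> \<open>Defining \<open>T\<close> through the limit, and not as a projection, makes it measurable.\<close>
  define T where "T = {-B..B} \<inter> {y. ennreal (2 * \<rho>) \<le> liminf (\<lambda>n. I n y)}"
  have T: "T \<in> sets borel" unfolding T_def by measurable
  have proj: "(\<lambda>z. z \<bullet> v) ` (Q \<inter> {z. f z = c}) \<subseteq> T"
  proof (intro image_subsetI)
    fix z assume z: "z \<in> Q \<inter> {z. f z = c}"
    define y where "y = z \<bullet> v"
    define x0 where "x0 = z \<bullet> u"
    define e where "e x = x *\<^sub>R u + y *\<^sub>R v" for x
    have z_e: "z = e x0" using axis_pair_expand[OF uv, of z] by (simp add: e_def x0_def y_def)
    have "\<bar>z \<bullet> v\<bar> \<le> B"
      using Cauchy_Schwarz_ineq2[of z v] nuv B[of z] z O(2) by auto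
    then have yB: "y \<in> {-B..B}" by (auto simp: y_def)
    have ce: "continuous_on UNIV e" unfolding e_def[abs_def] by (intro continuous_intros)
    have "open (e -` Q)" using O(1) ce by (rule open_vimage)
    moreover have "x0 \<in> e -` Q" using z z_e by simp
    ultimately obtain r where r: "r > 0" "cball x0 r \<subseteq> e -` Q"
      by (meson open_contains_cball)
    then have seg: "e x \<in> Q" if "x \<in> {x0 - r..x0 + r}" for x
      using that by (auto simp: cball_eq_atLeastAtMost)
    have segR: "e x \<in> R" if "x \<in> {x0 - r..x0 + r}" for x
      using seg[OF that] O(2) by blast
    have sg: "(\<forall>x\<in>{x0 - r..x0 + r}. D (e x) u > 0) \<or> (\<forall>x\<in>{x0 - r..x0 + r}. D (e x) u < 0)"
    proof (cases "a \<bullet> u > 0")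
      case True
      then have "\<forall>x\<in>{x0 - r..x0 + r}. D (e x) u > 0"
        using dir[OF segR] au0 Dg[OF segR] by (smt (verit))
      then show ?thesis ..
    next
      case False
      then have "\<forall>x\<in>{x0 - r..x0 + r}. D (e x) u < 0"
        using dir[OF segR] au0 Dg[OF segR] by (smt (verit))
      then show ?thesis ..
    qed
    have "\<forall>\<^sub>F n in sequentially. (\<integral>\<^sup>+x\<in>{x0 - r..x0 + r}. ennreal (k n (f (e x)) * \<bar>D (e x) u\<bar>) \<partial>lborel) = 2"
    proof (rule jump_slice[OF hk, where m = x0])
      fix x assume x: "x \<in> {x0 - r..x0 + r}"
      have "(e has_derivative (\<lambda>t. t *\<^sub>R u)) (at x)"
        unfolding e_def[abs_def] by (auto intro!: derivative_eq_intros)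
      moreover have eU: "e x \<in> U" using seg[OF x] QU by blast
      ultimately have "((\<lambda>x. f (e x)) has_derivative (\<lambda>t. D (e x) (t *\<^sub>R u))) (at x)"
        using has_derivative_compose C1onD[OF f] by blast
      moreover have "D (e x) (t *\<^sub>R u) = D (e x) u * t" for t
        using C1on_gradient[OF f eU] by simp
      ultimately show "((\<lambda>x. f (e x)) has_real_derivative D (e x) u) (at x)"
        by (simp add: has_field_derivative_def)
    next
      have "continuous_on {x0 - r..x0 + r} e" using ce by (rule continuous_on_subset) simp
      then show "continuous_on {x0 - r..x0 + r} (\<lambda>x. D (e x) u)"
        by (rule continuous_on_compose2[OF C1on_continuous_derivative[OF f]]) (use seg QU in blast)
    next
      show "f (e x0) = c" using z z_e by simp
    qed (use r sg in auto)
    then have "\<forall>\<^sub>F n in sequentially. ennreal (2 * \<rho>) \<le> I n y"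
    proof eventually_elim
      case (elim n)
      have "ennreal (2 * \<rho>) = ennreal \<rho> * 2"
        using \<rho> by (simp add: ennreal_mult mult.commute)
      also have "\<dots> = (\<integral>\<^sup>+x. ennreal \<rho> * (ennreal (k n (f (e x)) * \<bar>D (e x) u\<bar>) * indicator {x0 - r..x0 + r} x) \<partial>lborel)"
      proof (subst elim[symmetric], rule nn_integral_cmult[symmetric])
        have c1: "continuous_on {x0 - r..x0 + r} e" using ce by (rule continuous_on_subset) simp
        have "continuous_on {x0 - r..x0 + r} (\<lambda>x. k n (f (e x)) * \<bar>D (e x) u\<bar>)"
        proof (intro continuous_intros)
          show "continuous_on {x0 - r..x0 + r} (\<lambda>x. D (e x) u)"
            by (rule continuous_on_compose2[OF C1on_continuous_derivative[OF f] c1]) (use seg QU in blast)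
          have "continuous_on {x0 - r..x0 + r} (\<lambda>x. f (e x))"
            by (rule continuous_on_compose2[OF C1on_continuous[OF f] c1]) (use seg QU in blast)
          then show "continuous_on {x0 - r..x0 + r} (\<lambda>x. k n (f (e x)))"
            by (rule continuous_on_compose2[OF k0(2)]) simp
        qed
        then have "(\<lambda>x. indicator {x0 - r..x0 + r} x *\<^sub>R (k n (f (e x)) * \<bar>D (e x) u\<bar>)) \<in> borel_measurable borel"
          by (intro borel_measurable_continuous_on_indicator) simp
        then show "(\<lambda>x. ennreal (k n (f (e x)) * \<bar>D (e x) u\<bar>) * indicator {x0 - r..x0 + r} x) \<in> borel_measurable lborel"
          using measurable_ennreal_indicator by simp
      qed
      also have "\<dots> \<le> I n y"
        unfolding I_def
      proof (rule nn_integral_mono)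
        fix x
        show "ennreal \<rho> * (ennreal (k n (f (e x)) * \<bar>D (e x) u\<bar>) * indicator {x0 - r..x0 + r} x) \<le> q n (x *\<^sub>R u + y *\<^sub>R v)"
        proof (cases "x \<in> {x0 - r..x0 + r}")
          case True
          have "\<rho> * (k n (f (e x)) * \<bar>D (e x) u\<bar>) \<le> k n (f (e x)) * norm (gradient D (e x))"
            using mult_left_mono[OF slope[OF segR[OF True]] k0(1)[of n "f (e x)"]] by (simp add: mult_ac)
          then show ?thesis
            using True seg[OF True] \<rho> k0(1)
            by (simp add: q_def e_def[symmetric] ennreal_mult[symmetric] ennreal_leI)
        qed simp
      qed
      finally show ?case .
    qed
    then have "ennreal (2 * \<rho>) \<le> liminf (\<lambda>n. I n y)"
      by (rule Liminf_bounded)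
    then show "z \<bullet> v \<in> T" using yB by (simp add: T_def y_def)
  qed
  have "arclength (Q \<inter> {z. f z = c}) \<le> ennreal L * emeasure lborel T"
    by (rule arclength_le_of_coordinate[OF less_imp_le[OF L] lip proj])
      (use T in \<open>auto simp: T_def\<close>)
  then have "ennreal (2 * \<rho> / L) * arclength (Q \<inter> {z. f z = c}) \<le> ennreal (2 * \<rho> / L) * (ennreal L * emeasure lborel T)"
    by (rule mult_left_mono) simp
  also have "\<dots> = ennreal (2 * \<rho>) * emeasure lborel T"
    using L \<rho> by (simp add: mult.assoc[symmetric] ennreal_mult[symmetric])
  also have "\<dots> = (\<integral>\<^sup>+y. ennreal (2 * \<rho>) * indicator T y \<partial>lborel)"
    using T by (subst nn_integral_cmult_indicator) auto
  also have "\<dots> \<le> (\<integral>\<^sup>+y. liminf (\<lambda>n. I n y) \<partial>lborel)"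
    by (intro nn_integral_mono) (auto simp: T_def indicator_def)
  also have "\<dots> \<le> liminf (\<lambda>n. \<integral>\<^sup>+y. I n y \<partial>lborel)"
    by (rule nn_integral_liminf) simp
  also have "\<dots> = liminf (\<lambda>n. \<integral>\<^sup>+z\<in>Q. ennreal (k n (f z) * norm (gradient D z)) \<partial>lborel)"
    unfolding I_def nn_integral_axis_pair[OF uv q, symmetric] unfolding q_def ..
  finally have main: "ennreal (2 * \<rho> / L) * arclength (Q \<inter> {z. f z = c})
    \<le> liminf (\<lambda>n. \<integral>\<^sup>+z\<in>Q. ennreal (k n (f z) * norm (gradient D z)) \<partial>lborel)" .
  have "2 * (1 - 2 * \<tau>) * (1 - \<tau>) / (1 + 2 * \<tau>) \<le> 2 * \<rho> / L"
  proof -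
    have "(1 - 2 * \<tau>) * (\<kappa> + \<tau>) \<le> (\<kappa> - \<tau>) * (1 + 2 * \<tau>)"
      using \<kappa> \<tau> by (simp add: algebra_simps)
    then have "(1 - 2 * \<tau>) / (1 + 2 * \<tau>) \<le> (\<kappa> - \<tau>) / (\<kappa> + \<tau>)"
      using \<kappa> \<tau> by (simp add: divide_simps)
    then have "2 * (1 - \<tau>) * ((1 - 2 * \<tau>) / (1 + 2 * \<tau>)) \<le> 2 * (1 - \<tau>) * ((\<kappa> - \<tau>) / (\<kappa> + \<tau>))"
      by (rule mult_left_mono) (use \<tau> in simp)
    moreover have "2 * (1 - 2 * \<tau>) * (1 - \<tau>) / (1 + 2 * \<tau>) = 2 * (1 - \<tau>) * ((1 - 2 * \<tau>) / (1 + 2 * \<tau>))"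
      by (simp only: times_divide_eq_right mult_ac)
    moreover have "2 * \<rho> / L = 2 * (1 - \<tau>) * ((\<kappa> - \<tau>) / (\<kappa> + \<tau>))"
      by (simp add: L_def \<rho>_def)
    ultimately show ?thesis by (simp only:)
  qed
  then have "ennreal (2 * (1 - 2 * \<tau>) * (1 - \<tau>) / (1 + 2 * \<tau>)) \<le> ennreal (2 * \<rho> / L)"
    by (rule ennreal_leI)
  from mult_right_mono[OF this] main show ?thesis by (meson order_trans zero_le)
qed

text \<open>
  The lower bound in the coarea formula for a level set. The set \<open>U\<close> is split, up to axis-parallel
  lines, into disjoint open pieces on which the gradient is nearly constant; the local bounds add up
  by Fatou's lemma, and finally \<open>\<tau>\<close> tends to 0 so that no constant is lost. The assumption on lines
  makes the part of the level set on the boundaries of the pieces negligible.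
\<close>

lemma level_set_arclength_le:
  fixes f :: "complex \<Rightarrow> real"
  assumes U: "open U" and f: "C1on U f D"
    and ne: "\<And>z. z \<in> U \<Longrightarrow> gradient D z \<noteq> 0"
    and hk: "jump_at c h k"
    and lines: "\<And>t. countable {z\<in>U. f z = c \<and> Re z = t}" "\<And>t. countable {z\<in>U. f z = c \<and> Im z = t}"
    and bound: "\<forall>\<^sub>F n in sequentially.
      (\<integral>\<^sup>+z\<in>U. ennreal (k n (f z) * norm (gradient D z)) \<partial>lborel) \<le> 2 * B"
  shows "arclength (U \<inter> {z. f z = c}) \<le> B"
proof -
  have k0: "k n t \<ge> 0" "continuous_on UNIV (k n)" for n t using hk by (auto simp: jump_at_def)
  have *: "ennreal (2 * (1 - 2 * \<tau>) * (1 - \<tau>) / (1 + 2 * \<tau>)) * arclength (U \<inter> {z. f z = c}) \<le> 2 * B"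
    if \<tau>: "0 < \<tau>" "\<tau> < 1/4" for \<tau>
  proof -
    define K where "K = ennreal (2 * (1 - 2 * \<tau>) * (1 - \<tau>) / (1 + 2 * \<tau>))"
    define good where "good R \<longleftrightarrow> (\<exists>l u z0. R = box l u \<and> R \<subseteq> U \<and> z0 \<in> R \<and>
       (\<forall>z\<in>R. norm (gradient D z - gradient D z0) \<le> \<tau> * norm (gradient D z0)))" for R
    have ex: "\<exists>R. good R \<and> z0 \<in> R" if z0: "z0 \<in> U" for z0
    proof -
      have e: "\<tau> * norm (gradient D z0) > 0" using ne[OF z0] \<tau> by simp
      have "continuous (at z0) (gradient D)"
        using continuous_on_gradient[OF f] U z0 by (simp add: continuous_on_eq_continuous_at)
      then obtain d where d: "d > 0" "\<And>z. dist z z0 < d \<Longrightarrow> dist (gradient D z) (gradient D z0) < \<tau> * norm (gradient D z0)"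
        using e by (auto simp: continuous_at_eps_delta)
      obtain d' where d': "d' > 0" "ball z0 d' \<subseteq> U"
        using U z0 by (auto simp: open_contains_ball)
      have "min d d' > 0" using d d' by simp
      then obtain l u where lu: "z0 \<in> box l u" "box l u \<subseteq> ball z0 (min d d')"
        by (metis rational_boxes)
      have "norm (gradient D z - gradient D z0) \<le> \<tau> * norm (gradient D z0)" if "z \<in> box l u" for z
        using d(2)[of z] lu(2) that by (auto simp: dist_norm norm_minus_commute less_imp_le)
      moreover have "box l u \<subseteq> U" using lu(2) d'(2) by (meson ball_subset_ball_iff min.cobounded2 order_trans subset_ball)
      ultimately have "good (box l u)" unfolding good_def using lu(1) by blast
      then show ?thesis using lu(1) by blast
    qed
    have "\<And>S. S \<in> Collect good \<Longrightarrow> open S" by (auto simp: good_def)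
    then obtain \<F> where \<F>: "\<F> \<subseteq> Collect good" "countable \<F>" "\<Union>\<F> = \<Union>(Collect good)"
      using Lindelof[of "Collect good"] by blast
    have cover: "U \<subseteq> \<Union>\<F>" unfolding \<F>(3) using ex by blast
    show ?thesis
    proof (cases "U = {}")
      case False
      then have "\<F> \<noteq> {}" using cover by auto
      then obtain R :: "nat \<Rightarrow> complex set" where R: "range R = \<F>"
        using \<F>(2) by (metis range_from_nat_into)
      have goodR: "good (R i)" for i using R \<F>(1) by auto
      have openR: "open (R i)" and RU: "R i \<subseteq> U" for i
        using goodR[of i] by (auto simp: good_def)
      \<comment> \<open>Removing the closures of the earlier boxes keeps the pieces open, which the local bound requires.\<close>
      define Q where "Q i = R i - (\<Union>j<i. closure (R j))" for i
      have Qo: "open (Q i)" for i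
        unfolding Q_def by (intro open_Diff openR closed_UN) auto
      have QR: "Q i \<subseteq> R i" for i by (auto simp: Q_def)
      have "disjoint_family Q"
      proof -
        have "Q i \<inter> Q j = {}" if "i < j" for i j
          using that closure_subset[of "R i"] by (auto simp: Q_def)
        then show ?thesis
          unfolding disjoint_family_on_def by (metis Int_commute linorder_neqE_nat)
      qed
      have cov: "U \<subseteq> (\<Union>i. Q i) \<union> (\<Union>i. frontier (R i))"
      proof
        fix z assume "z \<in> U"
        then have ex_i: "\<exists>i. z \<in> R i" using cover R by auto
        define i where "i = (LEAST i. z \<in> R i)"
        have i: "z \<in> R i" "\<And>j. j < i \<Longrightarrow> z \<notin> R j"
          unfolding i_def using LeastI_ex[OF ex_i] not_less_Least by blast+
        show "z \<in> (\<Union>i. Q i) \<union> (\<Union>i. frontier (R i))"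
        proof (cases "z \<in> Q i")
          case False
          then obtain j where "j < i" "z \<in> closure (R j)" using i by (auto simp: Q_def)
          then have "z \<in> frontier (R j)" using i(2) openR by (auto simp: frontier_def interior_open)
          then show ?thesis by blast
        qed blast
      qed
      have fr: "countable (U \<inter> {z. f z = c} \<inter> frontier (R i))" for i
      proof -
        obtain l u where lu: "R i = box l u" using goodR[of i] by (auto simp: good_def)
        have "frontier (box l u) \<subseteq> {z. Re z = Re l} \<union> {z. Re z = Re u} \<union> {z. Im z = Im l} \<union> {z. Im z = Im u}"
          unfolding frontier_box by (auto simp: in_cbox_complex_iff in_box_complex_iff split: if_splits)
        then have "U \<inter> {z. f z = c} \<inter> frontier (R i) \<subseteq>
            {z\<in>U. f z = c \<and> Re z = Re l} \<union> {z\<in>U. f z = c \<and> Re z = Re u} \<union>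
            {z\<in>U. f z = c \<and> Im z = Im l} \<union> {z\<in>U. f z = c \<and> Im z = Im u}"
          unfolding lu by blast
        then show ?thesis
          by (rule countable_subset) (intro countable_Un lines)
      qed
      define F where "F n z = ennreal (k n (f z) * norm (gradient D z))" for n z
      have Fm: "(\<lambda>z. F n z * indicator U z) \<in> borel_measurable borel" for n
        unfolding F_def
        by (intro measurable_ennreal_indicator measurable_continuous_on_open U continuous_intros
            continuous_on_compose2[OF k0(2)] C1on_continuous[OF f] continuous_on_gradient[OF f]) simp
      have "arclength (U \<inter> {z. f z = c})
          \<le> arclength ((\<Union>i. Q i \<inter> {z. f z = c}) \<union> (\<Union>i. U \<inter> {z. f z = c} \<inter> frontier (R i)))"
        using cov by (intro arclength_mono) blast
      also have "\<dots> \<le> arclength (\<Union>i. Q i \<inter> {z. f z = c}) + 0"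
      proof -
        have "countable (\<Union>i. U \<inter> {z. f z = c} \<inter> frontier (R i))"
          using fr by (intro countable_UN) auto
        then have "arclength (\<Union>i. U \<inter> {z. f z = c} \<inter> frontier (R i)) = 0"
          by (rule arclength_countable)
        then show ?thesis
          using arclength_Un_le[of "\<Union>i. Q i \<inter> {z. f z = c}" "\<Union>i. U \<inter> {z. f z = c} \<inter> frontier (R i)"]
          by (simp only:)
      qed
      also have "\<dots> \<le> (\<Sum>i. arclength (Q i \<inter> {z. f z = c}))"
        unfolding add_0_right by (rule arclength_UN_nat_le)
      finally have "K * arclength (U \<inter> {z. f z = c}) \<le> K * (\<Sum>i. arclength (Q i \<inter> {z. f z = c}))"
        by (rule mult_left_mono) simp
      also have "\<dots> = (\<Sum>i. K * arclength (Q i \<inter> {z. f z = c}))" by simp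
      also have "\<dots> \<le> (\<Sum>i. liminf (\<lambda>n. \<integral>\<^sup>+z\<in>Q i. F n z \<partial>lborel))"
      proof (intro suminf_le allI)
        fix i
        obtain l u z0 where lu: "R i = box l u" "z0 \<in> R i"
            "\<And>z. z \<in> R i \<Longrightarrow> norm (gradient D z - gradient D z0) \<le> \<tau> * norm (gradient D z0)"
          using goodR[of i] by (auto simp: good_def)
        have cb: "convex (R i)" "bounded (R i)" unfolding lu(1) by auto
        have "gradient D z0 \<noteq> 0" using ne lu(2) RU by blast
        then show "K * arclength (Q i \<inter> {z. f z = c}) \<le> liminf (\<lambda>n. \<integral>\<^sup>+z\<in>Q i. F n z \<partial>lborel)"
          unfolding K_def F_def
          by (intro level_set_local[OF f cb RU Qo QR lu(2) \<tau> _ lu(3) hk])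
      qed auto
      also have "\<dots> = (\<integral>\<^sup>+i. liminf (\<lambda>n. \<integral>\<^sup>+z\<in>Q i. F n z \<partial>lborel) \<partial>count_space UNIV)"
        by (simp add: nn_integral_count_space_nat)
      also have "\<dots> \<le> liminf (\<lambda>n. \<integral>\<^sup>+i. (\<integral>\<^sup>+z\<in>Q i. F n z \<partial>lborel) \<partial>count_space UNIV)"
        by (rule nn_integral_liminf) simp
      also have "\<dots> \<le> liminf (\<lambda>n. \<integral>\<^sup>+z\<in>U. F n z \<partial>lborel)"
      proof (intro Liminf_mono always_eventually allI)
        fix n
        have eq: "F n z * indicator (Q i) z = (F n z * indicator U z) * indicator (Q i) z" for i z
          using QR[of i] RU[of i] by (auto simp: indicator_def)
        have "(\<integral>\<^sup>+i. (\<integral>\<^sup>+z\<in>Q i. F n z \<partial>lborel) \<partial>count_space UNIV)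
            = (\<Sum>i. \<integral>\<^sup>+z\<in>Q i. (F n z * indicator U z) \<partial>lborel)"
          by (simp add: nn_integral_count_space_nat eq)
        also have "\<dots> = (\<integral>\<^sup>+z\<in>(\<Union>i. Q i). (F n z * indicator U z) \<partial>lborel)"
          by (rule nn_integral_disjoint_family[symmetric])
            (use Fm Qo \<open>disjoint_family Q\<close> in auto)
        also have "\<dots> \<le> (\<integral>\<^sup>+z\<in>U. F n z \<partial>lborel)"
          by (intro nn_integral_mono) (auto simp: indicator_def)
        finally show "(\<integral>\<^sup>+i. (\<integral>\<^sup>+z\<in>Q i. F n z \<partial>lborel) \<partial>count_space UNIV) \<le> (\<integral>\<^sup>+z\<in>U. F n z \<partial>lborel)" .
      qed
      also have "\<dots> \<le> 2 * B"
      proof -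
        have "liminf (\<lambda>n. \<integral>\<^sup>+z\<in>U. F n z \<partial>lborel) \<le> liminf (\<lambda>n. 2 * B)"
          by (rule Liminf_mono) (use bound in \<open>simp add: F_def\<close>)
        then show ?thesis by (simp add: Liminf_const)
      qed
      finally show ?thesis unfolding K_def .
    qed simp
  qed
  define \<tau> where "\<tau> n = 1 / real (n + 5)" for n :: nat
  have \<tau>: "0 < \<tau> n" "\<tau> n < 1/4" for n by (auto simp: \<tau>_def field_simps)
  have "\<tau> \<longlonglongrightarrow> 0" unfolding \<tau>_def by (rule LIMSEQ_ignore_initial_segment[OF lim_1_over_n])
  then have "(\<lambda>n. 2 * (1 - 2 * \<tau> n) * (1 - \<tau> n) / (1 + 2 * \<tau> n)) \<longlonglongrightarrow> 2 * (1 - 2 * 0) * (1 - 0) / (1 + 2 * 0)"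
    by (intro tendsto_intros) auto
  then have "(\<lambda>n. ennreal (2 * (1 - 2 * \<tau> n) * (1 - \<tau> n) / (1 + 2 * \<tau> n))) \<longlonglongrightarrow> ennreal 2"
    by (intro tendsto_ennrealI) simp
  then have lim: "(\<lambda>n. arclength (U \<inter> {z. f z = c}) * ennreal (2 * (1 - 2 * \<tau> n) * (1 - \<tau> n) / (1 + 2 * \<tau> n)))
      \<longlonglongrightarrow> arclength (U \<inter> {z. f z = c}) * ennreal 2"
    if "arclength (U \<inter> {z. f z = c}) < top"
    using that by (intro ennreal_tendsto_cmult)
  have "arclength (U \<inter> {z. f z = c}) * ennreal 2 \<le> 2 * B"
  proof (cases "arclength (U \<inter> {z. f z = c}) < top")
    case True
    show ?thesis
      by (rule LIMSEQ_le_const2[OF lim[OF True]]) (use *[OF \<tau>] in \<open>auto simp: mult.commute\<close>)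
  next
    case False
    have "ennreal (2 * (1 - 2 * (1/5)) * (1 - 1/5) / (1 + 2 * (1/5))) * arclength (U \<inter> {z. f z = c}) \<le> 2 * B"
      by (rule *) auto
    moreover have "arclength (U \<inter> {z. f z = c}) = top"
      using False top.not_eq_extremum by blast
    ultimately have "2 * B = top"
      by (simp add: ennreal_mult_top top_unique)
    then show ?thesis by simp
  qed
  then have "2 * arclength (U \<inter> {z. f z = c}) \<le> 2 * B" by (simp add: mult.commute)
  then show ?thesis
    by (subst (asm) ennreal_mult_le_mult_iff) auto
qed

section \<open>Unit fields and angles of holomorphic functions\<close>

text \<open>
  The mean of \<open>|cos|\<close> over a half period is \<open>2 / pi\<close>. Hence the antiderivative of \<open>|cos t| - 2 / pi\<close> is
  periodic with period \<open>pi\<close>; on the central half period it is \<open>sin t - 2 / pi * t\<close>, which is bounded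
  by 1. This mean is the source of the constant \<open>1 / pi\<close> in \<open>Psi\<close>.
\<close>

lemma abs_cos_antiderivative:
  obtains G :: "real \<Rightarrow> real" where
    "\<And>t. t \<in> {-pi..pi} \<Longrightarrow> (G has_real_derivative (\<bar>cos t\<bar> - 2 / pi)) (at t)"
    "\<And>t. t \<in> {-pi..0} \<Longrightarrow> G (t + pi) = G t"
    "\<And>t. t \<in> {-pi..pi} \<Longrightarrow> \<bar>G t\<bar> \<le> 1"
proof -
  let ?f = "\<lambda>t::real. \<bar>cos t\<bar> - 2 / pi"
  have "continuous_on {-5..5} ?f" by (intro continuous_intros) auto
  then obtain g where g: "\<And>t. t \<in> {-5..5} \<Longrightarrow> (g has_vector_derivative ?f t) (at t within {-5..5})"
    using antiderivative_continuous by blast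
  define G where "G t = g t - g 0" for t
  have pi4: "pi < 4" "pi > 0" using pi_less_4 by auto
  have G: "(G has_real_derivative ?f t) (at t)" if "t \<in> {-5<..<5}" for t
  proof -
    have "(g has_vector_derivative ?f t) (at t)"
      using g[of t] that at_within_Icc_at[of "-5" t 5] by auto
    then show ?thesis
      unfolding G_def by (auto intro!: derivative_eq_intros simp: has_real_derivative_iff_has_vector_derivative)
  qed
  have center: "G t = sin t - 2 / pi * t" if t: "t \<in> {-pi/2..pi/2}" for t
  proof -
    have "\<exists>c. \<forall>t\<in>{-pi/2..pi/2}. G t - (sin t - 2 / pi * t) = c"
    proof (rule has_field_derivative_zero_constant)
      fix t assume t: "t \<in> {-pi/2..pi/2}"
      then have c: "\<bar>cos t\<bar> = cos t" using cos_ge_zero[of t] by auto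
      have r: "t \<in> {-5<..<5}" using t pi4 by auto
      have "((\<lambda>t. G t - (sin t - 2 / pi * t)) has_real_derivative (?f t - (cos t - 2 / pi * 1))) (at t)"
        by (intro DERIV_diff G[OF r] DERIV_sin DERIV_cmult DERIV_ident)
      then have "((\<lambda>t. G t - (sin t - 2 / pi * t)) has_real_derivative 0) (at t)"
        by (simp add: c)
      then show "((\<lambda>t. G t - (sin t - 2 / pi * t)) has_field_derivative 0) (at t within {-pi/2..pi/2})"
        by (rule has_field_derivative_at_within)
    qed simp
    then obtain c where c: "\<And>t. t \<in> {-pi/2..pi/2} \<Longrightarrow> G t - (sin t - 2 / pi * t) = c" by blast
    have "c = 0" using c[of 0] by (simp add: G_def)
    then show ?thesis using c[OF t] by simp
  qed
  have period: "G (t + pi) = G t" if t: "t \<in> {-pi..0}" for t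
  proof -
    have "\<exists>c. \<forall>t\<in>{-pi..0}. G (t + pi) - G t = c"
    proof (rule has_field_derivative_zero_constant)
      fix t assume t: "t \<in> {-pi..0}"
      then have r: "t \<in> {-5<..<5}" "t + pi \<in> {-5<..<5}" using pi4 by auto
      have "((\<lambda>t. G (t + pi)) has_real_derivative ?f (t + pi)) (at t)"
        using G[OF r(2)] by (simp add: DERIV_shift)
      from DERIV_diff[OF this G[OF r(1)]]
      have "((\<lambda>t. G (t + pi) - G t) has_field_derivative 0) (at t)" by simp
      then show "((\<lambda>t. G (t + pi) - G t) has_field_derivative 0) (at t within {-pi..0})"
        by (rule has_field_derivative_at_within)
    qed simp
    then obtain c where c: "\<And>t. t \<in> {-pi..0} \<Longrightarrow> G (t + pi) - G t = c" by blast
    have "c = 0" using c[of "-pi/2"] center[of "pi/2"] center[of "-pi/2"] by simp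
    then show ?thesis using c[OF t] by simp
  qed
  have bc: "\<bar>G t\<bar> \<le> 1" if t: "t \<in> {-pi/2..pi/2}" for t
  proof (cases "t \<ge> 0")
    case True
    have "0 \<le> sin t" using True t pi4 by (intro sin_ge_zero) auto
    moreover have "sin t \<le> 1" by simp
    moreover have "0 \<le> 2 / pi * t" "2 / pi * t \<le> 1" using True t pi4 by (auto simp: field_simps)
    ultimately show ?thesis unfolding center[OF t] by linarith
  next
    case False
    have "0 \<le> sin (-t)" using False t pi4 by (intro sin_ge_zero) auto
    then have "sin t \<le> 0" by simp
    moreover have "-1 \<le> sin t" by simp
    moreover have "2 / pi * t \<le> 0" "-1 \<le> 2 / pi * t" using False t pi4 by (auto simp: field_simps)
    ultimately show ?thesis unfolding center[OF t] by linarith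
  qed
  have bound: "\<bar>G t\<bar> \<le> 1" if t: "t \<in> {-pi..pi}" for t
  proof -
    consider "t \<in> {-pi/2..pi/2}" | "t > pi/2" | "t < -pi/2" by force
    then show ?thesis
    proof cases
      case 2
      then have "G t = G (t - pi)" using period[of "t - pi"] t by auto
      then show ?thesis using bc[of "t - pi"] 2 t by auto
    next
      case 3
      then have "G t = G (t + pi)" using period[of t] t by auto
      then show ?thesis using bc[of "t + pi"] 3 t by auto
    qed (rule bc)
  qed
  show ?thesis
    by (rule that[of G]) (use G period bound pi4 in auto)
qed

text \<open>
  By periodicity \<open>G (Arg w)\<close> is an even function of \<open>w\<close>, so at the branch cut of \<open>Arg\<close> it may be
  differentiated at \<open>- w\<close> instead.
\<close>

lemma angle_function:
  obtains \<Gamma> :: "complex \<Rightarrow> real" where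
    "\<And>w. w \<noteq> 0 \<Longrightarrow> (\<Gamma> has_derivative (\<lambda>h. (\<bar>Re w\<bar> / norm w - 2 / pi) * Im (h / w))) (at w)"
    "\<And>w. \<bar>\<Gamma> w\<bar> \<le> 1"
proof -
  obtain G :: "real \<Rightarrow> real" where G:
    "\<And>t. t \<in> {-pi..pi} \<Longrightarrow> (G has_real_derivative (\<bar>cos t\<bar> - 2 / pi)) (at t)"
    "\<And>t. t \<in> {-pi..0} \<Longrightarrow> G (t + pi) = G t"
    "\<And>t. t \<in> {-pi..pi} \<Longrightarrow> \<bar>G t\<bar> \<le> 1"
    using abs_cos_antiderivative by metis
  define \<Gamma> where "\<Gamma> w = G (Arg w)" for w
  have arg: "Arg w \<in> {-pi..pi}" for w using Arg_bounded[of w] by auto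
  have even: "\<Gamma> (- w) = \<Gamma> w" if "w \<noteq> 0" for w
    using G(2)[of "Arg w"] G(2)[of "Arg w - pi"] arg[of w] Arg_minus[OF that]
    by (auto simp: \<Gamma>_def split: if_splits)
  have cosA: "\<bar>cos (Arg w)\<bar> = \<bar>Re w\<bar> / norm w" if "w \<noteq> 0" for w
  proof -
    have "sgn w = cis (Arg w)" using that by (simp add: cis_Arg)
    then have "cos (Arg w) = Re (sgn w)" by simp
    then show ?thesis by (simp add: Re_sgn)
  qed
  have d0: "(\<Gamma> has_derivative (\<lambda>h. (\<bar>Re w\<bar> / norm w - 2 / pi) * Im (h / w))) (at w)"
    if w: "w \<notin> \<real>\<^sub>\<le>\<^sub>0" for w
  proof -
    have w0: "w \<noteq> 0" using w by auto
    have "((\<lambda>w. Im (Ln w)) has_derivative (\<lambda>h. Im (inverse w * h))) (at w)"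
      by (rule has_derivative_Im) (use has_field_derivative_Ln[OF w] in \<open>simp add: has_field_derivative_def\<close>)
    moreover have "(G has_derivative (*) (\<bar>Re w\<bar> / norm w - 2 / pi)) (at (Im (Ln w)))"
      using G(1)[OF arg[of w]] cosA[OF w0] Arg_eq_Im_Ln[OF w0] by (simp add: has_field_derivative_def)
    ultimately have "((\<lambda>w. G (Im (Ln w))) has_derivative (\<lambda>h. (\<bar>Re w\<bar> / norm w - 2 / pi) * Im (inverse w * h))) (at w)"
      by (rule has_derivative_compose)
    moreover have "open (- {0::complex})" "w \<in> - {0}" using w0 by auto
    ultimately have "(\<Gamma> has_derivative (\<lambda>h. (\<bar>Re w\<bar> / norm w - 2 / pi) * Im (inverse w * h))) (at w)"
      by (rule has_derivative_transform_within_open) (auto simp: \<Gamma>_def Arg_eq_Im_Ln)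
    then show ?thesis by (simp add: divide_inverse mult.commute)
  qed
  show ?thesis
  proof (rule that[of \<Gamma>])
    fix w :: complex assume w0: "w \<noteq> 0"
    show "(\<Gamma> has_derivative (\<lambda>h. (\<bar>Re w\<bar> / norm w - 2 / pi) * Im (h / w))) (at w)"
    proof (cases "w \<in> \<real>\<^sub>\<le>\<^sub>0")
      case False
      then show ?thesis by (rule d0)
    next
      case True
      then have "- w \<notin> \<real>\<^sub>\<le>\<^sub>0" using w0 by (auto simp: complex_nonpos_Reals_iff complex_eq_iff)
      from d0[OF this]
      have "(\<Gamma> has_derivative (\<lambda>h. (\<bar>Re w\<bar> / norm w - 2 / pi) * Im (h / - w))) (at (- w))" by simp
      moreover have "((\<lambda>w::complex. - w) has_derivative (\<lambda>h. - h)) (at w)"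
        by (rule has_derivative_minus[OF has_derivative_ident])
      ultimately have "((\<lambda>w. \<Gamma> (- w)) has_derivative (\<lambda>h. (\<bar>Re w\<bar> / norm w - 2 / pi) * Im (- h / - w))) (at w)"
        by (rule has_derivative_compose[rotated])
      moreover have "open (- {0::complex})" "w \<in> - {0}" using w0 by auto
      ultimately have "(\<Gamma> has_derivative (\<lambda>h. (\<bar>Re w\<bar> / norm w - 2 / pi) * Im (- h / - w))) (at w)"
        by (rule has_derivative_transform_within_open) (auto simp: even)
      then show ?thesis by simp
    qed
  qed (use G(3)[OF arg] in \<open>simp add: \<Gamma>_def\<close>)
qed

text \<open>
  All fields below are built from nonvanishing holomorphic functions through their modulus, sign and
  argument. Their derivatives depend on \<open>g\<close> through the logarithmic derivative \<open>m\<close> alone, and \<open>m\<close> is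
  additive under products and quotients.
\<close>

definition log_deriv_on :: "complex set \<Rightarrow> (complex \<Rightarrow> complex) \<Rightarrow> (complex \<Rightarrow> complex) \<Rightarrow> bool" where
  "log_deriv_on U g m \<longleftrightarrow>
     (\<forall>z\<in>U. g z \<noteq> 0 \<and> (g has_field_derivative g z * m z) (at z)) \<and> continuous_on U m"

lemma log_deriv_onD:
  assumes "log_deriv_on U g m"
  shows "z \<in> U \<Longrightarrow> g z \<noteq> 0" "z \<in> U \<Longrightarrow> (g has_derivative (\<lambda>h. g z * m z * h)) (at z)"
    "continuous_on U m" "continuous_on U g"
  using assms unfolding log_deriv_on_def
  by (auto simp: has_field_derivative_def intro!: continuous_at_imp_continuous_on DERIV_isCont)

lemma log_deriv_on_mult:
  assumes "log_deriv_on U g m" "log_deriv_on U g' m'"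
  shows "log_deriv_on U (\<lambda>z. g z * g' z) (\<lambda>z. m z + m' z)"
  using assms unfolding log_deriv_on_def
  by (auto intro!: derivative_eq_intros continuous_intros simp: algebra_simps)

lemma log_deriv_on_divide:
  assumes "log_deriv_on U g m" "log_deriv_on U g' m'"
  shows "log_deriv_on U (\<lambda>z. g z / g' z) (\<lambda>z. m z - m' z)"
  using assms unfolding log_deriv_on_def
  by (auto intro!: derivative_eq_intros continuous_intros simp: field_simps)

lemma log_deriv_on_const: "c \<noteq> 0 \<Longrightarrow> log_deriv_on U (\<lambda>z. c) (\<lambda>z. 0)"
  by (auto simp: log_deriv_on_def)

lemma C1on_cmod:
  assumes g: "log_deriv_on U g m"
  shows "C1on U (\<lambda>z. cmod (g z)) (\<lambda>z h. cmod (g z) * Re (m z * h))"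
proof (rule C1onI)
  fix z assume z: "z \<in> U"
  note gz = log_deriv_onD(1,2)[OF g z]
  have "((\<lambda>z. cmod (g z)) has_derivative (\<lambda>h. (g z * m z * h) \<bullet> sgn (g z))) (at z)"
    by (rule has_derivative_compose[OF gz(2) has_derivative_norm[OF gz(1)]])
  also have "(\<lambda>h. (g z * m z * h) \<bullet> sgn (g z)) = (\<lambda>h. cmod (g z) * Re (m z * h))"
  proof
    fix h
    have "(g z * m z * h) \<bullet> sgn (g z) = Re ((g z * m z * h) * cnj (sgn (g z)))"
      by (simp add: inner_complex_def)
    also have "(g z * m z * h) * cnj (sgn (g z)) = (m z * h) * (g z * cnj (g z)) / of_real (cmod (g z))"
      by (simp add: sgn_eq)
    also have "\<dots> = (m z * h) * of_real (cmod (g z))"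
      using gz(1) by (simp add: complex_norm_square[symmetric] power2_eq_square)
    finally show "(g z * m z * h) \<bullet> sgn (g z) = cmod (g z) * Re (m z * h)" by simp
  qed
  finally show "((\<lambda>z. cmod (g z)) has_derivative (\<lambda>h. cmod (g z) * Re (m z * h))) (at z)" .
qed (intro continuous_intros log_deriv_onD(3,4)[OF g])

lemma C1on_sgn:
  assumes g: "log_deriv_on U g m"
  shows "C1on U (\<lambda>z. sgn (g z)) (\<lambda>z h. sgn (g z) * (\<i> * of_real (Im (m z * h))))"
proof (rule C1onI)
  fix z assume z: "z \<in> U"
  note gz = log_deriv_onD(1,2)[OF g z]
  have c: "((\<lambda>z. cmod (g z)) has_derivative (\<lambda>h. cmod (g z) * Re (m z * h))) (at z)"
    by (rule C1onD[OF C1on_cmod[OF g] z])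
  have "((\<lambda>z. g z / of_real (cmod (g z))) has_derivative
      (\<lambda>h. (g z * m z * h * of_real (cmod (g z)) - g z * of_real (cmod (g z) * Re (m z * h)))
        / (of_real (cmod (g z)) * of_real (cmod (g z))))) (at z)"
    by (rule has_derivative_divide'[OF gz(2) has_derivative_of_real[OF c]]) (use gz in simp)
  also have "(\<lambda>z. g z / of_real (cmod (g z))) = (\<lambda>z. sgn (g z))"
    by (simp add: sgn_eq)
  also have "(\<lambda>h. (g z * m z * h * of_real (cmod (g z)) - g z * of_real (cmod (g z) * Re (m z * h)))
        / (of_real (cmod (g z)) * of_real (cmod (g z)))) = (\<lambda>h. sgn (g z) * (\<i> * of_real (Im (m z * h))))"
  proof
    fix h
    have "m z * h - of_real (Re (m z * h)) = \<i> * of_real (Im (m z * h))"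
      by (simp add: complex_eq_iff)
    moreover have "g z * m z * h * of_real (cmod (g z)) - g z * of_real (cmod (g z) * Re (m z * h))
        = g z * of_real (cmod (g z)) * (m z * h - of_real (Re (m z * h)))"
      by (simp add: right_diff_distrib mult_ac)
    ultimately have "g z * m z * h * of_real (cmod (g z)) - g z * of_real (cmod (g z) * Re (m z * h))
        = g z * of_real (cmod (g z)) * (\<i> * of_real (Im (m z * h)))"
      by (simp only:)
    then show "(g z * m z * h * of_real (cmod (g z)) - g z * of_real (cmod (g z) * Re (m z * h)))
        / (of_real (cmod (g z)) * of_real (cmod (g z))) = sgn (g z) * (\<i> * of_real (Im (m z * h)))"
      using gz(1) by (simp add: sgn_eq)
  qed
  finally show "((\<lambda>z. sgn (g z)) has_derivative (\<lambda>h. sgn (g z) * (\<i> * of_real (Im (m z * h))))) (at z)" .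
next
  fix v
  have "continuous_on U (\<lambda>z. g z / of_real (cmod (g z)) * (\<i> * of_real (Im (m z * v))))"
    by (intro continuous_intros log_deriv_onD(3,4)[OF g]) (use log_deriv_onD(1)[OF g] in simp)
  then show "continuous_on U (\<lambda>z. sgn (g z) * (\<i> * of_real (Im (m z * v))))"
    by (simp add: sgn_eq)
qed

lemma divergence_sgn:
  "divergence (\<lambda>z h. sgn (g z) * (\<i> * of_real (Im (m z * h)))) z = Re (sgn (g z) * m z)"
  by (simp add: divergence_def)

lemma C1on_angle:
  assumes \<Gamma>: "\<And>w. w \<noteq> 0 \<Longrightarrow> (\<Gamma> has_derivative (\<lambda>h. (\<bar>Re w\<bar> / norm w - 2 / pi) * Im (h / w))) (at w)"
    and g: "log_deriv_on U g m"
  shows "C1on U (\<lambda>z. \<Gamma> (g z)) (\<lambda>z h. (\<bar>Re (g z)\<bar> / norm (g z) - 2 / pi) * Im (m z * h))"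
proof (rule C1onI)
  fix z assume z: "z \<in> U"
  note gz = log_deriv_onD(1,2)[OF g z]
  have "((\<lambda>z. \<Gamma> (g z)) has_derivative (\<lambda>h. (\<bar>Re (g z)\<bar> / norm (g z) - 2 / pi) * Im (g z * m z * h / g z))) (at z)"
    by (rule has_derivative_compose[OF gz(2) \<Gamma>[OF gz(1)]])
  then show "((\<lambda>z. \<Gamma> (g z)) has_derivative (\<lambda>h. (\<bar>Re (g z)\<bar> / norm (g z) - 2 / pi) * Im (m z * h))) (at z)"
    using gz(1) by (simp add: mult.assoc)
next
  fix v
  show "continuous_on U (\<lambda>z. (\<bar>Re (g z)\<bar> / norm (g z) - 2 / pi) * Im (m z * v))"
    by (intro continuous_intros log_deriv_onD(3,4)[OF g]) (use log_deriv_onD(1)[OF g] in auto)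
qed

lemma C1on_divide:
  fixes a b :: "complex \<Rightarrow> real"
  assumes a: "C1on U a A" and b: "C1on U b B" and nz: "\<And>z. z \<in> U \<Longrightarrow> b z \<noteq> 0"
  shows "C1on U (\<lambda>z. a z / b z) (\<lambda>z h. (A z h * b z - a z * B z h) / (b z * b z))"
proof (rule C1onI)
  fix z assume "z \<in> U"
  then show "((\<lambda>z. a z / b z) has_derivative (\<lambda>h. (A z h * b z - a z * B z h) / (b z * b z))) (at z)"
    by (intro has_derivative_divide' C1onD[OF a] C1onD[OF b] nz)
qed (intro continuous_intros C1on_continuous[OF a] C1on_continuous[OF b]
    C1on_continuous_derivative[OF a] C1on_continuous_derivative[OF b]; use nz in simp)

section \<open>Flux through the level curves\<close>

text \<open>
  A cutoff in the modulus of \<open>p\<close>: it equals 1 near modulus 1, and its support \<open>[1/2, 3/2]\<close> stays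
  away from the zeros of \<open>p\<close> and inside the sublevel set \<open>|p| < 2\<close>.
\<close>

definition ring_cutoff :: "real \<Rightarrow> real" where
  "ring_cutoff t = smoothstep (4 * t - 2) * (1 - smoothstep (4 * t - 5))"

definition ring_cutoff' :: "real \<Rightarrow> real" where
  "ring_cutoff' t = 4 * smoothstep' (4 * t - 2) * (1 - smoothstep (4 * t - 5))
     - 4 * smoothstep (4 * t - 2) * smoothstep' (4 * t - 5)"

lemma smoothstep_affine_deriv:
  "((\<lambda>t. smoothstep (a * t + b)) has_real_derivative a * smoothstep' (a * t + b)) (at t)"
proof -
  have "((\<lambda>t. a * t + b) has_real_derivative a) (at t)"
    by (auto intro!: derivative_eq_intros)
  from DERIV_chain2[OF smoothstep_deriv this] show ?thesis by (simp add: mult.commute)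
qed

lemma ring_cutoff_deriv: "(ring_cutoff has_real_derivative ring_cutoff' t) (at t)"
proof -
  have "((\<lambda>t. smoothstep (4 * t + -2) * (1 - smoothstep (4 * t + -5))) has_real_derivative
      4 * smoothstep' (4 * t + -2) * (1 - smoothstep (4 * t + -5))
      + (0 - 4 * smoothstep' (4 * t + -5)) * smoothstep (4 * t + -2)) (at t)"
    by (rule DERIV_mult[OF smoothstep_affine_deriv DERIV_diff[OF DERIV_const smoothstep_affine_deriv]])
  then show ?thesis
    by (simp add: ring_cutoff_def[abs_def] ring_cutoff'_def algebra_simps)
qed

lemma continuous_smoothstep [continuous_intros]:
  "continuous_on S f \<Longrightarrow> continuous_on S (\<lambda>x. smoothstep (f x))"
  by (rule continuous_on_compose2[of UNIV])
    (auto intro!: continuous_at_imp_continuous_on DERIV_isCont[OF smoothstep_deriv])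

lemma continuous_smoothstep' [continuous_intros]:
  "continuous_on S f \<Longrightarrow> continuous_on S (\<lambda>x. smoothstep' (f x))"
  by (rule continuous_on_compose2[OF smoothstep'_continuous]) auto

lemma continuous_ring_cutoff [continuous_intros]:
  "continuous_on S f \<Longrightarrow> continuous_on S (\<lambda>x. ring_cutoff (f x))"
  unfolding ring_cutoff_def by (intro continuous_intros)

lemma ring_cutoff'_continuous: "continuous_on UNIV ring_cutoff'"
  unfolding ring_cutoff'_def[abs_def] by (intro continuous_intros)

lemma ring_cutoff_bounds: "0 \<le> ring_cutoff t" "ring_cutoff t \<le> 1"
  using smoothstep_bounds[of "4 * t - 2"] smoothstep_bounds[of "4 * t - 5"]
  by (auto simp: ring_cutoff_def intro!: mult_le_one)

lemma ring_cutoff'_bound: "\<bar>ring_cutoff' t\<bar> \<le> 16"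
proof -
  have "\<bar>4 * smoothstep' (4 * t - 2) * (1 - smoothstep (4 * t - 5))\<bar> \<le> 8 * 1"
    unfolding abs_mult using smoothstep_bounds[of "4 * t - 5"] smoothstep'_bounds[of "4 * t - 2"]
    by (intro mult_mono) auto
  moreover have "\<bar>4 * smoothstep (4 * t - 2) * smoothstep' (4 * t - 5)\<bar> \<le> 4 * 2"
    unfolding abs_mult using smoothstep_bounds[of "4 * t - 2"] smoothstep'_bounds[of "4 * t - 5"]
    by (intro mult_mono) auto
  ultimately show ?thesis unfolding ring_cutoff'_def by linarith
qed

lemma ring_cutoff_support:
  assumes "t \<le> 1/2 \<or> t \<ge> 3/2"
  shows "ring_cutoff t = 0" "ring_cutoff' t = 0"
  using assms smoothstep_eq_0[of "4 * t - 2"] smoothstep_eq_1[of "4 * t - 5"]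
    smoothstep'_eq_0[of "4 * t - 2"] smoothstep'_eq_0[of "4 * t - 5"]
  by (auto simp: ring_cutoff_def ring_cutoff'_def)

lemma ring_cutoff_eq_1: "3/4 \<le> t \<Longrightarrow> t \<le> 5/4 \<Longrightarrow> ring_cutoff t = 1"
  by (simp add: ring_cutoff_def smoothstep_eq_1 smoothstep_eq_0)

text \<open>
  A jump at 1 spread over an interval of length \<open>2 / (n + 4)\<close>; the offset 4 keeps that interval where
  \<open>ring_cutoff\<close> equals 1.
\<close>

definition jump_profile :: "nat \<Rightarrow> real \<Rightarrow> real" where
  "jump_profile n t = 2 * smoothstep (real (n + 4) / 2 * t + (1 - real (n + 4)) / 2) - 1"

definition jump_profile' :: "nat \<Rightarrow> real \<Rightarrow> real" where
  "jump_profile' n t = real (n + 4) * smoothstep' (real (n + 4) / 2 * t + (1 - real (n + 4)) / 2)"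

lemma jump_profile_deriv: "(jump_profile n has_real_derivative jump_profile' n t) (at t)"
proof -
  have "((\<lambda>t. 2 * smoothstep (real (n + 4) / 2 * t + (1 - real (n + 4)) / 2) - 1) has_real_derivative
     (2 * (real (n + 4) / 2 * smoothstep' (real (n + 4) / 2 * t + (1 - real (n + 4)) / 2)) - 0)) (at t)"
    by (rule DERIV_diff[OF DERIV_cmult[OF smoothstep_affine_deriv] DERIV_const])
  then show ?thesis by (simp add: jump_profile_def[abs_def] jump_profile'_def)
qed

lemma jump_profile'_continuous: "continuous_on UNIV (jump_profile' n)"
  unfolding jump_profile'_def[abs_def] by (intro continuous_intros)

lemma jump_profile'_nonneg: "0 \<le> jump_profile' n t"
  by (simp add: jump_profile'_def smoothstep'_bounds)

lemma jump_profile_bound: "\<bar>jump_profile n t\<bar> \<le> 1"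
  using smoothstep_bounds[of "real (n + 4) / 2 * t + (1 - real (n + 4)) / 2"]
  unfolding jump_profile_def by linarith

lemma jump_profile_eq:
  assumes "real (n + 4) * \<bar>t - 1\<bar> \<ge> 1"
  shows "t < 1 \<Longrightarrow> jump_profile n t = -1" "t > 1 \<Longrightarrow> jump_profile n t = 1" "jump_profile' n t = 0"
proof -
  have e: "real (n + 4) / 2 * t + (1 - real (n + 4)) / 2 = (real (n + 4) * (t - 1) + 1) / 2"
    by (simp add: field_simps)
  have lt: "t < 1 \<Longrightarrow> (real (n + 4) * (t - 1) + 1) / 2 \<le> 0"
    using assms by (simp add: algebra_simps abs_if)
  have gt: "t > 1 \<Longrightarrow> (real (n + 4) * (t - 1) + 1) / 2 \<ge> 1"
    using assms by (simp add: algebra_simps abs_if)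
  show "t < 1 \<Longrightarrow> jump_profile n t = -1" "t > 1 \<Longrightarrow> jump_profile n t = 1"
    unfolding jump_profile_def e using smoothstep_eq_0[OF lt] smoothstep_eq_1[OF gt] by auto
  have "t \<noteq> 1" using assms by auto
  then show "jump_profile' n t = 0"
    unfolding jump_profile'_def e using smoothstep'_eq_0 lt gt by (metis linorder_neqE_linordered_idom mult_zero_right)
qed

lemma jump_profile'_cutoff: "jump_profile' n t * ring_cutoff t = jump_profile' n t"
proof (cases "3/4 \<le> t \<and> t \<le> 5/4")
  case False
  then have "1/4 \<le> \<bar>t - 1\<bar>" by linarith
  then have "4 * (1/4) \<le> real (n + 4) * \<bar>t - 1\<bar>" by (intro mult_mono) auto
  then show ?thesis using jump_profile_eq(3)[of n t] by simp
qed (simp add: ring_cutoff_eq_1)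

lemma jump_at_jump_profile: "jump_at 1 jump_profile jump_profile'"
proof -
  have ev: "\<forall>\<^sub>F n in sequentially. real (n + 4) * \<bar>t - 1\<bar> \<ge> 1" if "t \<noteq> 1" for t
  proof -
    obtain N :: nat where N: "1 / \<bar>t - 1\<bar> < real N" using reals_Archimedean2 by blast
    have "real (n + 4) * \<bar>t - 1\<bar> \<ge> 1" if "n \<ge> N" for n
    proof -
      have "1 / \<bar>t - 1\<bar> \<le> real (n + 4)" using N that by linarith
      then show ?thesis using \<open>t \<noteq> 1\<close> by (simp add: divide_le_eq split: if_splits)
    qed
    then show ?thesis by (auto simp: eventually_sequentially)
  qed
  show ?thesis
    unfolding jump_at_def
  proof (intro conjI allI impI)
    fix t :: real assume t: "t < 1"
    show "\<forall>\<^sub>F n in sequentially. jump_profile n t = -1"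
      using ev[of t] t by (auto elim!: eventually_mono simp: jump_profile_eq)
  next
    fix t :: real assume t: "t > 1"
    show "\<forall>\<^sub>F n in sequentially. jump_profile n t = 1"
      using ev[of t] t by (auto elim!: eventually_mono simp: jump_profile_eq)
  qed (simp_all add: jump_profile_deriv jump_profile'_continuous jump_profile'_nonneg)
qed

lemma log_deriv_on_poly:
  fixes p :: "complex poly"
  assumes "\<And>z. z \<in> U \<Longrightarrow> poly p z \<noteq> 0"
  shows "log_deriv_on U (poly p) (\<lambda>z. poly (pderiv p) z / poly p z)"
  unfolding log_deriv_on_def using assms by (auto intro!: continuous_intros poly_DERIV)

lemma sublevel_bounded_radius:
  assumes "degree (p :: complex poly) > 0"
  obtains R where "\<And>z. norm z \<ge> R \<Longrightarrow> cmod (poly p z) \<ge> 2"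
proof (cases p)
  case (pCons a q)
  then have "q \<noteq> 0" using assms by auto
  from poly_infinity[OF this, of 2 a] show ?thesis using pCons that by blast
qed

lemma sublevel_borel [measurable]: "sublevel R p \<in> sets borel"
  unfolding sublevel_def by (intro borel_open open_Collect_less continuous_intros)

text \<open>
  The outward unit normal of the level sets of \<open>|p|\<close> is \<open>n = sgn (p / p')\<close>, and the gradient of \<open>|p|\<close>
  is \<open>|p'| n\<close>. With \<open>\<psi>\<close> the logarithmic derivative of \<open>p'\<close>, that of \<open>p / p'\<close> is \<open>p' / p - \<psi>\<close>, so
  the divergence of \<open>n\<close> is \<open>|p'| / |p| - Re (\<psi> n)\<close>. Hence the flux of \<open>n\<close>, multiplied by a smoothed
  sign of \<open>|p| - 1\<close> and by the cutoff, is the smoothed length of the level curve plus a curvature term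
  bounded by \<open>|Re (\<psi> n)|\<close> and a multiple of \<open>|p'|\<close>. Because the sign takes both values \<open>-1\<close> and
  \<open>1\<close>, the length is counted twice against one curvature term.
\<close>

lemma level_flux_le:
  fixes p :: "complex poly"
  assumes p: "degree p > 0" and U: "open U"
    and nz: "\<And>z. z \<in> U \<Longrightarrow> poly p z \<noteq> 0" "\<And>z. z \<in> U \<Longrightarrow> poly (pderiv p) z \<noteq> 0"
    and len: "arclength (frontier U) \<le> ennreal l" and l: "l \<ge> 0"
  defines "\<theta> \<equiv> (\<lambda>z. \<bar>Re (log_deriv p z * sgn (poly p z / poly (pderiv p) z))\<bar>)"
  shows "(\<integral>\<^sup>+z\<in>U. ennreal (jump_profile' n (cmod (poly p z)) * cmod (poly (pderiv p) z)) \<partial>lborel)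
    \<le> (\<integral>\<^sup>+z\<in>U. ennreal (ring_cutoff (cmod (poly p z)) * \<theta> z
         + indicator (sublevel 2 p) z * (18 * cmod (poly (pderiv p) z))) \<partial>lborel) + ennreal (96 * l)"
proof -
  define P where "P = poly p"
  define B where "B = poly (pderiv p)"
  define \<psi> where "\<psi> = log_deriv p"
  define mP where "mP z = B z / P z" for z
  define q where "q z = P z / B z" for z
  have ldP: "log_deriv_on U P mP"
    using log_deriv_on_poly[of U p] nz unfolding P_def B_def mP_def by blast
  have ldB: "log_deriv_on U B \<psi>"
    using log_deriv_on_poly[of U "pderiv p"] nz unfolding B_def \<psi>_def log_deriv_def[abs_def] by blast
  have ldq: "log_deriv_on U q (\<lambda>z. mP z - \<psi> z)"
    unfolding q_def[abs_def] by (rule log_deriv_on_divide[OF ldP ldB])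
  define a where "a t = jump_profile n t * ring_cutoff t" for t
  define a' where "a' t = jump_profile' n t * ring_cutoff t + ring_cutoff' t * jump_profile n t" for t
  have a: "(a has_real_derivative a' t) (at t)" for t
    unfolding a_def[abs_def] a'_def by (rule DERIV_mult[OF jump_profile_deriv ring_cutoff_deriv])
  have ca: "continuous_on UNIV a'"
    unfolding a'_def[abs_def]
    by (intro continuous_intros jump_profile'_continuous ring_cutoff'_continuous
        continuous_at_imp_continuous_on ballI DERIV_isCont[OF jump_profile_deriv])
  have abound: "\<bar>a t\<bar> \<le> ring_cutoff t" for t
    using mult_right_mono[OF jump_profile_bound[of n t] ring_cutoff_bounds(1)[of t]]
    by (simp add: a_def abs_mult ring_cutoff_bounds)
  define V where "V z = a (cmod (P z)) *\<^sub>R sgn (q z)" for z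
  have A: "C1on U (\<lambda>z. a (cmod (P z))) (\<lambda>z h. a' (cmod (P z)) * (cmod (P z) * Re (mP z * h)))"
    by (rule C1on_compose_real[OF C1on_cmod[OF ldP] a ca])
  note S = C1on_sgn[OF ldq]
  note V = C1on_scaleR[OF A S]
  have nP: "P z \<noteq> 0" "B z \<noteq> 0" if "z \<in> U" for z using nz that by (auto simp: P_def B_def)
  obtain R where R: "\<And>z. norm z \<ge> R \<Longrightarrow> cmod (poly p z) \<ge> 2"
    using sublevel_bounded_radius[OF p] by blast
  have cont: "continuous_on U P" "continuous_on U B" "continuous_on U \<psi>"
    using log_deriv_onD(3,4)[OF ldP] log_deriv_onD(3,4)[OF ldB] by auto
  have "(\<integral>\<^sup>+z\<in>U. ennreal (jump_profile' n (cmod (P z)) * cmod (B z)) \<partial>lborel)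
    \<le> (\<integral>\<^sup>+z\<in>U. ennreal (ring_cutoff (cmod (P z)) * \<bar>Re (\<psi> z * sgn (q z))\<bar>
         + indicator (sublevel 2 p) z * (18 * cmod (B z))) \<partial>lborel) + ennreal (96 * 1 * l)"
  proof (rule stokes_le[OF U V _ _ _ _ _ _ _ _ len l, of 1 R])
    fix z assume z: "z \<in> U"
    have "\<bar>a (cmod (P z))\<bar> \<le> 1"
      using abound[of "cmod (P z)"] ring_cutoff_bounds(2)[of "cmod (P z)"] by linarith
    then show "norm (a (cmod (P z)) *\<^sub>R sgn (q z)) \<le> 1"
      by (simp add: norm_sgn)
  next
    fix z :: complex assume "norm z \<ge> R"
    then have "ring_cutoff (cmod (P z)) = 0"
      using R[of z] by (intro ring_cutoff_support) (simp add: P_def)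
    then show "a (cmod (P z)) *\<^sub>R sgn (q z) = 0" by (simp add: a_def)
  next
    show "(\<lambda>z. indicator U z * (jump_profile' n (cmod (P z)) * cmod (B z))) \<in> borel_measurable borel"
      by (intro measurable_continuous_on_open U continuous_intros cont
          continuous_on_compose2[OF jump_profile'_continuous]) auto
    have "(\<lambda>z. indicator U z * (ring_cutoff (cmod (P z)) * \<bar>Re (\<psi> z * (q z / of_real (cmod (q z))))\<bar>)) \<in> borel_measurable borel"
      unfolding q_def
      by (intro measurable_continuous_on_open U continuous_intros cont) (use nP in auto)
    moreover have "(\<lambda>z. indicator (sublevel 2 p) z * (indicator U z * (18 * cmod (B z)))) \<in> borel_measurable borel"
    proof (rule borel_measurable_times)
      show "(\<lambda>z. indicator (sublevel 2 p) z :: real) \<in> borel_measurable borel"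
        by (intro borel_measurable_indicator sublevel_borel)
      show "(\<lambda>z. indicator U z * (18 * cmod (B z))) \<in> borel_measurable borel"
        by (intro measurable_continuous_on_open U continuous_intros cont)
    qed
    ultimately have "(\<lambda>z. indicator U z * (ring_cutoff (cmod (P z)) * \<bar>Re (\<psi> z * (q z / of_real (cmod (q z))))\<bar>)
        + indicator (sublevel 2 p) z * (indicator U z * (18 * cmod (B z)))) \<in> borel_measurable borel"
      by (rule borel_measurable_add)
    then show "(\<lambda>z. indicator U z * (ring_cutoff (cmod (P z)) * \<bar>Re (\<psi> z * sgn (q z))\<bar>
         + indicator (sublevel 2 p) z * (18 * cmod (B z)))) \<in> borel_measurable borel"
      by (simp add: sgn_eq distrib_left mult.left_commute)
  next
    fix z assume z: "z \<in> U"
    define t where "t = cmod (P z)"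
    have qz: "q z \<noteq> 0" using nP[OF z] by (simp add: q_def)
    have t0: "t > 0" using nP[OF z] by (simp add: t_def)
    have e: "mP z * sgn (q z) = of_real (cmod (B z) / t)"
    proof -
      have "mP z = 1 / q z" by (simp add: mP_def q_def)
      then have "mP z * sgn (q z) = of_real (1 / cmod (q z))" using qz by (simp add: sgn_eq)
      then show ?thesis by (simp add: q_def norm_divide t_def)
    qed
    have "divergence (\<lambda>z h. a (cmod (P z)) *\<^sub>R (sgn (q z) * (\<i> * of_real (Im ((mP z - \<psi> z) * h))))
          + (a' (cmod (P z)) * (cmod (P z) * Re (mP z * h))) *\<^sub>R sgn (q z)) z
        = a t * Re (sgn (q z) * (mP z - \<psi> z)) + a' t * (t * Re (mP z * sgn (q z)))"
      unfolding divergence_scaleR[OF A z] divergence_sgn t_def ..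
    also have "\<dots> = a t * (cmod (B z) / t - Re (\<psi> z * sgn (q z))) + a' t * cmod (B z)"
    proof -
      have "sgn (q z) * (mP z - \<psi> z) = of_real (cmod (B z) / t) - \<psi> z * sgn (q z)"
        using e by (simp add: algebra_simps)
      then show ?thesis using e t0 by simp
    qed
    also have "\<dots> = jump_profile' n t * cmod (B z) + (a t * (cmod (B z) / t)
        - a t * Re (\<psi> z * sgn (q z)) + ring_cutoff' t * jump_profile n t * cmod (B z))"
      unfolding a'_def jump_profile'_cutoff by (simp add: algebra_simps)
    finally have div: "divergence (\<lambda>z h. a (cmod (P z)) *\<^sub>R (sgn (q z) * (\<i> * of_real (Im ((mP z - \<psi> z) * h))))
          + (a' (cmod (P z)) * (cmod (P z) * Re (mP z * h))) *\<^sub>R sgn (q z)) z = \<dots>" .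
    have 1: "\<bar>a t * Re (\<psi> z * sgn (q z))\<bar> \<le> ring_cutoff t * \<bar>Re (\<psi> z * sgn (q z))\<bar>"
      unfolding abs_mult by (intro mult_right_mono abound) simp
    \<comment> \<open>On the support of the cutoffs \<open>|p|\<close> is at least \<open>1/2\<close>, whence \<open>18 = 2 + 16\<close>.\<close>
    have 23: "\<bar>a t * (cmod (B z) / t)\<bar> + \<bar>ring_cutoff' t * jump_profile n t * cmod (B z)\<bar>
        \<le> indicator (sublevel 2 p) z * (18 * cmod (B z))"
    proof (cases "t \<le> 1/2 \<or> t \<ge> 3/2")
      case True
      then show ?thesis using ring_cutoff_support[OF True] by (simp add: a_def)
    next
      case False
      have "cmod (B z) / t \<le> cmod (B z) / (1/2)"
        using False by (intro divide_left_mono) auto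
      then have "\<bar>a t * (cmod (B z) / t)\<bar> \<le> 1 * (cmod (B z) / (1/2))"
        unfolding abs_mult using t0 abound[of t] ring_cutoff_bounds(2)[of t]
        by (intro mult_mono) auto
      moreover have "\<bar>ring_cutoff' t * jump_profile n t * cmod (B z)\<bar> \<le> 16 * 1 * cmod (B z)"
        unfolding abs_mult using ring_cutoff'_bound[of t] jump_profile_bound[of n t]
        by (intro mult_mono) auto
      moreover have "z \<in> sublevel 2 p" using False by (simp add: sublevel_def t_def P_def)
      ultimately show ?thesis by simp
    qed
    show "jump_profile' n (cmod (P z)) * cmod (B z)
      \<le> divergence (\<lambda>z h. a (cmod (P z)) *\<^sub>R (sgn (q z) * (\<i> * of_real (Im ((mP z - \<psi> z) * h))))
          + (a' (cmod (P z)) * (cmod (P z) * Re (mP z * h))) *\<^sub>R sgn (q z)) z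
        + (ring_cutoff (cmod (P z)) * \<bar>Re (\<psi> z * sgn (q z))\<bar> + indicator (sublevel 2 p) z * (18 * cmod (B z)))"
      unfolding div using 1 23 unfolding t_def[symmetric] by linarith
  qed (auto simp: jump_profile'_nonneg ring_cutoff_bounds)
  then show ?thesis
    unfolding \<theta>_def P_def B_def \<psi>_def q_def by simp
qed

section \<open>Averaging the angle\<close>

text \<open>
  Let \<open>w = p \<psi> / p'\<close>. Then \<open>|Re (\<psi> n)|\<close> is \<open>|\<psi>|\<close> times \<open>|cos|\<close> of the argument of \<open>w\<close>, and the task
  is to replace \<open>|cos|\<close> by its mean. The unit field \<open>F = sgn (- \<i> / \<psi>)\<close> is the direction in which
  the argument of \<open>p'\<close> decreases fastest, at rate \<open>|\<psi>|\<close>; along \<open>F\<close> the argument of \<open>w\<close> increases at rate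
  \<open>|\<psi>|\<close> up to an error \<open>|p' / p| + |\<psi>' / \<psi>|\<close>. With \<open>\<Gamma>\<close> from \<open>angle_function\<close>, the main term in the
  divergence of \<open>\<Gamma> (w) F\<close> is therefore \<open>|\<psi>|\<close> times \<open>|cos| - 2 / pi\<close>, exactly the oscillation to be
  removed. The factor \<open>smoothstep (2 |\<psi>| / \<mu> - 1)\<close> restricts to \<open>|\<psi>| \<ge> \<mu> / 2\<close>; differentiating it
  produces the terms with \<open>\<psi>' / \<psi>\<close> and the gradient of \<open>\<mu>\<close>.
\<close>

lemma angle_flux_le:
  fixes p :: "complex poly" and \<mu> :: "complex \<Rightarrow> real"
  assumes p: "degree p > 0" and U: "open U"
    and nz: "\<And>z. z \<in> U \<Longrightarrow> poly p z \<noteq> 0" "\<And>z. z \<in> U \<Longrightarrow> poly (pderiv p) z \<noteq> 0"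
      "\<And>z. z \<in> U \<Longrightarrow> poly (pderiv (pderiv p)) z \<noteq> 0"
    and lam: "C1on UNIV \<mu> L" "\<And>z. \<mu> z > 0"
    and len: "arclength (frontier U) \<le> ennreal l" and l: "l \<ge> 0"
  defines "\<theta> \<equiv> (\<lambda>z. \<bar>Re (log_deriv p z * sgn (poly p z / poly (pderiv p) z))\<bar>)"
  defines "c \<equiv> (\<lambda>z. ring_cutoff (cmod (poly p z)) * smoothstep (2 * (cmod (log_deriv p z) / \<mu> z) + -1))"
  shows "(\<integral>\<^sup>+z\<in>U. ennreal (c z * \<theta> z) \<partial>lborel)
    \<le> (\<integral>\<^sup>+z\<in>U. ennreal (2 / pi * c z * cmod (log_deriv p z)
         + indicator (sublevel 2 p) z * (18 * cmod (poly (pderiv p) z)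
           + indicator {z. \<mu> z / 2 \<le> cmod (log_deriv p z)} z
               * (6 * (cmod (deriv (log_deriv p) z) / cmod (log_deriv p z)))
           + 4 * (norm (gradient L z) / \<mu> z))) \<partial>lborel) + ennreal (96 * l)"
proof -
  obtain \<Gamma> :: "complex \<Rightarrow> real" where \<Gamma>:
    "\<And>w. w \<noteq> 0 \<Longrightarrow> (\<Gamma> has_derivative (\<lambda>h. (\<bar>Re w\<bar> / norm w - 2 / pi) * Im (h / w))) (at w)"
    "\<And>w. \<bar>\<Gamma> w\<bar> \<le> 1"
    using angle_function by metis
  define P where "P = poly p"
  define B where "B = poly (pderiv p)"
  define \<psi> where "\<psi> = log_deriv p"
  define mP where "mP z = B z / P z" for z
  define m\<psi> where "m\<psi> z = poly (pderiv (pderiv (pderiv p))) z / poly (pderiv (pderiv p)) z - \<psi> z" for z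
  define q where "q z = P z / B z" for z
  define w where "w z = q z * \<psi> z" for z
  define mw where "mw z = mP z - \<psi> z + m\<psi> z" for z
  define g where "g z = - \<i> / \<psi> z" for z
  define F where "F z = sgn (g z)" for z
  define r where "r z = cmod (\<psi> z) / \<mu> z" for z
  define \<xi> where "\<xi> z = ring_cutoff (cmod (P z))" for z
  define \<eta> where "\<eta> z = smoothstep (2 * r z + -1)" for z
  have ldP: "log_deriv_on U P mP"
    using log_deriv_on_poly[of U p] nz unfolding P_def B_def mP_def by blast
  have ldB: "log_deriv_on U B \<psi>"
    using log_deriv_on_poly[of U "pderiv p"] nz unfolding B_def \<psi>_def log_deriv_def[abs_def] by blast
  have ld\<psi>: "log_deriv_on U \<psi> m\<psi>"
    using log_deriv_on_divide[OF log_deriv_on_poly[of U "pderiv (pderiv p)"] ldB] nz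
    unfolding B_def \<psi>_def log_deriv_def[abs_def] m\<psi>_def[abs_def] by blast
  have ldq: "log_deriv_on U q (\<lambda>z. mP z - \<psi> z)"
    unfolding q_def[abs_def] by (rule log_deriv_on_divide[OF ldP ldB])
  have ldw: "log_deriv_on U w mw"
    unfolding w_def[abs_def] mw_def[abs_def] by (rule log_deriv_on_mult[OF ldq ld\<psi>])
  have ldg: "log_deriv_on U g (\<lambda>z. 0 - m\<psi> z)"
    unfolding g_def[abs_def] by (rule log_deriv_on_divide[OF log_deriv_on_const ld\<psi>]) simp
  note nzU = log_deriv_onD(1)[OF ldP] log_deriv_onD(1)[OF ldB] log_deriv_onD(1)[OF ld\<psi>]
    log_deriv_onD(1)[OF ldq] log_deriv_onD(1)[OF ldw] log_deriv_onD(1)[OF ldg]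
  have cont: "continuous_on U P" "continuous_on U B" "continuous_on U \<psi>" "continuous_on U q"
      "continuous_on U m\<psi>"
    using log_deriv_onD(3,4)[OF ldP] log_deriv_onD(3,4)[OF ldB] log_deriv_onD(3,4)[OF ld\<psi>]
      log_deriv_onD(4)[OF ldq] by auto
  have lamU: "C1on U \<mu> L" using lam(1) by (rule C1on_subset) simp
  have clam: "continuous_on U \<mu>" "continuous_on U (gradient L)"
    using C1on_continuous[OF lamU] continuous_on_gradient[OF lamU] by auto
  define r' where "r' z h = (cmod (\<psi> z) * Re (m\<psi> z * h) * \<mu> z - cmod (\<psi> z) * L z h) / (\<mu> z * \<mu> z)" for z h
  have C\<xi>: "C1on U \<xi> (\<lambda>z h. ring_cutoff' (cmod (P z)) * (cmod (P z) * Re (mP z * h)))"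
    unfolding \<xi>_def[abs_def]
    by (rule C1on_compose_real[OF C1on_cmod[OF ldP] ring_cutoff_deriv ring_cutoff'_continuous])
  have Cr: "C1on U r r'"
    unfolding r_def[abs_def] r'_def[abs_def]
    by (rule C1on_divide[OF C1on_cmod[OF ld\<psi>] lamU]) (use lam(2) in \<open>metis less_irrefl\<close>)
  have C\<eta>: "C1on U \<eta> (\<lambda>z h. 2 * smoothstep' (2 * r z + -1) * r' z h)"
    unfolding \<eta>_def[abs_def]
    by (rule C1on_compose_real[OF Cr smoothstep_affine_deriv]) (intro continuous_intros)
  note Cc = C1on_mult[OF C\<xi> C\<eta>]
  note C\<Gamma> = C1on_angle[OF \<Gamma>(1) ldw]
  note Cb = C1on_mult[OF Cc C\<Gamma>]
  note V = C1on_scaleR[OF Cb C1on_sgn[OF ldg]]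
  obtain R where R: "\<And>z. norm z \<ge> R \<Longrightarrow> cmod (poly p z) \<ge> 2"
    using sublevel_bounded_radius[OF p] by blast
  have \<xi>01: "0 \<le> \<xi> z" "\<xi> z \<le> 1" and \<eta>01: "0 \<le> \<eta> z" "\<eta> z \<le> 1" for z
    by (auto simp: \<xi>_def \<eta>_def ring_cutoff_bounds smoothstep_bounds)
  have r0: "r z \<ge> 0" for z using lam(2)[of z] by (simp add: r_def less_imp_le)
  define big where "big z = (indicator {z. \<mu> z / 2 \<le> cmod (\<psi> z)} z :: real)" for z
  have big: "big z = (if 1/2 \<le> r z then 1 else 0)" for z
    using lam(2)[of z] by (simp add: big_def r_def field_simps)
  have \<eta>big: "\<eta> z \<le> big z" for z
    using \<eta>01[of z] by (auto simp: big \<eta>_def smoothstep_eq_0)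
  have E2: "\<xi> z \<le> indicator (sublevel 2 p) z" for z
    using \<xi>01[of z] ring_cutoff_support[of "cmod (P z)"]
    by (auto simp: indicator_def sublevel_def \<xi>_def P_def)
  have "(\<integral>\<^sup>+z\<in>U. ennreal (\<xi> z * \<eta> z * \<bar>Re (\<psi> z * sgn (q z))\<bar>) \<partial>lborel)
    \<le> (\<integral>\<^sup>+z\<in>U. ennreal (2 / pi * (\<xi> z * \<eta> z) * cmod (\<psi> z)
         + indicator (sublevel 2 p) z * (18 * cmod (B z) + big z * (6 * cmod (m\<psi> z))
           + 4 * (norm (gradient L z) / \<mu> z))) \<partial>lborel) + ennreal (96 * 1 * l)"
  proof (rule stokes_le[OF U V _ _ _ _ _ _ _ _ len l, of 1 R])
    fix z assume z: "z \<in> U"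
    have "\<bar>\<xi> z * \<eta> z * \<Gamma> (w z)\<bar> \<le> 1 * 1 * 1"
      unfolding abs_mult using \<xi>01[of z] \<eta>01[of z] \<Gamma>(2)[of "w z"] by (intro mult_mono) auto
    then show "norm ((\<xi> z * \<eta> z * \<Gamma> (w z)) *\<^sub>R sgn (g z)) \<le> 1"
      by (simp add: norm_sgn)
  next
    fix z :: complex assume "norm z \<ge> R"
    then have "\<xi> z = 0"
      unfolding \<xi>_def using R[of z] by (intro ring_cutoff_support) (simp add: P_def)
    then show "(\<xi> z * \<eta> z * \<Gamma> (w z)) *\<^sub>R sgn (g z) = 0" by simp
  next
    have ccont: "continuous_on U \<xi>" "continuous_on U \<eta>"
      using C1on_continuous[OF C\<xi>] C1on_continuous[OF C\<eta>] by auto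
    have "(\<lambda>z. indicator U z * (\<xi> z * \<eta> z * \<bar>Re (\<psi> z * (q z / of_real (cmod (q z))))\<bar>)) \<in> borel_measurable borel"
      by (intro measurable_continuous_on_open U continuous_intros cont ccont) (use nzU in auto)
    then show "(\<lambda>z. indicator U z * (\<xi> z * \<eta> z * \<bar>Re (\<psi> z * sgn (q z))\<bar>)) \<in> borel_measurable borel"
      by (simp add: sgn_eq)
    define IE where "IE z = (indicator (sublevel 2 p) z :: real)" for z
    have [measurable]: "IE \<in> borel_measurable borel"
      unfolding IE_def[abs_def] by (intro borel_measurable_indicator sublevel_borel)
    have [measurable]: "big \<in> borel_measurable borel"
    proof -
      have "\<mu> \<in> borel_measurable borel"
        by (intro borel_measurable_continuous_onI C1on_continuous[OF lam(1)])
      then have "{z. \<mu> z / 2 \<le> cmod (\<psi> z)} \<in> sets borel"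
        unfolding \<psi>_def by measurable
      then show ?thesis unfolding big_def[abs_def] by (intro borel_measurable_indicator)
    qed
    have m1: "(\<lambda>z. indicator U z * (2 / pi * (\<xi> z * \<eta> z) * cmod (\<psi> z))) \<in> borel_measurable borel"
      by (intro measurable_continuous_on_open U continuous_intros cont ccont) auto
    have m2: "(\<lambda>z. indicator U z * (18 * cmod (B z))) \<in> borel_measurable borel"
      by (intro measurable_continuous_on_open U continuous_intros cont)
    have m3: "(\<lambda>z. indicator U z * (6 * cmod (m\<psi> z))) \<in> borel_measurable borel"
      by (intro measurable_continuous_on_open U continuous_intros cont)
    have m4: "(\<lambda>z. indicator U z * (4 * (norm (gradient L z) / \<mu> z))) \<in> borel_measurable borel"
      by (intro measurable_continuous_on_open U continuous_intros clam) (use lam(2) in \<open>metis less_irrefl\<close>)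
    have "(\<lambda>z. indicator U z * (2 / pi * (\<xi> z * \<eta> z) * cmod (\<psi> z))
        + IE z * (indicator U z * (18 * cmod (B z)) + big z * (indicator U z * (6 * cmod (m\<psi> z)))
          + indicator U z * (4 * (norm (gradient L z) / \<mu> z)))) \<in> borel_measurable borel"
      using m1 m2 m3 m4 by measurable
    also have "(\<lambda>z. indicator U z * (2 / pi * (\<xi> z * \<eta> z) * cmod (\<psi> z))
        + IE z * (indicator U z * (18 * cmod (B z)) + big z * (indicator U z * (6 * cmod (m\<psi> z)))
          + indicator U z * (4 * (norm (gradient L z) / \<mu> z))))
       = (\<lambda>z. indicator U z * (2 / pi * (\<xi> z * \<eta> z) * cmod (\<psi> z)
         + indicator (sublevel 2 p) z * (18 * cmod (B z) + big z * (6 * cmod (m\<psi> z))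
           + 4 * (norm (gradient L z) / \<mu> z))))"
      by (intro ext) (simp add: IE_def algebra_simps)
    finally show "(\<lambda>z. indicator U z * (2 / pi * (\<xi> z * \<eta> z) * cmod (\<psi> z)
         + indicator (sublevel 2 p) z * (18 * cmod (B z) + big z * (6 * cmod (m\<psi> z))
           + 4 * (norm (gradient L z) / \<mu> z)))) \<in> borel_measurable borel" .
  next
    fix z assume z: "z \<in> U"
    define t where "t = cmod (P z)"
    define s where "s = \<bar>Re (w z)\<bar> / norm (w z) - 2 / pi"
    define \<eta>' where "\<eta>' = 2 * smoothstep' (2 * r z + -1)"
    define IE where "IE = (indicator (sublevel 2 p) z :: real)"
    have t0: "t > 0" using nzU(1)[OF z] by (simp add: t_def)
    have \<psi>0: "\<psi> z \<noteq> 0" "q z \<noteq> 0" using nzU z by auto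
    have nF: "norm (sgn (g z)) = 1" using nzU(6)[OF z] by (simp add: norm_sgn)
    have \<psi>F: "\<psi> z * sgn (g z) = - \<i> * of_real (cmod (\<psi> z))"
      using \<psi>0 by (simp add: g_def sgn_eq norm_divide)
    have div: "divergence (\<lambda>z h. (\<xi> z * \<eta> z * \<Gamma> (w z)) *\<^sub>R (sgn (g z) * (\<i> * of_real (Im ((0 - m\<psi> z) * h))))
        + (\<xi> z * \<eta> z * ((\<bar>Re (w z)\<bar> / norm (w z) - 2 / pi) * Im (mw z * h))
          + (\<xi> z * (2 * smoothstep' (2 * r z + -1) * r' z h)
            + ring_cutoff' (cmod (P z)) * (cmod (P z) * Re (mP z * h)) * \<eta> z) * \<Gamma> (w z)) *\<^sub>R sgn (g z)) z
      = \<xi> z * \<eta> z * \<Gamma> (w z) * Re (sgn (g z) * (0 - m\<psi> z))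
        + (\<xi> z * \<eta> z * (s * Im (mw z * sgn (g z)))
          + (\<xi> z * (\<eta>' * r' z (sgn (g z)))
            + ring_cutoff' t * (t * Re (mP z * sgn (g z))) * \<eta> z) * \<Gamma> (w z))"
      using divergence_scaleR[OF Cb z, where F = "\<lambda>z. sgn (g z)"
          and B = "\<lambda>z h. sgn (g z) * (\<i> * of_real (Im ((0 - m\<psi> z) * h)))"]
      unfolding divergence_sgn[of g "\<lambda>z. 0 - m\<psi> z"] t_def s_def \<eta>'_def .
    have Re1: "\<bar>Re (x * sgn (g z))\<bar> \<le> cmod x" "\<bar>Im (x * sgn (g z))\<bar> \<le> cmod x" for x
      using abs_Re_le_cmod[of "x * sgn (g z)"] abs_Im_le_cmod[of "x * sgn (g z)"] nF
      by (simp_all add: norm_mult)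
    have s1: "\<bar>s\<bar> \<le> 1"
    proof -
      have "\<bar>Re (w z)\<bar> / norm (w z) \<le> 1" "0 \<le> \<bar>Re (w z)\<bar> / norm (w z)"
        using abs_Re_le_cmod[of "w z"] nzU(5)[OF z] by auto
      moreover have "0 \<le> 2 / pi" "2 / pi \<le> 1" using pi_ge_two by auto
      ultimately show ?thesis unfolding s_def by linarith
    qed
    have IE: "0 \<le> IE" "\<xi> z \<le> IE" using E2 by (auto simp: IE_def)
    have \<xi>big: "\<xi> z * \<eta> z \<le> IE * big z"
      using \<xi>01 \<eta>01 IE \<eta>big[of z] by (intro mult_mono) auto
    \<comment> \<open>The term from the divergence of \<open>F\<close>, which is \<open>- Re (F \<psi>' / \<psi>)\<close>.\<close>
    have t1: "\<bar>\<xi> z * \<eta> z * \<Gamma> (w z) * Re (sgn (g z) * (0 - m\<psi> z))\<bar> \<le> IE * big z * cmod (m\<psi> z)"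
    proof -
      have "\<bar>\<xi> z * \<eta> z * \<Gamma> (w z) * Re (sgn (g z) * (0 - m\<psi> z))\<bar>
          \<le> (\<xi> z * \<eta> z) * 1 * cmod (m\<psi> z)"
        unfolding abs_mult using Re1(1)[of "0 - m\<psi> z"] \<xi>01[of z] \<eta>01[of z] \<Gamma>(2)[of "w z"]
        by (intro mult_mono) (auto simp: mult.commute)
      also have "\<dots> \<le> IE * big z * cmod (m\<psi> z)"
        using \<xi>big by (simp add: mult_right_mono)
      finally show ?thesis .
    qed
    have small: "\<xi> z * cmod (mP z) \<le> IE * (2 * cmod (B z))"
    proof (cases "t \<le> 1/2")
      case True
      then show ?thesis using IE ring_cutoff_support[of t] by (simp add: \<xi>_def t_def)
    next
      case False
      have "cmod (mP z) = cmod (B z) / t" by (simp add: mP_def norm_divide t_def)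
      also have "\<dots> \<le> cmod (B z) / (1/2)" using False by (intro divide_left_mono) auto
      finally show ?thesis using IE \<xi>01[of z] by (intro mult_mono) auto
    qed
    \<comment> \<open>The main term: \<open>\<psi>F\<close> makes the angle turn at rate exactly \<open>|\<psi>|\<close>.\<close>
    have t2: "\<xi> z * \<eta> z * (s * Im (mw z * sgn (g z))) \<ge> \<xi> z * \<eta> z * s * cmod (\<psi> z)
        - IE * (2 * cmod (B z)) - IE * big z * cmod (m\<psi> z)"
    proof -
      have "Im (mw z * sgn (g z)) = cmod (\<psi> z) + Im ((mP z + m\<psi> z) * sgn (g z))"
        unfolding mw_def using arg_cong[OF \<psi>F, of Im] by (simp add: algebra_simps)
      then have "\<xi> z * \<eta> z * (s * Im (mw z * sgn (g z))) = \<xi> z * \<eta> z * s * cmod (\<psi> z)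
          + \<xi> z * \<eta> z * s * Im ((mP z + m\<psi> z) * sgn (g z))"
        by (simp add: algebra_simps)
      moreover have "\<bar>\<xi> z * \<eta> z * s * Im ((mP z + m\<psi> z) * sgn (g z))\<bar> \<le> (\<xi> z * \<eta> z) * 1 * (cmod (mP z) + cmod (m\<psi> z))"
        unfolding abs_mult using Re1(2)[of "mP z + m\<psi> z"] norm_triangle_ineq[of "mP z" "m\<psi> z"]
          \<xi>01[of z] \<eta>01[of z] s1
        by (intro mult_mono) auto
      moreover have "(\<xi> z * \<eta> z) * 1 * (cmod (mP z) + cmod (m\<psi> z))
          = (\<xi> z * \<eta> z) * cmod (mP z) + (\<xi> z * \<eta> z) * cmod (m\<psi> z)"
        by (simp only: distrib_left mult_1_right)
      moreover have "(\<xi> z * \<eta> z) * cmod (mP z) \<le> \<xi> z * cmod (mP z)"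
        using \<xi>01[of z] \<eta>01[of z] by (intro mult_right_mono) (auto intro: mult_left_le)
      moreover have "(\<xi> z * \<eta> z) * cmod (m\<psi> z) \<le> IE * big z * cmod (m\<psi> z)"
        using \<xi>big by (intro mult_right_mono) auto
      ultimately show ?thesis using small by linarith
    qed
    \<comment> \<open>The derivative of \<open>\<eta>\<close> lives where \<open>r\<close> is between \<open>1/2\<close> and \<open>1\<close>, so a factor \<open>r\<close> costs nothing there.\<close>
    have t3: "\<bar>\<xi> z * (\<eta>' * r' z (sgn (g z))) * \<Gamma> (w z)\<bar>
        \<le> IE * big z * (4 * cmod (m\<psi> z)) + IE * (4 * (norm (gradient L z) / \<mu> z))"
    proof -
      have lz: "\<mu> z > 0" by (rule lam(2))
      have "r' z (sgn (g z)) = r z * (Re (m\<psi> z * sgn (g z)) - L z (sgn (g z)) / \<mu> z)"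
        using lz by (simp add: r'_def r_def field_simps)
      moreover have "\<bar>L z (sgn (g z))\<bar> \<le> norm (gradient L z)"
        using Cauchy_Schwarz_ineq2[of "gradient L z" "sgn (g z)"] nF C1on_gradient[OF lamU z] by simp
      then have "\<bar>L z (sgn (g z)) / \<mu> z\<bar> \<le> norm (gradient L z) / \<mu> z"
        using lz by (simp add: divide_right_mono)
      then have "\<bar>Re (m\<psi> z * sgn (g z)) - L z (sgn (g z)) / \<mu> z\<bar> \<le> cmod (m\<psi> z) + norm (gradient L z) / \<mu> z"
        using Re1(1)[of "m\<psi> z"] by linarith
      ultimately have rb: "\<bar>r' z (sgn (g z))\<bar> \<le> r z * (cmod (m\<psi> z) + norm (gradient L z) / \<mu> z)"
        using r0[of z] by (simp add: abs_mult mult_left_mono)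
      have \<eta>r: "\<bar>\<eta>'\<bar> * r z \<le> 4 * big z"
      proof (cases "1/2 \<le> r z \<and> r z \<le> 1")
        case True
        then have "\<bar>\<eta>'\<bar> * r z \<le> 4 * 1"
          using smoothstep'_bounds[of "2 * r z + -1"] by (intro mult_mono) (auto simp: \<eta>'_def)
        then show ?thesis using True by (simp add: big)
      next
        case False
        then have "\<eta>' = 0" unfolding \<eta>'_def using smoothstep'_eq_0[of "2 * r z + -1"] by auto
        then show ?thesis by (simp add: big)
      qed
      have "\<bar>\<eta>' * r' z (sgn (g z))\<bar> \<le> \<bar>\<eta>'\<bar> * (r z * (cmod (m\<psi> z) + norm (gradient L z) / \<mu> z))"
        unfolding abs_mult by (intro mult_left_mono rb) simp
      also have "\<dots> \<le> 4 * big z * (cmod (m\<psi> z) + norm (gradient L z) / \<mu> z)"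
        unfolding mult.assoc[symmetric] using lz by (intro mult_right_mono \<eta>r) auto
      finally have e: "\<bar>\<eta>' * r' z (sgn (g z))\<bar> \<le> 4 * big z * (cmod (m\<psi> z) + norm (gradient L z) / \<mu> z)" .
      have "\<bar>\<xi> z * (\<eta>' * r' z (sgn (g z))) * \<Gamma> (w z)\<bar>
          \<le> IE * (4 * big z * (cmod (m\<psi> z) + norm (gradient L z) / \<mu> z)) * 1"
        unfolding abs_mult[of "\<xi> z * _"] abs_mult[of "\<xi> z"]
        using e IE \<xi>01[of z] \<Gamma>(2)[of "w z"] by (intro mult_mono) auto
      also have "\<dots> = IE * big z * (4 * cmod (m\<psi> z)) + IE * big z * (4 * (norm (gradient L z) / \<mu> z))"
        by (simp add: algebra_simps)
      also have "IE * big z * (4 * (norm (gradient L z) / \<mu> z)) \<le> IE * 1 * (4 * (norm (gradient L z) / \<mu> z))"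
        using IE lz by (intro mult_right_mono mult_left_mono) (auto simp: big)
      finally show ?thesis by simp
    qed
    \<comment> \<open>The derivative of \<open>\<xi>\<close> contributes only a multiple of \<open>|p'|\<close>.\<close>
    have t4: "\<bar>ring_cutoff' t * (t * Re (mP z * sgn (g z))) * \<eta> z * \<Gamma> (w z)\<bar> \<le> IE * (16 * cmod (B z))"
    proof (cases "t \<le> 1/2 \<or> t \<ge> 3/2")
      case True
      then show ?thesis using ring_cutoff_support(2)[OF True] IE by simp
    next
      case False
      then have "IE = 1" by (simp add: IE_def sublevel_def t_def P_def)
      have "\<bar>t * Re (mP z * sgn (g z))\<bar> \<le> t * cmod (mP z)"
        using Re1(1)[of "mP z"] t0 by (simp add: abs_mult)
      also have "\<dots> = cmod (B z)" using t0 by (simp add: mP_def norm_divide t_def)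
      finally have "\<bar>t * Re (mP z * sgn (g z))\<bar> \<le> cmod (B z)" .
      then have "\<bar>ring_cutoff' t * (t * Re (mP z * sgn (g z))) * \<eta> z * \<Gamma> (w z)\<bar> \<le> 16 * cmod (B z) * 1 * 1"
        unfolding abs_mult[of "_ * \<eta> z"] abs_mult[of _ "\<eta> z"] abs_mult[of "ring_cutoff' t"]
        using ring_cutoff'_bound[of t] \<eta>01[of z] \<Gamma>(2)[of "w z"] by (intro mult_mono) auto
      then show ?thesis using \<open>IE = 1\<close> by simp
    qed
    have main: "\<xi> z * \<eta> z * \<bar>Re (\<psi> z * sgn (q z))\<bar> = \<xi> z * \<eta> z * s * cmod (\<psi> z) + 2 / pi * (\<xi> z * \<eta> z) * cmod (\<psi> z)"
    proof -
      have "\<psi> z * sgn (q z) = w z / of_real (cmod (q z))" by (simp add: w_def sgn_eq)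
      then have "\<bar>Re (\<psi> z * sgn (q z))\<bar> = \<bar>Re (w z)\<bar> / cmod (q z)" by simp
      also have "\<dots> = \<bar>Re (w z)\<bar> / norm (w z) * cmod (\<psi> z)"
        using \<psi>0 by (simp add: w_def norm_mult)
      also have "\<dots> = (s + 2 / pi) * cmod (\<psi> z)" by (simp add: s_def)
      finally show ?thesis by (simp add: algebra_simps)
    qed
    show "\<xi> z * \<eta> z * \<bar>Re (\<psi> z * sgn (q z))\<bar>
      \<le> divergence (\<lambda>z h. (\<xi> z * \<eta> z * \<Gamma> (w z)) *\<^sub>R (sgn (g z) * (\<i> * of_real (Im ((0 - m\<psi> z) * h))))
        + (\<xi> z * \<eta> z * ((\<bar>Re (w z)\<bar> / norm (w z) - 2 / pi) * Im (mw z * h))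
          + (\<xi> z * (2 * smoothstep' (2 * r z + -1) * r' z h)
            + ring_cutoff' (cmod (P z)) * (cmod (P z) * Re (mP z * h)) * \<eta> z) * \<Gamma> (w z)) *\<^sub>R sgn (g z)) z
      + (2 / pi * (\<xi> z * \<eta> z) * cmod (\<psi> z)
         + indicator (sublevel 2 p) z * (18 * cmod (B z) + big z * (6 * cmod (m\<psi> z))
           + 4 * (norm (gradient L z) / \<mu> z)))"
    proof -
      have "(\<xi> z * (\<eta>' * r' z (sgn (g z))) + ring_cutoff' t * (t * Re (mP z * sgn (g z))) * \<eta> z) * \<Gamma> (w z)
        = \<xi> z * (\<eta>' * r' z (sgn (g z))) * \<Gamma> (w z) + ring_cutoff' t * (t * Re (mP z * sgn (g z))) * \<eta> z * \<Gamma> (w z)"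
        by (simp add: distrib_right)
      moreover have "IE * (18 * cmod (B z) + big z * (6 * cmod (m\<psi> z)) + 4 * (norm (gradient L z) / \<mu> z))
        = IE * (2 * cmod (B z)) + IE * (16 * cmod (B z)) + IE * big z * cmod (m\<psi> z) + IE * big z * cmod (m\<psi> z)
          + IE * big z * (4 * cmod (m\<psi> z)) + IE * (4 * (norm (gradient L z) / \<mu> z))"
        by (simp add: algebra_simps)
      ultimately show ?thesis
        unfolding div main IE_def[symmetric] using t1 t2 t3 t4 by linarith
    qed
  qed (use \<xi>01 \<eta>01 lam(2) in \<open>auto simp: big less_imp_le intro!: add_nonneg_nonneg\<close>)
  also have "(\<integral>\<^sup>+z\<in>U. ennreal (2 / pi * (\<xi> z * \<eta> z) * cmod (\<psi> z)
         + indicator (sublevel 2 p) z * (18 * cmod (B z) + big z * (6 * cmod (m\<psi> z))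
           + 4 * (norm (gradient L z) / \<mu> z))) \<partial>lborel)
    = (\<integral>\<^sup>+z\<in>U. ennreal (2 / pi * (\<xi> z * \<eta> z) * cmod (\<psi> z)
         + indicator (sublevel 2 p) z * (18 * cmod (B z) + big z * (6 * (cmod (deriv \<psi> z) / cmod (\<psi> z)))
           + 4 * (norm (gradient L z) / \<mu> z))) \<partial>lborel)"
  proof (intro nn_integral_cong)
    fix z
    have "cmod (m\<psi> z) = cmod (deriv \<psi> z) / cmod (\<psi> z)" if z: "z \<in> U"
    proof -
      have "deriv \<psi> z = \<psi> z * m\<psi> z"
        using ld\<psi> z by (intro DERIV_imp_deriv) (auto simp: log_deriv_on_def)
      then show ?thesis using nzU(3)[OF z] by (simp add: norm_mult)
    qed
    then show "ennreal (2 / pi * (\<xi> z * \<eta> z) * cmod (\<psi> z)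
         + indicator (sublevel 2 p) z * (18 * cmod (B z) + big z * (6 * cmod (m\<psi> z))
           + 4 * (norm (gradient L z) / \<mu> z))) * indicator U z
      = ennreal (2 / pi * (\<xi> z * \<eta> z) * cmod (\<psi> z)
         + indicator (sublevel 2 p) z * (18 * cmod (B z) + big z * (6 * (cmod (deriv \<psi> z) / cmod (\<psi> z)))
           + 4 * (norm (gradient L z) / \<mu> z))) * indicator U z"
      by (simp add: indicator_def)
  qed
  finally show ?thesis
    unfolding c_def \<theta>_def big_def \<xi>_def \<eta>_def r_def P_def B_def \<psi>_def q_def by simp
qed

section \<open>The length bound\<close>

text \<open>
  On a real line \<open>|p|\<^sup>2\<close> is a polynomial in the real parameter, namely the product of \<open>p\<close> with its
  conjugate polynomial; it is not constant because the degrees of the two factors add.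
\<close>

lemma finite_level_on_line:
  fixes p :: "complex poly"
  assumes p: "degree p > 0" and b: "b \<noteq> 0"
  shows "finite {y::real. cmod (poly p (a + of_real y * b)) = 1}"
proof -
  define r where "r = pcompose p [:a, b:]"
  define Q where "Q = r * map_poly cnj r - 1"
  have dr: "degree r = degree p"
    using b by (simp add: r_def degree_pcompose)
  have dc: "degree (map_poly cnj r) = degree r"
    by (rule degree_map_poly) simp
  have "Q \<noteq> 0"
  proof
    assume "Q = 0"
    then have "r * map_poly cnj r = 1" by (simp add: Q_def)
    moreover have "r \<noteq> 0" "map_poly cnj r \<noteq> 0" using dr dc p by auto
    then have "degree (r * map_poly cnj r) = degree r + degree r"
      by (simp add: degree_mult_eq dc)
    ultimately show False using dr p by simp
  qed
  then have "finite {x. poly Q x = 0}" by (rule poly_roots_finite)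
  then have "finite ((of_real :: real \<Rightarrow> complex) -` {x. poly Q x = 0})"
    by (rule finite_vimageI) (simp add: inj_def)
  moreover have "{y::real. cmod (poly p (a + of_real y * b)) = 1} \<subseteq> of_real -` {x. poly Q x = 0}"
  proof
    fix y :: real assume y: "y \<in> {y. cmod (poly p (a + of_real y * b)) = 1}"
    have "poly Q (of_real y) = poly r (of_real y) * cnj (poly r (of_real y)) - 1"
      by (simp add: Q_def)
    also have "\<dots> = of_real ((cmod (poly r (of_real y)))\<^sup>2) - 1"
      by (simp only: complex_norm_square)
    also have "poly r (of_real y) = poly p (a + of_real y * b)"
      by (simp add: r_def poly_pcompose mult.commute)
    finally show "y \<in> of_real -` {x. poly Q x = 0}" using y by simp
  qed
  ultimately show ?thesis by (rule finite_subset[rotated])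
qed

lemma countable_level_on_axis_lines:
  fixes p :: "complex poly"
  assumes p: "degree p > 0"
  shows "countable {z. cmod (poly p z) = 1 \<and> Re z = t}" "countable {z. cmod (poly p z) = 1 \<and> Im z = t}"
proof -
  have "{z. cmod (poly p z) = 1 \<and> Re z = t}
      \<subseteq> (\<lambda>y. of_real t + of_real y * \<i>) ` {y::real. cmod (poly p (of_real t + of_real y * \<i>)) = 1}"
  proof
    fix z assume z: "z \<in> {z. cmod (poly p z) = 1 \<and> Re z = t}"
    then have "z = of_real t + of_real (Im z) * \<i>" by (simp add: complex_eq_iff)
    then show "z \<in> (\<lambda>y. of_real t + of_real y * \<i>) ` {y::real. cmod (poly p (of_real t + of_real y * \<i>)) = 1}"
      using z by (metis (mono_tags, lifting) image_eqI mem_Collect_eq)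
  qed
  then show "countable {z. cmod (poly p z) = 1 \<and> Re z = t}"
    by (rule countable_subset)
      (intro countable_finite finite_imageI finite_level_on_line p, simp)
  have "{z. cmod (poly p z) = 1 \<and> Im z = t}
      \<subseteq> (\<lambda>y. of_real t * \<i> + of_real y * 1) ` {y::real. cmod (poly p (of_real t * \<i> + of_real y * 1)) = 1}"
  proof
    fix z assume z: "z \<in> {z. cmod (poly p z) = 1 \<and> Im z = t}"
    then have "z = of_real t * \<i> + of_real (Re z) * 1" by (simp add: complex_eq_iff)
    then show "z \<in> (\<lambda>y. of_real t * \<i> + of_real y * 1) ` {y::real. cmod (poly p (of_real t * \<i> + of_real y * 1)) = 1}"
      using z by (metis (mono_tags, lifting) image_eqI mem_Collect_eq)
  qed
  then show "countable {z. cmod (poly p z) = 1 \<and> Im z = t}"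
    by (rule countable_subset)
      (intro countable_finite finite_imageI finite_level_on_line p, simp)
qed

lemma smooth_C1on:
  assumes "smooth l"
  shows "C1on UNIV l (\<lambda>z. frechet_derivative l (at z))"
proof (rule C1onI)
  have 1: "times_cont_diff (Suc 0) l" using assms unfolding smooth_def by blast
  show "(l has_derivative frechet_derivative l (at z)) (at z)" for z
    using 1 by (simp add: frechet_derivative_works)
  show "continuous_on UNIV (\<lambda>z. frechet_derivative l (at z) v)" for v
    using 1 by simp
qed

lemma grad_eq_gradient:
  assumes "C1on UNIV l L"
  shows "grad l z = gradient L z"
proof (rule grad_eqI)
  have "L z = (\<lambda>h. h \<bullet> gradient L z)"
    using C1on_gradient[OF assms] by (auto simp: inner_commute)
  then show "GDERIV l z :> gradient L z"
    using C1onD[OF assms, of z] by (simp add: gderiv_def)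
qed

text \<open>
  The curvature term of \<open>level_flux_le\<close> in terms of the quantities of the theorem. Where \<open>|\<psi>| \<le> l\<close> it
  is bounded trivially by \<open>|\<psi>|\<close>, and \<open>angle_flux_le\<close> treats the rest. If \<open>p'\<close> is constant then
  \<open>\<psi>\<close> is zero and the term vanishes.
\<close>

lemma cutoff_turning_le:
  fixes p :: "complex poly" and l :: "complex \<Rightarrow> real"
  assumes p: "degree p > 0" and U: "open U" "U \<subseteq> \<Omega>" and \<Omega>: "open \<Omega>"
    and nz: "\<And>z. z \<in> U \<Longrightarrow> poly p z \<noteq> 0" "\<And>z. z \<in> U \<Longrightarrow> poly (pderiv p) z \<noteq> 0"
      "\<And>z. pderiv (pderiv p) \<noteq> 0 \<Longrightarrow> z \<in> U \<Longrightarrow> poly (pderiv (pderiv p)) z \<noteq> 0"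
    and lam: "smooth l" "\<And>z. l z > 0"
    and len: "arclength (frontier U) \<le> ennreal a" and a: "a \<ge> 0"
  shows "(\<integral>\<^sup>+z\<in>U. ennreal (ring_cutoff (cmod (poly p z)) *
        \<bar>Re (log_deriv p z * sgn (poly p z / poly (pderiv p) z))\<bar>) \<partial>lborel)
    \<le> 2 * emeasure (Psi p) (sublevel 2 p \<inter> \<Omega>) + 18 * X1 p \<Omega> + X2 p \<Omega> l + 6 * X3 p \<Omega> l + 4 * X4 p \<Omega> l
      + ennreal (96 * a)"
proof (cases "pderiv (pderiv p) = 0")
  case True
  then show ?thesis by (simp add: log_deriv_def)
next
  case False
  define \<psi> where "\<psi> = log_deriv p"
  define \<theta> where "\<theta> z = \<bar>Re (\<psi> z * sgn (poly p z / poly (pderiv p) z))\<bar>" for z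
  define \<xi> where "\<xi> z = ring_cutoff (cmod (poly p z))" for z
  define \<eta> where "\<eta> z = smoothstep (2 * (cmod (\<psi> z) / l z) + -1)" for z
  define E where "E = sublevel 2 p"
  define L where "L z = frechet_derivative l (at z)" for z
  have L: "C1on UNIV l L" using smooth_C1on[OF lam(1)] by (simp add: L_def[abs_def])
  have [measurable]: "E \<in> sets borel" "U \<in> sets borel" "\<Omega> \<in> sets borel"
    using U \<Omega> by (auto simp: E_def sublevel_borel)
  have [measurable]: "\<psi> \<in> borel_measurable borel" unfolding \<psi>_def by (rule log_deriv_measurable)
  have [measurable]: "l \<in> borel_measurable borel"
    by (intro borel_measurable_continuous_onI C1on_continuous[OF L])
  have gl: "grad l = gradient L" using grad_eq_gradient[OF L] by auto
  have [measurable]: "grad l \<in> borel_measurable borel"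
    unfolding gl by (intro borel_measurable_continuous_onI continuous_on_gradient[OF L])
  have [measurable]: "poly q \<in> borel_measurable borel" for q :: "complex poly"
    by (intro borel_measurable_continuous_onI continuous_intros)
  have [measurable]: "smoothstep \<in> borel_measurable borel" "ring_cutoff \<in> borel_measurable borel"
    by (intro borel_measurable_continuous_onI continuous_intros)+
  have ld: "log_deriv_on U \<psi> (\<lambda>z. poly (pderiv (pderiv (pderiv p))) z / poly (pderiv (pderiv p)) z
      - poly (pderiv (pderiv p)) z / poly (pderiv p) z)"
    unfolding \<psi>_def log_deriv_def[abs_def]
    by (rule log_deriv_on_divide[OF log_deriv_on_poly[OF nz(3)[OF False]] log_deriv_on_poly[OF nz(2)]])
  have ld': "deriv \<psi> z = \<psi> z * (poly (pderiv (pderiv (pderiv p))) z / poly (pderiv (pderiv p)) z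
      - poly (pderiv (pderiv p)) z / poly (pderiv p) z)" if "z \<in> U" for z
    using ld that by (intro DERIV_imp_deriv) (auto simp: log_deriv_on_def)
  define F0 where "F0 z = ennreal (cmod (\<psi> z)) * indicator (E \<inter> \<Omega>) z" for z
  define F1 where "F1 z = ennreal (cmod (poly (pderiv p) z)) * indicator (E \<inter> \<Omega>) z" for z
  define F2 where "F2 z = ennreal (cmod (\<psi> z)) * indicator (E \<inter> \<Omega> \<inter> {z. cmod (\<psi> z) \<le> l z}) z" for z
  define F3 where "F3 z = ennreal (cmod (deriv \<psi> z) / cmod (\<psi> z)) * indicator U z
      * indicator (E \<inter> \<Omega> \<inter> {z. cmod (\<psi> z) \<ge> l z / 2}) z" for z
  define F4 where "F4 z = ennreal (cmod (grad l z) / \<bar>l z\<bar>) * indicator (E \<inter> \<Omega>) z" for z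
  have [measurable]: "F0 \<in> borel_measurable borel" "F1 \<in> borel_measurable borel"
      "F2 \<in> borel_measurable borel" "F4 \<in> borel_measurable borel"
    unfolding F0_def[abs_def] F1_def[abs_def] F2_def[abs_def] F4_def[abs_def] by measurable
  have [measurable]: "F3 \<in> borel_measurable borel"
  proof -
    have "(\<lambda>z. ennreal (cmod (\<psi> z * (poly (pderiv (pderiv (pderiv p))) z / poly (pderiv (pderiv p)) z
      - poly (pderiv (pderiv p)) z / poly (pderiv p) z)) / cmod (\<psi> z)) * indicator U z
      * indicator (E \<inter> \<Omega> \<inter> {z. cmod (\<psi> z) \<ge> l z / 2}) z) \<in> borel_measurable borel"
      by measurable
    also have "(\<lambda>z. ennreal (cmod (\<psi> z * (poly (pderiv (pderiv (pderiv p))) z / poly (pderiv (pderiv p)) z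
      - poly (pderiv (pderiv p)) z / poly (pderiv p) z)) / cmod (\<psi> z)) * indicator U z
      * indicator (E \<inter> \<Omega> \<inter> {z. cmod (\<psi> z) \<ge> l z / 2}) z) = F3"
      unfolding F3_def[abs_def] by (intro ext) (auto simp: ld' indicator_def)
    finally show ?thesis .
  qed
  have i0: "ennreal (2 / pi) * (\<integral>\<^sup>+z. F0 z \<partial>lborel) = 2 * emeasure (Psi p) (E \<inter> \<Omega>)"
  proof -
    have "2 * emeasure (Psi p) (E \<inter> \<Omega>) = 2 * (ennreal (1 / pi) * (\<integral>\<^sup>+z. F0 z \<partial>lborel))"
      by (subst emeasure_Psi) (auto simp: F0_def[abs_def] \<psi>_def)
    also have "\<dots> = ennreal (2 / pi) * (\<integral>\<^sup>+z. F0 z \<partial>lborel)"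
    proof -
      have "ennreal (2 / pi) = 2 * ennreal (1 / pi)"
        using ennreal_mult[of 2 "1 / pi"] by simp
      then show ?thesis by (simp only: mult.assoc)
    qed
    finally show ?thesis by simp
  qed
  have i3: "(\<integral>\<^sup>+z. F3 z \<partial>lborel) \<le> X3 p \<Omega> l"
    unfolding X3_def by (intro nn_integral_mono) (auto simp: F3_def \<psi>_def E_def indicator_def)
  have \<xi>01: "0 \<le> \<xi> z" "\<xi> z \<le> 1" and \<eta>01: "0 \<le> \<eta> z" "\<eta> z \<le> 1" for z
    by (auto simp: \<xi>_def \<eta>_def ring_cutoff_bounds smoothstep_bounds)
  have \<xi>E: "\<xi> z \<le> indicator E z" for z
    using \<xi>01[of z] ring_cutoff_support[of "cmod (poly p z)"]
    by (auto simp: indicator_def sublevel_def \<xi>_def E_def)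
  have \<theta>: "0 \<le> \<theta> z" "\<theta> z \<le> cmod (\<psi> z)" for z
  proof -
    have ns: "cmod (sgn x) \<le> 1" for x :: complex by (simp add: norm_sgn)
    have "\<theta> z \<le> cmod (\<psi> z) * cmod (sgn (poly p z / poly (pderiv p) z))"
      unfolding \<theta>_def by (metis abs_Re_le_cmod norm_mult)
    also have "\<dots> \<le> cmod (\<psi> z) * 1" by (intro mult_left_mono ns) simp
    finally show "\<theta> z \<le> cmod (\<psi> z)" by simp
  qed (simp add: \<theta>_def)
  have m: "\<theta> \<in> borel_measurable borel" "\<xi> \<in> borel_measurable borel" "\<eta> \<in> borel_measurable borel"
    unfolding \<theta>_def[abs_def] \<xi>_def[abs_def] \<eta>_def[abs_def] sgn_eq by measurable
  note m [measurable]
  have split: "ennreal (\<xi> z * \<theta> z) * indicator U z \<le> F2 z + ennreal (\<xi> z * \<eta> z * \<theta> z) * indicator U z" for z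
  proof (cases "z \<in> U")
    case True
    have "\<xi> z * \<theta> z = \<xi> z * (1 - \<eta> z) * \<theta> z + \<xi> z * \<eta> z * \<theta> z" by (simp add: algebra_simps)
    then have "ennreal (\<xi> z * \<theta> z) = ennreal (\<xi> z * (1 - \<eta> z) * \<theta> z) + ennreal (\<xi> z * \<eta> z * \<theta> z)"
      using \<xi>01[of z] \<eta>01[of z] \<theta>[of z] by (simp add: ennreal_plus[symmetric] del: ennreal_plus)
    moreover have "ennreal (\<xi> z * (1 - \<eta> z) * \<theta> z) \<le> F2 z"
    proof (cases "cmod (\<psi> z) \<le> l z")
      case small: True
      show ?thesis
      proof (cases "z \<in> E")
        case True
        have "\<xi> z * (1 - \<eta> z) * \<theta> z \<le> 1 * 1 * cmod (\<psi> z)"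
          using \<xi>01[of z] \<eta>01[of z] \<theta>[of z] by (intro mult_mono) auto
        then show ?thesis
          using True small \<open>z \<in> U\<close> U(2) by (auto simp: F2_def intro!: ennreal_leI)
      next
        case False
        then have "\<xi> z = 0" using \<xi>E[of z] \<xi>01[of z] by simp
        then show ?thesis by simp
      qed
    next
      case False
      then have "\<eta> z = 1" unfolding \<eta>_def using lam(2)[of z] by (intro smoothstep_eq_1) (simp add: field_simps)
      then show ?thesis by simp
    qed
    ultimately show ?thesis using True by (simp add: add_right_mono)
  qed simp
  have pw: "ennreal (2 / pi * (\<xi> z * \<eta> z) * cmod (\<psi> z)
         + indicator E z * (18 * cmod (poly (pderiv p) z)
           + indicator {z. l z / 2 \<le> cmod (\<psi> z)} z * (6 * (cmod (deriv \<psi> z) / cmod (\<psi> z)))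
           + 4 * (norm (gradient L z) / l z))) * indicator U z
      \<le> ennreal (2 / pi) * F0 z + 18 * F1 z + 6 * F3 z + 4 * F4 z" for z
  proof (cases "z \<in> U \<and> z \<in> E")
    case True
    then have z\<Omega>: "z \<in> \<Omega>" using U(2) by auto
    define a0 a1 a3 a4 where "a0 = 2 / pi * cmod (\<psi> z)" and "a1 = 18 * cmod (poly (pderiv p) z)"
      and "a3 = indicator {z. l z / 2 \<le> cmod (\<psi> z)} z * (6 * (cmod (deriv \<psi> z) / cmod (\<psi> z)))"
      and "a4 = 4 * (norm (gradient L z) / l z)"
    have nn: "0 \<le> a0" "0 \<le> a1" "0 \<le> a3" "0 \<le> a4"
      using lam(2)[of z] by (auto simp: a0_def a1_def a3_def a4_def)
    have "2 / pi * (\<xi> z * \<eta> z) * cmod (\<psi> z) \<le> a0"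
      unfolding a0_def using \<xi>01[of z] \<eta>01[of z]
      by (intro mult_right_mono mult_left_le) (auto intro: mult_le_one)
    moreover have "ennreal (2 / pi) * F0 z + 18 * F1 z + 6 * F3 z + 4 * F4 z = ennreal (a0 + (a1 + a3 + a4))"
    proof -
      have "18 * F1 z = ennreal a1"
        using True z\<Omega> by (simp add: F1_def a1_def ennreal_mult)
      moreover have "6 * F3 z = ennreal a3"
        using True z\<Omega> ennreal_mult[of 6 "cmod (deriv \<psi> z) / cmod (\<psi> z)"]
        by (simp add: F3_def a3_def indicator_def)
      moreover have "4 * F4 z = ennreal a4"
        using True z\<Omega> lam(2)[of z] ennreal_mult[of 4 "norm (gradient L z) / l z"]
        by (simp add: F4_def a4_def gl)
      moreover have "ennreal (2 / pi) * F0 z = ennreal a0"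
        using True z\<Omega> ennreal_mult[of "2 / pi" "cmod (\<psi> z)"] by (simp add: F0_def a0_def)
      ultimately show ?thesis using nn by (simp add: ennreal_plus add.assoc)
    qed
    ultimately show ?thesis
      using True by (simp add: a1_def a3_def a4_def ennreal_leI del: ennreal_plus)
  next
    case False
    then have "z \<notin> U \<or> z \<in> U \<and> z \<notin> E \<and> \<xi> z = 0"
      using \<xi>E[of z] \<xi>01[of z] by (auto simp: indicator_def split: if_splits)
    then show ?thesis by auto
  qed
  have "(\<integral>\<^sup>+z\<in>U. ennreal (\<xi> z * \<theta> z) \<partial>lborel)
      \<le> (\<integral>\<^sup>+z. F2 z + ennreal (\<xi> z * \<eta> z * \<theta> z) * indicator U z \<partial>lborel)"
    by (intro nn_integral_mono split)
  also have "\<dots> = (\<integral>\<^sup>+z. F2 z \<partial>lborel) + (\<integral>\<^sup>+z\<in>U. ennreal (\<xi> z * \<eta> z * \<theta> z) \<partial>lborel)"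
    by (rule nn_integral_add) auto
  also have "(\<integral>\<^sup>+z\<in>U. ennreal (\<xi> z * \<eta> z * \<theta> z) \<partial>lborel)
      \<le> (\<integral>\<^sup>+z\<in>U. ennreal (2 / pi * (\<xi> z * \<eta> z) * cmod (\<psi> z)
         + indicator E z * (18 * cmod (poly (pderiv p) z)
           + indicator {z. l z / 2 \<le> cmod (\<psi> z)} z * (6 * (cmod (deriv \<psi> z) / cmod (\<psi> z)))
           + 4 * (norm (gradient L z) / l z))) \<partial>lborel) + ennreal (96 * a)"
    unfolding \<xi>_def \<eta>_def \<theta>_def \<psi>_def E_def
    by (rule angle_flux_le[OF p U(1) nz(1,2) nz(3)[OF False] L lam(2) len a])
  also have "(\<integral>\<^sup>+z\<in>U. ennreal (2 / pi * (\<xi> z * \<eta> z) * cmod (\<psi> z)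
         + indicator E z * (18 * cmod (poly (pderiv p) z)
           + indicator {z. l z / 2 \<le> cmod (\<psi> z)} z * (6 * (cmod (deriv \<psi> z) / cmod (\<psi> z)))
           + 4 * (norm (gradient L z) / l z))) \<partial>lborel)
      \<le> (\<integral>\<^sup>+z. ennreal (2 / pi) * F0 z + 18 * F1 z + 6 * F3 z + 4 * F4 z \<partial>lborel)"
    by (intro nn_integral_mono pw)
  also have "\<dots> = ennreal (2 / pi) * (\<integral>\<^sup>+z. F0 z \<partial>lborel) + 18 * (\<integral>\<^sup>+z. F1 z \<partial>lborel)
      + 6 * (\<integral>\<^sup>+z. F3 z \<partial>lborel) + 4 * (\<integral>\<^sup>+z. F4 z \<partial>lborel)"
    by (simp add: nn_integral_add nn_integral_cmult)
  also have "\<dots> \<le> 2 * emeasure (Psi p) (E \<inter> \<Omega>) + 18 * X1 p \<Omega> + 6 * X3 p \<Omega> l + 4 * X4 p \<Omega> l"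
    unfolding i0 using i3
    by (intro add_mono mult_left_mono) (auto simp: X1_def X4_def F1_def F4_def E_def)
  finally have "(\<integral>\<^sup>+z\<in>U. ennreal (\<xi> z * \<theta> z) \<partial>lborel) \<le> (\<integral>\<^sup>+z. F2 z \<partial>lborel) +
      (2 * emeasure (Psi p) (E \<inter> \<Omega>) + 18 * X1 p \<Omega> + 6 * X3 p \<Omega> l + 4 * X4 p \<Omega> l + ennreal (96 * a))"
    by (simp add: add_left_mono add_right_mono)
  also have "(\<integral>\<^sup>+z. F2 z \<partial>lborel) = X2 p \<Omega> l"
    unfolding X2_def F2_def \<psi>_def E_def ..
  finally show ?thesis
    unfolding \<xi>_def \<theta>_def \<psi>_def E_def by (simp add: add_ac)
qed

theorem theorem1p3:
  shows "\<exists>C::real. C > 0 \<and>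
    (\<forall>(p :: complex poly) (\<Omega> :: complex set) (l :: complex \<Rightarrow> real).
       degree p > 0 \<longrightarrow> semialgebraic \<Omega> \<longrightarrow> open \<Omega> \<longrightarrow> smooth l \<longrightarrow> (\<forall>z. l z > 0) \<longrightarrow>
       arclength (level 1 p \<inter> closure \<Omega>) \<le>
         emeasure (Psi p) (sublevel 2 p \<inter> \<Omega>)
         + ennreal C * (X1 p \<Omega> + X2 p \<Omega> l + X3 p \<Omega> l + X4 p \<Omega> l + X5 \<Omega>))"
proof (intro exI[of _ 100] conjI allI impI)
  fix p :: "complex poly" and \<Omega> :: "complex set" and l :: "complex \<Rightarrow> real"
  assume p: "degree p > 0" and \<Omega>: "open \<Omega>" and l: "smooth l" "\<forall>z. l z > 0"
  show "arclength (level 1 p \<inter> closure \<Omega>) \<le> emeasure (Psi p) (sublevel 2 p \<inter> \<Omega>)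
         + ennreal 100 * (X1 p \<Omega> + X2 p \<Omega> l + X3 p \<Omega> l + X4 p \<Omega> l + X5 \<Omega>)"
  proof (cases "X5 \<Omega> = top")
    case True
    then show ?thesis by (simp add: ennreal_mult_top)
  next
    case False
    then obtain a where a: "X5 \<Omega> = ennreal a" "a \<ge> 0" by (cases "X5 \<Omega>") auto
    \<comment> \<open>Zeros of \<open>p\<close>, \<open>p'\<close> and \<open>p''\<close> are removed from \<open>\<Omega>\<close> so that all fields are continuously
      differentiable; being finite in number they do not change any length. The factor \<open>p''\<close> is
      left out when it is zero.\<close>
    define s where "s = p * pderiv p * (if pderiv (pderiv p) = 0 then 1 else pderiv (pderiv p))"
    have p': "p \<noteq> 0" "pderiv p \<noteq> 0" using p by (auto simp: pderiv_eq_0_iff)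
    define S where "S = {z. poly s z = 0}"
    have "s \<noteq> 0" using p' by (auto simp: s_def)
    then have S: "finite S" unfolding S_def by (rule poly_roots_finite)
    define U where "U = \<Omega> - S"
    have U: "open U" "U \<subseteq> \<Omega>"
      unfolding U_def using \<Omega> S by (auto intro: open_Diff finite_imp_closed)
    have nz: "poly p z \<noteq> 0" "poly (pderiv p) z \<noteq> 0"
        "pderiv (pderiv p) \<noteq> 0 \<Longrightarrow> poly (pderiv (pderiv p)) z \<noteq> 0" if "z \<in> U" for z
      using that by (auto simp: U_def S_def s_def split: if_splits)
    have frU: "frontier U \<subseteq> frontier \<Omega> \<union> S"
      using closure_mono[OF U(2)]
      unfolding frontier_def interior_open[OF U(1)] interior_open[OF \<Omega>] by (auto simp: U_def)
    have "arclength (frontier U) \<le> arclength (frontier \<Omega>) + arclength S"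
      using order_trans[OF arclength_mono[OF frU] arclength_Un_le] .
    then have len: "arclength (frontier U) \<le> ennreal a"
      using a arclength_countable[OF countable_finite[OF S]] by (simp add: X5_def)
    define N where "N = emeasure (Psi p) (sublevel 2 p \<inter> \<Omega>)"
    define B where "B = N + 18 * X1 p \<Omega> + X2 p \<Omega> l + 3 * X3 p \<Omega> l + 2 * X4 p \<Omega> l + 96 * X5 \<Omega>"
    define P where "P = poly p"
    define m where "m z = poly (pderiv p) z / P z" for z
    have ld: "log_deriv_on U P m"
      using log_deriv_on_poly[of U p] nz unfolding P_def m_def by blast
    define D where "D z h = cmod (P z) * Re (m z * h)" for z h
    have f: "C1on U (\<lambda>z. cmod (P z)) D"
      unfolding D_def by (rule C1on_cmod[OF ld])
    have gr: "gradient D z = of_real (cmod (P z)) * cnj (m z)" for z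
      by (simp add: gradient_def D_def complex_eq_iff)
    have ng: "norm (gradient D z) = cmod (poly (pderiv p) z)" if "z \<in> U" for z
      using nz(1)[OF that] by (simp add: gr norm_mult m_def norm_divide P_def)
    have flux: "(\<integral>\<^sup>+z\<in>U. ennreal (jump_profile' n (cmod (P z)) * norm (gradient D z)) \<partial>lborel) \<le> 2 * B" for n
    proof -
      define \<theta> where "\<theta> z = \<bar>Re (log_deriv p z * sgn (P z / poly (pderiv p) z))\<bar>" for z
      have [measurable]: "sublevel 2 p \<in> sets borel" "U \<in> sets borel"
        using U by (auto simp: sublevel_borel)
      have [measurable]: "poly q \<in> borel_measurable borel" for q :: "complex poly"
        by (intro borel_measurable_continuous_onI continuous_intros)
      have [measurable]: "ring_cutoff \<in> borel_measurable borel"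
        by (intro borel_measurable_continuous_onI continuous_intros)
      have [measurable]: "\<theta> \<in> borel_measurable borel"
        unfolding \<theta>_def[abs_def] sgn_eq P_def by measurable
      have "(\<integral>\<^sup>+z\<in>U. ennreal (jump_profile' n (cmod (P z)) * norm (gradient D z)) \<partial>lborel)
          = (\<integral>\<^sup>+z\<in>U. ennreal (jump_profile' n (cmod (P z)) * cmod (poly (pderiv p) z)) \<partial>lborel)"
        by (intro nn_integral_cong) (auto simp: indicator_def ng)
      also have "\<dots> \<le> (\<integral>\<^sup>+z\<in>U. ennreal (ring_cutoff (cmod (P z)) * \<theta> z
         + indicator (sublevel 2 p) z * (18 * cmod (poly (pderiv p) z))) \<partial>lborel) + ennreal (96 * a)"
        unfolding P_def \<theta>_def using nz by (intro level_flux_le p U len a) auto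
      also have "(\<integral>\<^sup>+z\<in>U. ennreal (ring_cutoff (cmod (P z)) * \<theta> z
         + indicator (sublevel 2 p) z * (18 * cmod (poly (pderiv p) z))) \<partial>lborel)
        \<le> (\<integral>\<^sup>+z. ennreal (ring_cutoff (cmod (P z)) * \<theta> z) * indicator U z
            + 18 * (ennreal (cmod (poly (pderiv p) z)) * indicator (sublevel 2 p \<inter> U) z) \<partial>lborel)"
      proof (intro nn_integral_mono)
        fix z
        have "0 \<le> ring_cutoff (cmod (P z)) * \<theta> z" by (simp add: \<theta>_def ring_cutoff_bounds)
        moreover have "ennreal (18 * cmod (poly (pderiv p) z)) = 18 * ennreal (cmod (poly (pderiv p) z))"
          by (simp add: ennreal_mult)
        ultimately show "ennreal (ring_cutoff (cmod (P z)) * \<theta> z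
         + indicator (sublevel 2 p) z * (18 * cmod (poly (pderiv p) z))) * indicator U z
          \<le> ennreal (ring_cutoff (cmod (P z)) * \<theta> z) * indicator U z
            + 18 * (ennreal (cmod (poly (pderiv p) z)) * indicator (sublevel 2 p \<inter> U) z)"
          by (auto simp: indicator_def ennreal_plus)
      qed
      also have "\<dots> = (\<integral>\<^sup>+z\<in>U. ennreal (ring_cutoff (cmod (P z)) * \<theta> z) \<partial>lborel)
          + 18 * (\<integral>\<^sup>+z\<in>sublevel 2 p \<inter> U. ennreal (cmod (poly (pderiv p) z)) \<partial>lborel)"
        unfolding P_def by (subst nn_integral_add, measurable, subst nn_integral_cmult) auto
      also have "(\<integral>\<^sup>+z\<in>sublevel 2 p \<inter> U. ennreal (cmod (poly (pderiv p) z)) \<partial>lborel) \<le> X1 p \<Omega>"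
        unfolding X1_def using U(2) by (intro nn_integral_mono) (auto simp: indicator_def)
      also have "(\<integral>\<^sup>+z\<in>U. ennreal (ring_cutoff (cmod (P z)) * \<theta> z) \<partial>lborel)
        \<le> 2 * N + 18 * X1 p \<Omega> + X2 p \<Omega> l + 6 * X3 p \<Omega> l + 4 * X4 p \<Omega> l + ennreal (96 * a)"
        unfolding P_def \<theta>_def N_def using nz l(2) by (intro cutoff_turning_le p U \<Omega> l len a) auto
      finally have "(\<integral>\<^sup>+z\<in>U. ennreal (jump_profile' n (cmod (P z)) * norm (gradient D z)) \<partial>lborel)
        \<le> 2 * N + 18 * X1 p \<Omega> + X2 p \<Omega> l + 6 * X3 p \<Omega> l + 4 * X4 p \<Omega> l + ennreal (96 * a)
          + 18 * X1 p \<Omega> + ennreal (96 * a)"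
        by (simp add: add_mono mult_left_mono)
      also have "\<dots> = 2 * N + 36 * X1 p \<Omega> + X2 p \<Omega> l + 6 * X3 p \<Omega> l + 4 * X4 p \<Omega> l + 192 * ennreal a"
      proof -
        have "ennreal (96 * a) + ennreal (96 * a) = 192 * ennreal a"
          using a(2) ennreal_mult[of 192 a] by (simp flip: ennreal_plus)
        moreover have "18 * X1 p \<Omega> + 18 * X1 p \<Omega> = 36 * X1 p \<Omega>"
          by (simp flip: distrib_right)
        moreover have "2 * N + 18 * X1 p \<Omega> + X2 p \<Omega> l + 6 * X3 p \<Omega> l + 4 * X4 p \<Omega> l + ennreal (96 * a)
            + 18 * X1 p \<Omega> + ennreal (96 * a)
          = 2 * N + (18 * X1 p \<Omega> + 18 * X1 p \<Omega>) + X2 p \<Omega> l + 6 * X3 p \<Omega> l + 4 * X4 p \<Omega> l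
            + (ennreal (96 * a) + ennreal (96 * a))"
          by (simp only: add_ac)
        ultimately show ?thesis by (simp only:)
      qed
      also have "\<dots> \<le> 2 * N + 36 * X1 p \<Omega> + 2 * X2 p \<Omega> l + 6 * X3 p \<Omega> l + 4 * X4 p \<Omega> l + 192 * ennreal a"
        by (intro add_mono) (auto simp: mult_2)
      also have "\<dots> = 2 * B"
        unfolding B_def a(1) distrib_left mult.assoc[symmetric] by simp
      finally show ?thesis .
    qed
    have "arclength (U \<inter> {z. cmod (P z) = 1}) \<le> B"
    proof (rule level_set_arclength_le[OF U(1) f _ jump_at_jump_profile])
      show "gradient D z \<noteq> 0" if "z \<in> U" for z
        using ng[OF that] nz(2)[OF that] by auto
      show "countable {z \<in> U. cmod (P z) = 1 \<and> Re z = t}" for t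
        by (rule countable_subset[OF _ countable_level_on_axis_lines(1)[OF p, of t]]) (auto simp: P_def)
      show "countable {z \<in> U. cmod (P z) = 1 \<and> Im z = t}" for t
        by (rule countable_subset[OF _ countable_level_on_axis_lines(2)[OF p, of t]]) (auto simp: P_def)
    qed (use flux in simp)
    moreover have "level 1 p \<inter> closure \<Omega> \<subseteq> (U \<inter> {z. cmod (P z) = 1}) \<union> (frontier \<Omega> \<union> S)"
      by (auto simp: level_def P_def U_def frontier_def interior_open \<Omega>)
    then have "arclength (level 1 p \<inter> closure \<Omega>)
        \<le> arclength (U \<inter> {z. cmod (P z) = 1}) + arclength (frontier \<Omega> \<union> S)"
      using order_trans[OF arclength_mono arclength_Un_le] by blast
    moreover have "arclength (frontier \<Omega> \<union> S) \<le> X5 \<Omega>"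
      using arclength_Un_le[of "frontier \<Omega>" S] arclength_countable[OF countable_finite[OF S]]
      by (simp add: X5_def)
    ultimately have "arclength (level 1 p \<inter> closure \<Omega>) \<le> B + X5 \<Omega>"
      by (meson add_mono order_trans)
    also have "\<dots> = N + (18 * X1 p \<Omega> + 1 * X2 p \<Omega> l + 3 * X3 p \<Omega> l + 2 * X4 p \<Omega> l + 97 * X5 \<Omega>)"
    proof -
      have "96 * X5 \<Omega> + X5 \<Omega> = 97 * X5 \<Omega>"
        using distrib_right[of 96 1 "X5 \<Omega>"] by simp
      then show ?thesis by (simp add: B_def add.assoc)
    qed
    also have "\<dots> \<le> N + (100 * X1 p \<Omega> + 100 * X2 p \<Omega> l + 100 * X3 p \<Omega> l + 100 * X4 p \<Omega> l + 100 * X5 \<Omega>)"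
      by (intro add_mono mult_right_mono) auto
    also have "\<dots> = N + ennreal 100 * (X1 p \<Omega> + X2 p \<Omega> l + X3 p \<Omega> l + X4 p \<Omega> l + X5 \<Omega>)"
      by (simp add: distrib_left)
    finally show ?thesis unfolding N_def .
  qed
qed simp

end
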